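(* Let $n\ge2$, let $\Gamma=([n],w)$ be a weighted hypergraph with non-negative weights, let $k\in\mathbb{Z}_{\ge1}$ and write $\rho_k=\rho_{(k,0,\ldots,0,-k)}$. Let $\rho\colon\mathrm{U}(n)\to\mathrm{U}(V)$ be an irreducible (unitary) representation of $\mathrm{U}(n)$, and let $\alpha$ be any eigenvalue of ${\cal L}(\Gamma,\rho)$ restricted to the orthogonal complement $\mathrm{TorInv}(\rho)^\perp$ (which is invariant under ${\cal L}(\Gamma,\rho)$). Then $\lambda_{\min}(\Gamma,\rho_k)\le\alpha$. In particular, if $\rho$ is unbalanced, then $\lambda_{\min}(\Gamma,\rho_k)\le\lambda_{\min}(\Gamma,\rho)$ for all $k\ge1$.
   Context: A weighted hypergraph $\Gamma=([n],w)$ assigns $w_B\ge0$ to every $B\subseteq[n]$. $\mathrm{U}_B\le\mathrm{U}(n)$ is the subgroup of unitaries coinciding with the identity outside the minor indexed by $B$, with Haar probability measure $\mu_B$. For a finite-dimensional representation $\rho$ on $V$, ${\cal L}(\Gamma,\rho)=\sum_Bw_B\big[I-\int_{\mathrm{U}_B}\rho(A)\,d\mu_B(A)\big]$, and $\lambda_{\min}(\Gamma,\rho)$ is its smallest eigenvalue. Irreducible representations $\rho_\mu$ of $\mathrm{U}(n)$ are indexed by non-increasing highest weights $\mu\in\mathbb{Z}^n$; $\rho_\mu$ is balanced if $\sum_i\mu_i=0$ and unbalanced otherwise. $T_n\le\mathrm{U}(n)$ is the subgroup of diagonal unitary matrices (the torus), and $\mathrm{TorInv}(\rho)=\{v\in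 V:\rho(A)v=v\ \forall A\in T_n\}$ is the torus-invariant subspace. *)

theory Defs
  imports "HOL-Analysis.Analysis"
begin

definition cadj :: "complex^'m^'n \<Rightarrow> complex^'n^'m" where
  "cadj A = (\<chi> i j. cnj (A $ j $ i))"

definition unitary_mat :: "complex^'n^'n \<Rightarrow> bool" where
  "unitary_mat A \<longleftrightarrow> A ** cadj A = mat 1 \<and> cadj A ** A = mat 1"

definition U_group :: "(complex^'n^'n) set" where
  "U_group = {A. unitary_mat A}"

definition U_sub :: "'n set \<Rightarrow> (complex^'n^'n) set" where
  "U_sub B = {A \<in> U_group. \<forall>i j. (i \<notin> B \<or> j \<notin> B) \<longrightarrow> A $ i $ j = (if i = j then 1 else 0)}"

definition torus :: "(complex^'n^'n) set" where
  "torus = {A \<in> U_group. \<forall>i j. i \<noteq> j \<longrightarrow> A $ i $ j = 0}"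

definition is_haar :: "'n set \<Rightarrow> (complex^'n^'n) measure \<Rightarrow> bool" where
  "is_haar B \<mu> \<longleftrightarrow> sets \<mu> = sets (restrict_space borel (U_sub B))
      \<and> emeasure \<mu> (space \<mu>) = 1
      \<and> (\<forall>g \<in> U_sub B. distr \<mu> \<mu> (\<lambda>A. g ** A) = \<mu>)"

definition haar_measure :: "'n set \<Rightarrow> (complex^'n^'n) measure" where
  "haar_measure B = (THE \<mu>. is_haar B \<mu>)"

definition unitary_rep :: "(complex^'n^'n \<Rightarrow> complex^'d^'d) \<Rightarrow> bool" where
  "unitary_rep \<rho> \<longleftrightarrow> (\<forall>A \<in> U_group. unitary_mat (\<rho> A))
      \<and> (\<forall>A \<in> U_group. \<forall>B \<in> U_group. \<rho> (A ** B) = \<rho> A ** \<rho> B)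
      \<and> continuous_on U_group \<rho>"

definition csubspace :: "(complex^'d) set \<Rightarrow> bool" where
  "csubspace W \<longleftrightarrow> 0 \<in> W \<and> (\<forall>u \<in> W. \<forall>v \<in> W. u + v \<in> W)
      \<and> (\<forall>c::complex. \<forall>v \<in> W. c *s v \<in> W)"

definition irreducible_rep :: "(complex^'n^'n \<Rightarrow> complex^'d^'d) \<Rightarrow> bool" where
  "irreducible_rep \<rho> \<longleftrightarrow> unitary_rep \<rho> \<and>
     (\<forall>W. csubspace W \<and> (\<forall>A \<in> U_group. \<forall>v \<in> W. \<rho> A *v v \<in> W) \<longrightarrow> W = {0} \<or> W = UNIV)"

definition is_weight :: "(complex^'n^'n \<Rightarrow> complex^'d^'d) \<Rightarrow> ('n \<Rightarrow> int) \<Rightarrow> bool" where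
  "is_weight \<rho> \<mu> \<longleftrightarrow> (\<exists>v. v \<noteq> 0 \<and>
      (\<forall>t \<in> torus. \<rho> t *v v = (\<Prod>i\<in>UNIV. (t $ i $ i) powi \<mu> i) *s v))"

definition lex_le :: "('n::linorder \<Rightarrow> int) \<Rightarrow> ('n \<Rightarrow> int) \<Rightarrow> bool" where
  "lex_le \<nu> \<mu> \<longleftrightarrow> \<nu> = \<mu> \<or> (\<exists>i. \<nu> i < \<mu> i \<and> (\<forall>j<i. \<nu> j = \<mu> j))"

definition highest_weight :: "(complex^('n::{finite,linorder})^('n::{finite,linorder}) \<Rightarrow> complex^'d^'d) \<Rightarrow> (('n::{finite,linorder}) \<Rightarrow> int) \<Rightarrow> bool" where
  "highest_weight \<rho> \<mu> \<longleftrightarrow> is_weight \<rho> \<mu> \<and> (\<forall>\<nu>. is_weight \<rho> \<nu> \<longrightarrow> lex_le \<nu> \<mu>)"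

definition hw_k :: "int \<Rightarrow> ('n::{finite,linorder} \<Rightarrow> int)" where
  "hw_k k = (\<lambda>i. if i = Min UNIV then k else if i = Max UNIV then - k else 0)"

definition unbalanced :: "(complex^('n::{finite,linorder})^('n::{finite,linorder}) \<Rightarrow> complex^'d^'d) \<Rightarrow> bool" where
  "unbalanced \<rho> \<longleftrightarrow> (\<exists>\<mu>. highest_weight \<rho> \<mu> \<and> (\<Sum>i\<in>UNIV. \<mu> i) \<noteq> 0)"

definition hyper_laplacian :: "('n::finite set \<Rightarrow> real) \<Rightarrow> (complex^'n^'n \<Rightarrow> complex^'d^'d) \<Rightarrow> complex^'d^'d" where
  "hyper_laplacian w \<rho> = (\<Sum>B\<in>UNIV. w B *\<^sub>R (mat 1 - (LINT A|haar_measure B. \<rho> A)))"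

definition c_eigenvalues :: "complex^'d^'d \<Rightarrow> complex set" where
  "c_eigenvalues M = {c. \<exists>v. v \<noteq> 0 \<and> M *v v = c *s v}"

definition lambda_min :: "('n::finite set \<Rightarrow> real) \<Rightarrow> (complex^'n^'n \<Rightarrow> complex^'d^'d) \<Rightarrow> real" where
  "lambda_min w \<rho> = Min (Re ` c_eigenvalues (hyper_laplacian w \<rho>))"

definition cinner :: "complex^'d \<Rightarrow> complex^'d \<Rightarrow> complex" where
  "cinner u v = (\<Sum>i\<in>UNIV. cnj (u $ i) * v $ i)"

definition tor_inv :: "(complex^'n^'n \<Rightarrow> complex^'d^'d) \<Rightarrow> (complex^'d) set" where
  "tor_inv \<rho> = {v. \<forall>A \<in> torus. \<rho> A *v v = v}"

definition orth_compl :: "(complex^'d) set \<Rightarrow> (complex^'d) set" where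
  "orth_compl S = {v. \<forall>u \<in> S. cinner u v = 0}"

end

theory Submission
  imports Defs "HOL-Computational_Algebra.Polynomial"
begin

text \<open>
  Averaging over \<open>U_sub B\<close> gives the orthogonal projection onto the \<open>U_sub B\<close>-invariant vectors. An
  eigenvector that is not torus invariant can be projected to a vector on which some coordinate circle
  \<open>U_sub {i}\<close> has no invariants; every average with \<open>i \<in> B\<close> kills it, so its eigenvalue is at
  least the sum of the weights of the \<open>B\<close> containing \<open>i\<close>. Conversely a vector fixed by
  \<open>U_sub (- {i})\<close> has Rayleigh quotient at most this sum. Hence it suffices that the representation
  of highest weight \<open>(k, 0, \<dots>, 0, - k)\<close> has a nonzero vector fixed by \<open>U_sub (- {i})\<close>.

  Such a vector is found through the matrix coefficient of the highest weight vector \<open>v\<close>. The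
  representation extends to the general linear group by convolution with a polynomial class function
  concentrated near the identity, and \<open>v\<close> is fixed by the root subgroups allowed by the weight, so an
  LU decomposition gives \<open>\<langle>v, \<rho>(g) v\<rangle> = (g\<^sub>1\<^sub>1 (g\<^sup>-\<^sup>1)\<^sub>n\<^sub>n)\<^sup>k \<langle>v, v\<rangle>\<close>. For the Hadamard
  reflection \<open>h\<close> in the first and last coordinates and \<open>A\<close> fixing the first basis vector,
  \<open>g = h A h\<close> yields \<open>\<bar>(1 + A\<^sub>n\<^sub>n) / 2\<bar>\<^sup>2\<^sup>k \<ge> 0\<close>; its integral is positive, so the average of
  \<open>\<rho>(h) v\<close> does not vanish.
\<close>

subsection \<open>Adjoints and the Hermitian inner product\<close>

text \<open>The representation is given only on unitary matrices and \<open>highest_weight\<close>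
  speaks only of torus weights, so raising operators and the complexified group have to be replaced;
  polynomiality does this. Along \<open>dg i z\<close> the extension has Laurent polynomial entries,
  and Laurent polynomials agreeing on the unit circle agree for all nonzero \<open>z\<close>:
  identities known for unitary diagonal matrices continue to invertible ones. Along
  \<open>tv i j s\<close> the image of a weight vector is polynomial in \<open>s\<close>, and a
  nonzero coefficient of \<open>s^r\<close> is again a weight vector, its weight raised by
  \<open>r\<close> at \<open>i\<close> and lowered by \<open>r\<close> at \<open>j\<close>. If no
  such weight with \<open>r \<ge> 1\<close> occurs, the vector is fixed. The reflection is forced:
  the group fixing the first basis vector contains the last coordinate circle, which acts on the
  highest weight vector with weight \<open>- k\<close>, so without the reflection its average is
  zero. The LU pivots vanish when the last diagonal entry of \<open>A\<close> is -1; such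
  \<open>A\<close> are reached by a limit. The coordinate \<open>i\<close> in the weight sum is
  dictated by the other representation, so a fixed vector is needed for every \<open>i\<close>;
  permutation matrices provide it.\<close>

lemma cadj_nth [simp]: "cadj A $ i $ j = cnj (A $ j $ i)"
  by (simp add: cadj_def)

lemma cadj_cadj [simp]: "cadj (cadj A) = A"
  by (simp add: vec_eq_iff)

lemma cadj_mat_1 [simp]: "cadj (mat 1) = mat 1"
  by (simp add: vec_eq_iff mat_def)

lemma cadj_mult: "cadj (A ** B) = cadj B ** cadj A"
  by (simp add: vec_eq_iff matrix_matrix_mult_def mult.commute)

lemma cadj_diff: "cadj (A - B) = cadj A - cadj B"
  by (simp add: vec_eq_iff)

lemma cadj_scaleR: "cadj (r *\<^sub>R A) = r *\<^sub>R cadj A"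
  by (simp add: vec_eq_iff)

lemma cadj_sum: "cadj (\<Sum>x\<in>S. f x) = (\<Sum>x\<in>S. cadj (f x))"
  by (simp add: vec_eq_iff)

lemma matrix_vector_mult_nth: "(A *v x) $ i = (\<Sum>j\<in>UNIV. A $ i $ j * x $ j)"
  by (simp add: matrix_vector_mult_def)

lemma matrix_mult_nth: "(A ** B) $ i $ j = (\<Sum>k\<in>UNIV. A $ i $ k * B $ k $ j)"
  by (simp add: matrix_matrix_mult_def)

lemma mat_1_nth: "mat 1 $ i $ j = (if i = j then 1 else 0)"
  by (simp add: mat_def)

lemma scaleR_eq_vec_scale: "r *\<^sub>R v = complex_of_real r *s v"
  unfolding vec_eq_iff vector_scaleR_component vector_smult_component by (simp add: scaleR_conv_of_real)

lemma matrix_vector_mult_scale: "(A :: complex^'n^'m) *v (c *s x) = c *s (A *v x)"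
  by (simp add: vec_eq_iff matrix_vector_mult_nth sum_distrib_left algebra_simps)

lemma matrix_vector_mult_sum: "(A :: complex^'n^'m) *v (\<Sum>x\<in>S. f x) = (\<Sum>x\<in>S. A *v f x)"
  by (induction S rule: infinite_finite_induct) (auto simp: matrix_vector_right_distrib)

lemma sum_matrix_vector_mult: "(\<Sum>x\<in>S. f x) *v u = (\<Sum>x\<in>S. f x *v (u :: complex^'n))"
  by (induction S rule: infinite_finite_induct) (auto simp: matrix_vector_mult_add_rdistrib)

lemma scaleR_matrix_vector_mult: "(r *\<^sub>R A) *v (u :: complex^'n) = r *\<^sub>R (A *v u)"
  by (simp add: vec_eq_iff matrix_vector_mult_nth scaleR_right.sum)

lemma cinner_add_right: "cinner u (v + w) = cinner u v + cinner u w"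
  by (simp add: cinner_def algebra_simps sum.distrib)

lemma cinner_add_left: "cinner (u + v) w = cinner u w + cinner v w"
  by (simp add: cinner_def algebra_simps sum.distrib)

lemma cinner_diff_right: "cinner u (v - w) = cinner u v - cinner u w"
  by (simp add: cinner_def algebra_simps sum_subtractf)

lemma cinner_diff_left: "cinner (u - v) w = cinner u w - cinner v w"
  by (simp add: cinner_def algebra_simps sum_subtractf)

lemma cinner_scale_right: "cinner u (c *s v) = c * cinner u v"
  by (simp add: cinner_def sum_distrib_left algebra_simps)

lemma cinner_scale_left: "cinner (c *s u) v = cnj c * cinner u v"
  by (simp add: cinner_def sum_distrib_left algebra_simps)

lemma cinner_scaleR_right: "cinner u (r *\<^sub>R v) = of_real r * cinner u v"
  by (simp add: scaleR_eq_vec_scale cinner_scale_right)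

lemma cinner_zero [simp]: "cinner u 0 = 0" "cinner 0 u = 0"
  by (simp_all add: cinner_def)

lemma cinner_sum_right: "cinner u (\<Sum>x\<in>S. f x) = (\<Sum>x\<in>S. cinner u (f x))"
  by (induction S rule: infinite_finite_induct) (auto simp: cinner_add_right)

lemma cnj_cinner: "cnj (cinner u v) = cinner v u"
  by (simp add: cinner_def mult.commute)

lemma cinner_cadj_left: "cinner (cadj A *v u) v = cinner u (A *v v)"
proof -
  have "cinner (cadj A *v u) v = (\<Sum>i\<in>UNIV. \<Sum>j\<in>UNIV. A $ j $ i * cnj (u $ j) * v $ i)"
    by (simp add: cinner_def matrix_vector_mult_nth sum_distrib_right)
  also have "\<dots> = (\<Sum>j\<in>UNIV. \<Sum>i\<in>UNIV. A $ j $ i * cnj (u $ j) * v $ i)"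
    by (rule sum.swap)
  also have "\<dots> = cinner u (A *v v)"
    by (simp add: cinner_def matrix_vector_mult_nth sum_distrib_left algebra_simps)
  finally show ?thesis .
qed

lemma inner_eq_Re_cinner: "u \<bullet> v = Re (cinner u v)"
  by (simp add: inner_vec_def cinner_def inner_complex_def)

lemma cinner_self: "cinner v v = of_real ((norm v)\<^sup>2)"
proof -
  have "Im (cinner v v) = 0" by (simp add: cinner_def mult.commute)
  moreover have "Re (cinner v v) = (norm v)\<^sup>2"
    by (simp add: inner_eq_Re_cinner[symmetric] power2_norm_eq_inner)
  ultimately show ?thesis by (simp add: complex_eq_iff)
qed

lemma cinner_self_eq_0 [simp]: "cinner v v = 0 \<longleftrightarrow> v = 0"
  by (simp add: cinner_self)

lemma unitary_matD: "unitary_mat A \<Longrightarrow> A ** cadj A = mat 1" "unitary_mat A \<Longrightarrow> cadj A ** A = mat 1"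
  by (auto simp: unitary_mat_def)

lemma cinner_unitary: "unitary_mat A \<Longrightarrow> cinner (A *v u) (A *v v) = cinner u v"
  by (metis cinner_cadj_left matrix_vector_mul_assoc matrix_vector_mul_lid unitary_matD(2))

lemma norm_unitary_mult: "unitary_mat A \<Longrightarrow> norm (A *v v) = norm v"
  by (simp add: norm_eq_sqrt_inner inner_eq_Re_cinner cinner_unitary)

subsection \<open>Hermitian matrices\<close>

lemma cinner_hermitian:
  assumes "cadj M = M" shows "cinner (M *v u) v = cinner u (M *v v)"
  using cinner_cadj_left[of M u v] assms by simp

text \<open>Along the line \<open>v + t M v\<close> the form is \<open>2 t a + t^2 b\<close> with
  \<open>a\<close> the squared norm of \<open>M v\<close>; a small negative \<open>t\<close> makes
  this negative unless \<open>a = 0\<close>.\<close>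

lemma hermitian_psd_kernel:
  assumes "cadj M = M" and nonneg: "\<And>u. 0 \<le> Re (cinner u (M *v u))" and "cinner v (M *v v) = 0"
  shows "M *v v = 0"
proof (rule ccontr)
  assume "M *v v \<noteq> 0"
  define x where "x = M *v v"
  define a where "a = (norm x)\<^sup>2"
  define b where "b = Re (cinner x (M *v x))"
  have a: "a > 0" using \<open>M *v v \<noteq> 0\<close> by (simp add: a_def x_def)
  have b: "b \<ge> 0" unfolding b_def by (rule nonneg)
  have "0 \<le> Re (cinner (v + of_real t *s x) (M *v (v + of_real t *s x)))" for t :: real
    by (rule nonneg)
  moreover have "Re (cinner (v + of_real t *s x) (M *v (v + of_real t *s x))) = 2 * t * a + t\<^sup>2 * b" for t :: real
  proof -
    have "cinner v (M *v x) = of_real a"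
      using cinner_hermitian[OF assms(1), of v x] by (simp add: x_def a_def cinner_self)
    moreover have "cinner x (M *v v) = of_real a"
      by (simp add: x_def a_def cinner_self)
    ultimately show ?thesis
      using assms(3)
      by (simp add: matrix_vector_right_distrib matrix_vector_mult_scale cinner_add_left cinner_add_right
            cinner_scale_left cinner_scale_right b_def power2_eq_square algebra_simps)
  qed
  ultimately have *: "0 \<le> 2 * t * a + t\<^sup>2 * b" for t by metis
  \<comment> \<open>The shift by 1 keeps the denominator positive when \<open>b = 0\<close>; at
    \<open>t = - a / c\<close> the linear term dominates.\<close>
  define c where "c = b + 1"
  have c: "c > 0" and bc: "b = c - 1" using b by (auto simp: c_def)
  have "2 * (- a / c) * a + (- a / c)\<^sup>2 * b = - (a\<^sup>2 / c\<^sup>2 * (c + 1))"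
    using c by (simp add: bc field_simps power2_eq_square)
  moreover have "a\<^sup>2 / c\<^sup>2 * (c + 1) > 0" using a c by simp
  ultimately show False using *[of "- a / c"] by simp
qed

lemma continuous_on_matrix_vector_mult [continuous_intros]:
  assumes "continuous_on S f" "continuous_on S g"
  shows "continuous_on S (\<lambda>x. (f x :: complex^'n^'m) *v g x)"
  unfolding matrix_vector_mult_def by (intro continuous_intros assms)

lemma continuous_on_matrix_matrix_mult [continuous_intros]:
  assumes "continuous_on S f" "continuous_on S g"
  shows "continuous_on S (\<lambda>x. (f x :: complex^'n^'m) ** (g x :: complex^'k^'n))"
  unfolding matrix_matrix_mult_def by (intro continuous_intros assms)

lemma continuous_on_cinner [continuous_intros]:
  assumes "continuous_on S f" "continuous_on S g"
  shows "continuous_on S (\<lambda>x. cinner (f x) (g x))"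
  unfolding cinner_def by (intro continuous_intros assms)

lemma continuous_on_cadj [continuous_intros]:
  assumes "continuous_on S f"
  shows "continuous_on S (\<lambda>x. cadj (f x))"
  unfolding cadj_def by (intro continuous_intros assms)

text \<open>The form attains its minimum \<open>m\<close> on the compact unit sphere. Then
  \<open>M - m\<close> is positive semidefinite and its form vanishes at the minimiser, so
  \<open>hermitian_psd_kernel\<close> turns the minimiser into an eigenvector.\<close>

lemma hermitian_min_eigenvector:
  fixes M :: "complex^'d^'d"
  assumes M: "cadj M = M"
  obtains m v where "v \<noteq> 0" "M *v v = of_real m *s v"
    "\<And>u. m * (norm u)\<^sup>2 \<le> Re (cinner u (M *v u))"
proof -
  have "sphere (0::complex^'d) 1 \<noteq> {}" by (simp add: sphere_eq_empty)
  moreover have "continuous_on (sphere (0::complex^'d) 1) (\<lambda>u. Re (cinner u (M *v u)))"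
    by (intro continuous_intros)
  ultimately obtain v where v: "v \<in> sphere 0 1"
    and min: "\<And>u. u \<in> sphere 0 1 \<Longrightarrow> Re (cinner v (M *v v)) \<le> Re (cinner u (M *v u))"
    using continuous_attains_inf[of "sphere 0 1" "\<lambda>u. Re (cinner u (M *v u))"] by auto
  define m where "m = Re (cinner v (M *v v))"
  have le: "m * (norm u)\<^sup>2 \<le> Re (cinner u (M *v u))" for u
  proof (cases "u = 0")
    case False
    define x where "x = of_real (inverse (norm u)) *s u"
    have "norm x = 1" using False by (simp add: x_def scaleR_eq_vec_scale[symmetric] del: of_real_inverse)
    then have "m \<le> Re (cinner x (M *v x))" using min by (simp add: m_def)
    also have "\<dots> = Re (cinner u (M *v u)) / (norm u)\<^sup>2"
      by (simp add: x_def matrix_vector_mult_scale cinner_scale_left cinner_scale_right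
            power2_eq_square divide_simps)
    finally show ?thesis using False by (simp add: field_simps)
  qed simp
  define K where "K = M - m *\<^sub>R mat 1"
  have Kv: "K *v u = M *v u - of_real m *s u" for u
    by (simp add: K_def matrix_vector_mult_diff_rdistrib scaleR_matrix_vector_mult scaleR_eq_vec_scale)
  have "Im (cinner v (M *v v)) = 0"
    using cnj_cinner[of v "M *v v"] cinner_hermitian[OF M, of v v] by (auto simp: complex_eq_iff)
  then have "cinner v (M *v v) = of_real m" by (simp add: m_def complex_eq_iff)
  then have "cinner v (K *v v) = 0"
    using v by (simp add: Kv cinner_diff_right cinner_scale_right cinner_self)
  moreover have "0 \<le> Re (cinner u (K *v u))" for u
    using le[of u] by (simp add: Kv cinner_diff_right cinner_scale_right cinner_self)
  moreover have "cadj K = K" by (simp add: K_def cadj_diff cadj_scaleR M)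
  ultimately have "K *v v = 0" using hermitian_psd_kernel[of K v] by simp
  then have "M *v v = of_real m *s v" by (simp add: Kv)
  moreover have "v \<noteq> 0" using v by auto
  ultimately show thesis using that le by blast
qed

lemma hermitian_eigenvalue_real:
  assumes M: "cadj M = M" and "M *v v = c *s v" "v \<noteq> 0"
  shows "c = of_real (Re c)"
proof -
  have "cnj c * cinner v v = c * cinner v v"
    using cinner_hermitian[OF M, of v v] by (simp add: assms(2) cinner_scale_left cinner_scale_right)
  then have "cnj c = c" using assms(3) by simp
  then show ?thesis by (simp add: complex_eq_iff)
qed

text \<open>\<open>lambda_min\<close> is a \<open>Min\<close>, which is meaningful only for finite
  nonempty sets. Eigenvectors chosen for distinct eigenvalues are nonzero and pairwise orthogonal,
  hence finite in number.\<close>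

lemma hermitian_finite_eigenvalues:
  fixes M :: "complex^'d^'d"
  assumes M: "cadj M = M"
  shows "finite (c_eigenvalues M)"
proof -
  define f where "f c = (SOME v. v \<noteq> 0 \<and> M *v v = c *s v)" for c
  have f: "f c \<noteq> 0 \<and> M *v f c = c *s f c" if "c \<in> c_eigenvalues M" for c
    unfolding f_def by (rule someI_ex) (use that in \<open>simp add: c_eigenvalues_def\<close>)
  have orth: "f c \<bullet> f d = 0" if "c \<in> c_eigenvalues M" "d \<in> c_eigenvalues M" "c \<noteq> d" for c d
  proof -
    have "cnj c * cinner (f c) (f d) = d * cinner (f c) (f d)"
      using cinner_hermitian[OF M, of "f c" "f d"] f[OF that(1)] f[OF that(2)]
      by (simp add: cinner_scale_left cinner_scale_right)
    moreover have "cnj c = c"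
      using hermitian_eigenvalue_real[OF M, of "f c" c] f[OF that(1)]
      by (auto simp: complex_eq_iff)
    ultimately show ?thesis using that(3) by (simp add: inner_eq_Re_cinner)
  qed
  have inj: "inj_on f (c_eigenvalues M)"
  proof (rule inj_onI, rule ccontr)
    fix c d assume "c \<in> c_eigenvalues M" "d \<in> c_eigenvalues M" "f c = f d" "c \<noteq> d"
    then have "f c \<bullet> f c = 0" using orth[of c d] by simp
    then show False using f[OF \<open>c \<in> c_eigenvalues M\<close>] by simp
  qed
  have "pairwise orthogonal (f ` c_eigenvalues M)"
    by (auto simp: pairwise_def orthogonal_def intro!: orth)
  then have "finite (f ` c_eigenvalues M)" by (rule pairwise_orthogonal_imp_finite)
  then show ?thesis using inj by (rule finite_imageD)
qed

subsection \<open>Invariance of Lebesgue measure under isometries\<close>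

lemma nn_integral_lborel_translate:
  fixes h :: "'a::euclidean_space \<Rightarrow> ennreal"
  assumes [measurable]: "h \<in> borel_measurable borel"
  shows "(\<integral>\<^sup>+ y. h (c + y) \<partial>lborel) = (\<integral>\<^sup>+ y. h y \<partial>lborel)"
proof -
  have "(\<integral>\<^sup>+ y. h y \<partial>lborel) = (\<integral>\<^sup>+ y. h y \<partial>(distr lborel borel ((+) c)))"
    by (simp add: lborel_distr_plus)
  also have "\<dots> = (\<integral>\<^sup>+ y. h (c + y) \<partial>lborel)"
    by (subst nn_integral_distr) auto
  finally show ?thesis by simp
qed

text \<open>Integrating \<open>1\<^sub>A(T x) 1\<^sub>K(y)\<close> over the product, where \<open>K\<close> is the unit ball, the two
  translation invariances exchange the roles of \<open>A\<close> and its preimage.\<close>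

lemma emeasure_lborel_orthogonal_vimage:
  fixes T :: "'a::euclidean_space \<Rightarrow> 'a"
  assumes T: "orthogonal_transformation T" and A[measurable]: "A \<in> sets borel"
  shows "emeasure lborel (T -` A) = emeasure lborel A"
proof -
  define K where "K = cball (0::'a) 1"
  have K[measurable]: "K \<in> sets borel" by (simp add: K_def)
  have lin: "linear T" using T by (rule orthogonal_transformation_linear)
  have [measurable]: "T \<in> borel_measurable borel"
    using lin by (intro borel_measurable_continuous_onI linear_continuous_on) (simp add: linear_conv_bounded_linear)
  obtain S where S: "\<And>y. T (S y) = y" using orthogonal_transformation_surj[OF T] by (metis surjD)
  have KT: "indicator K (- T x) = (indicator K x :: ennreal)" for x
    using T by (simp add: K_def indicator_def orthogonal_transformation)
  have "emeasure lborel (T -` A) * emeasure lborel K =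
      (\<integral>\<^sup>+ x. indicator A (T x) * emeasure lborel K \<partial>lborel)"
  proof -
    have "T -` A \<in> sets borel" using measurable_sets_borel[of T borel A] by simp
    then show ?thesis
      by (simp add: nn_integral_multc nn_integral_indicator[symmetric] indicator_vimage[symmetric] del: nn_integral_indicator)
  qed
  also have "\<dots> = (\<integral>\<^sup>+ x. \<integral>\<^sup>+ y. indicator A (T x) * indicator K y \<partial>lborel \<partial>lborel)"
    by (simp add: nn_integral_cmult)
  also have "\<dots> = (\<integral>\<^sup>+ x. \<integral>\<^sup>+ y. indicator A (T x) * indicator K (- T x + y) \<partial>lborel \<partial>lborel)"
  proof (rule nn_integral_cong)
    fix x
    show "(\<integral>\<^sup>+ y. indicator A (T x) * indicator K y \<partial>lborel)
        = (\<integral>\<^sup>+ y. indicator A (T x) * indicator K (- T x + y) \<partial>lborel)"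
      by (rule nn_integral_lborel_translate[symmetric, of "\<lambda>y. indicator A (T x) * indicator K y"]) measurable
  qed
  also have "\<dots> = (\<integral>\<^sup>+ y. \<integral>\<^sup>+ x. indicator A (T x) * indicator K (- T x + y) \<partial>lborel \<partial>lborel)"
    by (rule lborel_pair.Fubini') measurable
  also have "\<dots> = (\<integral>\<^sup>+ y. \<integral>\<^sup>+ x. indicator A (T (S y + x)) * indicator K (- T (S y + x) + y) \<partial>lborel \<partial>lborel)"
  proof (rule nn_integral_cong)
    fix y
    show "(\<integral>\<^sup>+ x. indicator A (T x) * indicator K (- T x + y) \<partial>lborel)
        = (\<integral>\<^sup>+ x. indicator A (T (S y + x)) * indicator K (- T (S y + x) + y) \<partial>lborel)"
      by (rule nn_integral_lborel_translate[symmetric, of "\<lambda>x. indicator A (T x) * indicator K (- T x + y)"]) measurable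
  qed
  also have "\<dots> = (\<integral>\<^sup>+ y. \<integral>\<^sup>+ x. indicator A (y + T x) * indicator K x \<partial>lborel \<partial>lborel)"
    by (simp add: linear_add[OF lin] S KT)
  also have "\<dots> = (\<integral>\<^sup>+ x. \<integral>\<^sup>+ y. indicator A (y + T x) * indicator K x \<partial>lborel \<partial>lborel)"
    by (rule lborel_pair.Fubini') measurable
  also have "\<dots> = (\<integral>\<^sup>+ x. emeasure lborel A * indicator K x \<partial>lborel)"
  proof (intro nn_integral_cong)
    fix x
    have "(\<integral>\<^sup>+ y. indicator A (T x + y) \<partial>lborel) = emeasure lborel A"
      by (subst nn_integral_lborel_translate) auto
    then show "(\<integral>\<^sup>+ y. indicator A (y + T x) * indicator K x \<partial>lborel) = emeasure lborel A * indicator K x"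
      by (simp add: nn_integral_multc add.commute)
  qed
  also have "\<dots> = emeasure lborel A * emeasure lborel K"
    by (simp add: nn_integral_cmult)
  finally have eq: "emeasure lborel (T -` A) * emeasure lborel K = emeasure lborel A * emeasure lborel K" .
  have "emeasure lborel K \<noteq> \<infinity>"
    using emeasure_bounded_finite[of K] by (simp add: K_def)
  moreover have "emeasure lborel K \<noteq> 0"
    using content_cball_pos[of 1 "0::'a"] by (auto simp: K_def measure_def)
  ultimately show ?thesis
    using eq by (metis mult_divide_eq_ennreal infinity_ennreal_def)
qed

subsection \<open>Gram--Schmidt\<close>

lemma finite_linorder_induct [case_names less]:
  fixes j :: "'n::{finite,linorder}"
  assumes "\<And>j. (\<And>i. i < j \<Longrightarrow> P i) \<Longrightarrow> P j"
  shows "P j"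
proof (induction "card {..<j}" arbitrary: j rule: less_induct)
  case less
  show ?case
  proof (rule assms)
    fix i assume "i < j"
    then have "card {..<i} < card {..<j}" by (intro psubset_card_mono) auto
    then show "P i" by (rule less)
  qed
qed

text \<open>Columns are processed in the order of the index type. On a dependent column the factor
  is \<open>1 / 0 = 0\<close>, so the recursion is total.\<close>

function gs :: "complex^('n::{finite,linorder})^('n::{finite,linorder}) \<Rightarrow> 'n \<Rightarrow> complex^('n::{finite,linorder})" where
  "gs Z j = (let u = column j Z - (\<Sum>i\<in>{..<j}. cinner (gs Z i) (column j Z) *s gs Z i)
     in (1 / norm u) *\<^sub>R u)"
  by auto
termination
  by (relation "Wellfounded.measure (\<lambda>(Z, j). card {..<j})") (auto intro!: psubset_card_mono)

declare gs.simps [simp del]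

text \<open>The vector before normalisation is kept apart because its nonvanishing is what
  invertibility has to supply.\<close>

definition gsu :: "complex^('n::{finite,linorder})^('n::{finite,linorder}) \<Rightarrow> 'n \<Rightarrow> complex^('n::{finite,linorder})" where
  "gsu Z j = column j Z - (\<Sum>i\<in>{..<j}. cinner (gs Z i) (column j Z) *s gs Z i)"

lemma gs_eq: "gs Z j = (1 / norm (gsu Z j)) *\<^sub>R gsu Z j"
  by (subst gs.simps) (simp add: gsu_def Let_def)

lemma column_mult: "column j (A ** B) = A *v column j B"
  by (simp add: vec_eq_iff column_def matrix_mult_nth matrix_vector_mult_nth)

text \<open>The recursion uses only linear combinations, inner products and norms, and a unitary
  factor respects all of them.\<close>

lemma gsu_gs_equivariant:
  assumes g: "unitary_mat g"
  shows "gsu (g ** Z) j = g *v gsu Z j \<and> gs (g ** Z) j = g *v gs Z j"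
proof (induction j rule: finite_linorder_induct)
  case (less j)
  have "gsu (g ** Z) j = g *v gsu Z j"
    using less by (simp add: gsu_def column_mult cinner_unitary[OF g] matrix_vector_mult_diff_distrib
        matrix_vector_mult_sum matrix_vector_mult_scale)
  then show ?case
    by (simp add: gs_eq norm_unitary_mult[OF g] scaleR_eq_vec_scale matrix_vector_mult_scale)
qed

text \<open>Earlier vectors involve only earlier columns, so the coefficient 1 at \<open>j\<close>
  survives the subtraction; this forbids \<open>gsu Z j = 0\<close> for invertible
  \<open>Z\<close>.\<close>

lemma gsu_in_range:
  shows "\<exists>x. gsu Z j = Z *v x \<and> x $ j = 1 \<and> (\<forall>i>j. x $ i = 0)"
proof (induction j rule: finite_linorder_induct)
  case (less j)
  have "\<exists>x. gs Z i = Z *v x \<and> (\<forall>p>i. x $ p = 0)" if i: "i < j" for i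
  proof -
    obtain x where "gsu Z i = Z *v x" "\<forall>p>i. x $ p = 0" using less[OF i] by auto
    then show ?thesis
      by (intro exI[of _ "(1 / norm (gsu Z i)) *\<^sub>R x"])
         (simp add: gs_eq scaleR_eq_vec_scale matrix_vector_mult_scale)
  qed
  then obtain X where X: "\<And>i. i < j \<Longrightarrow> gs Z i = Z *v X i" "\<And>i p. i < j \<Longrightarrow> i < p \<Longrightarrow> X i $ p = 0"
    by metis
  define y where "y = axis j 1 - (\<Sum>i\<in>{..<j}. cinner (gs Z i) (column j Z) *s X i)"
  have "column j Z = Z *v axis j 1" 
    by (simp add: vec_eq_iff column_def matrix_vector_mult_nth axis_def if_distrib cong: if_cong)
  then have "gsu Z j = Z *v y"
    unfolding gsu_def y_def using X(1)
    by (simp add: matrix_vector_mult_diff_distrib matrix_vector_mult_sum matrix_vector_mult_scale)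
  moreover have "y $ j = 1" using X(2) by (simp add: y_def)
  moreover have "\<forall>i>j. y $ i = 0" using X(2) by (auto simp: y_def axis_def)
  ultimately show ?case by blast
qed

lemma gsu_nonzero:
  assumes "invertible Z" shows "gsu Z j \<noteq> 0"
proof
  assume *: "gsu Z j = 0"
  obtain x where x: "gsu Z j = Z *v x" "x $ j = 1" using gsu_in_range by metis
  obtain Y where "Y ** Z = mat 1" using assms invertible_def by blast
  then have "x = Y *v (Z *v x)" by (simp add: matrix_vector_mul_assoc)
  with x * show False by simp
qed

lemma gs_orthonormal:
  assumes Z: "invertible Z"
  shows "norm (gs Z j) = 1 \<and> (\<forall>i<j. cinner (gs Z i) (gs Z j) = 0)"
proof (induction j rule: finite_linorder_induct)
  case (less j)
  have orth: "cinner (gs Z p) (gs Z i) = (if p = i then 1 else 0)" if "i < j" "p < j" for i p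
  proof -
    consider "p < i" | "p = i" | "i < p" by force
    then show ?thesis
    proof cases
      case 3 then show ?thesis using less[OF that(2)] cnj_cinner[of "gs Z i" "gs Z p"] by auto
    qed (use less that cinner_self[of "gs Z i"] in auto)
  qed
  have "cinner (gs Z i) (gsu Z j) = 0" if i: "i < j" for i
  proof -
    have "(\<Sum>p\<in>{..<j}. cinner (gs Z p) (column j Z) * cinner (gs Z i) (gs Z p))
        = (\<Sum>p\<in>{..<j}. if i = p then cinner (gs Z p) (column j Z) else 0)"
      using i by (intro sum.cong) (auto simp: orth)
    also have "\<dots> = cinner (gs Z i) (column j Z)" using i by simp
    finally show ?thesis
      by (simp add: gsu_def cinner_diff_right cinner_sum_right cinner_scale_right)
  qed
  then show ?case
    using gsu_nonzero[OF Z, of j] by (auto simp: gs_eq[of Z j] cinner_scaleR_right)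
qed

definition gs_mat :: "complex^('n::{finite,linorder})^('n::{finite,linorder}) \<Rightarrow> complex^('n::{finite,linorder})^('n::{finite,linorder})" where
  "gs_mat Z = (\<chi> p j. gs Z j $ p)"

lemma gs_mat_unitary:
  assumes "invertible Z" shows "unitary_mat (gs_mat Z)"
proof -
  have "cinner (gs Z i) (gs Z j) = (if i = j then 1 else 0)" for i j
  proof -
    consider "j < i" | "j = i" | "i < j" by force
    then show ?thesis
    proof cases
      case 1 then show ?thesis using gs_orthonormal[OF assms] cnj_cinner[of "gs Z j" "gs Z i"] by auto
    next
      case 2 then show ?thesis using gs_orthonormal[OF assms] cinner_self[of "gs Z i"] by auto
    next
      case 3 then show ?thesis using gs_orthonormal[OF assms] by auto
    qed
  qed
  then have "cadj (gs_mat Z) ** gs_mat Z = mat 1"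
    by (simp add: vec_eq_iff matrix_mult_nth gs_mat_def mat_1_nth cinner_def)
  then show ?thesis by (simp add: unitary_mat_def matrix_left_right_inverse)
qed

lemma gs_mat_equivariant: "unitary_mat g \<Longrightarrow> gs_mat (g ** Z) = g ** gs_mat Z"
  by (simp add: vec_eq_iff gs_mat_def gsu_gs_equivariant matrix_mult_nth matrix_vector_mult_nth)

text \<open>Ensures that Gram--Schmidt lands in \<open>U_sub B\<close>: columns outside
  \<open>B\<close> stay basis vectors, and the others never acquire a component along them.\<close>

lemma gs_block:
  assumes Z: "\<And>p q. p \<notin> B \<or> q \<notin> B \<Longrightarrow> Z $ p $ q = (if p = q then 1 else 0)"
  shows "(j \<notin> B \<longrightarrow> gs Z j = axis j 1) \<and> (j \<in> B \<longrightarrow> (\<forall>p. p \<notin> B \<longrightarrow> gs Z j $ p = 0))"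
proof (induction j rule: finite_linorder_induct)
  case (less j)
  show ?case
  proof (cases "j \<in> B")
    case False
    have col: "column j Z = axis j 1" using Z False by (auto simp: vec_eq_iff column_def axis_def)
    have "cinner (gs Z i) (axis j 1) = 0" if "i < j" for i
    proof -
      have "gs Z i $ j = 0" using less[OF that] False that by (cases "i \<in> B") (auto simp: axis_def)
      then show ?thesis by (simp add: cinner_def axis_def if_distrib cong: if_cong)
    qed
    then have "gsu Z j = axis j 1" by (simp add: gsu_def col)
    then show ?thesis using False by (simp add: gs_eq norm_axis_1)
  next
    case True
    have "gsu Z j $ p = 0" if p: "p \<notin> B" for p
    proof -
      have "cinner (gs Z i) (column j Z) * gs Z i $ p = 0" if i: "i < j" for i
      proof (cases "i \<in> B")
        case False
        then have "cinner (gs Z i) (column j Z) = Z $ i $ j"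
          using less[OF i] by (simp add: cinner_def axis_def column_def if_distrib if_distribR cong: if_cong)
        then show ?thesis using Z[of i j] False i by auto
      qed (use less[OF i] p in auto)
      then have "(\<Sum>i\<in>{..<j}. cinner (gs Z i) (column j Z) *s gs Z i) $ p = 0"
        by (simp add: sum.neutral)
      moreover have "column j Z $ p = 0" using Z[of p j] p True by (auto simp: column_def)
      ultimately show ?thesis by (simp add: gsu_def)
    qed
    then show ?thesis using True by (simp add: gs_eq)
  qed
qed

lemma continuous_on_vec_scale [continuous_intros]:
  assumes "continuous_on S f" "continuous_on S g"
  shows "continuous_on S (\<lambda>x. (f x :: complex) *s (g x :: complex^'n))"
  unfolding vector_scalar_mult_def by (intro continuous_intros assms)

lemma continuous_on_gs:
  "continuous_on {Z. invertible Z} (\<lambda>Z. gs Z j)"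
proof (induction j rule: finite_linorder_induct)
  case (less j)
  have "continuous_on {Z. invertible Z} (\<lambda>Z. gsu Z j)"
    unfolding gsu_def column_def using less by (intro continuous_intros) auto
  then show ?case
    unfolding gs_eq using gsu_nonzero by (intro continuous_intros) auto
qed

lemma continuous_on_gs_mat: "continuous_on {Z. invertible Z} gs_mat"
  unfolding gs_mat_def by (intro continuous_intros continuous_on_gs)

subsection \<open>Haar measure on \<open>U_sub B\<close>\<close>

lemma U_sub_UNIV: "U_sub UNIV = U_group"
  by (simp add: U_sub_def)

lemma U_sub_subset: "U_sub B \<subseteq> U_group"
  by (auto simp: U_sub_def)

lemma U_sub_mono: "A \<subseteq> B \<Longrightarrow> U_sub A \<subseteq> U_sub B"
  by (auto simp: U_sub_def)

lemma U_sub_unitary: "A \<in> U_sub B \<Longrightarrow> unitary_mat A"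
  by (auto simp: U_sub_def U_group_def)

lemma unitary_mat_1 [simp]: "unitary_mat (mat 1)"
  by (simp add: unitary_mat_def)

lemma mat_1_in_U_sub [simp]: "mat 1 \<in> U_sub B"
  by (simp add: U_sub_def U_group_def mat_1_nth)

lemma cadj_unitary: "unitary_mat A \<Longrightarrow> unitary_mat (cadj A)"
  by (simp add: unitary_mat_def)

lemma cadj_in_U_sub: "A \<in> U_sub B \<Longrightarrow> cadj A \<in> U_sub B"
  by (auto simp: U_sub_def U_group_def cadj_unitary)

lemma mult_unitary: "unitary_mat A \<Longrightarrow> unitary_mat B \<Longrightarrow> unitary_mat (A ** B)"
proof -
  assume A: "unitary_mat A" and B: "unitary_mat B"
  have "A ** B ** (cadj B ** cadj A) = A ** (B ** cadj B) ** cadj A"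
    by (simp add: matrix_mul_assoc)
  moreover have "cadj B ** cadj A ** (A ** B) = cadj B ** (cadj A ** A) ** B"
    by (simp add: matrix_mul_assoc)
  ultimately show ?thesis using A B by (simp add: unitary_mat_def cadj_mult)
qed

lemma mult_in_U_sub:
  assumes "g \<in> U_sub B" "h \<in> U_sub B" shows "g ** h \<in> U_sub B"
proof -
  have "(g ** h) $ i $ j = (if i = j then 1 else 0)" if "i \<notin> B \<or> j \<notin> B" for i j
  proof (cases "i \<in> B")
    case False
    then have "(g ** h) $ i $ j = (\<Sum>k\<in>UNIV. if i = k then h $ k $ j else 0)"
      unfolding matrix_mult_nth using assms(1) by (intro sum.cong) (auto simp: U_sub_def)
    then show ?thesis using assms(2) False by (auto simp: U_sub_def)
  next
    case True
    then have "j \<notin> B" using that by simp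
    then have "(g ** h) $ i $ j = (\<Sum>k\<in>UNIV. if k = j then g $ i $ k else 0)"
      unfolding matrix_mult_nth using assms(2) by (intro sum.cong) (auto simp: U_sub_def)
    then show ?thesis using assms(1) \<open>j \<notin> B\<close> by (auto simp: U_sub_def)
  qed
  then show ?thesis using assms mult_unitary by (auto simp: U_sub_def U_group_def)
qed

lemma unitary_column_norm:
  assumes "unitary_mat A" shows "(\<Sum>i\<in>UNIV. (cmod (A $ i $ j))\<^sup>2) = 1"
proof -
  have "complex_of_real (\<Sum>i\<in>UNIV. (cmod (A $ i $ j))\<^sup>2) = (cadj A ** A) $ j $ j"
    by (simp add: matrix_mult_nth complex_norm_square[symmetric] mult.commute)
  also have "\<dots> = 1" using assms by (simp add: unitary_mat_def mat_1_nth)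
  finally show ?thesis by (simp only: of_real_eq_1_iff)
qed

lemma unitary_entry_le_1:
  assumes "unitary_mat A" shows "cmod (A $ i $ j) \<le> 1"
proof -
  have "(cmod (A $ i $ j))\<^sup>2 \<le> (\<Sum>i\<in>UNIV. (cmod (A $ i $ j))\<^sup>2)"
    by (rule member_le_sum) auto
  then show ?thesis using unitary_column_norm[OF assms, of j] by (simp add: power_le_one_iff)
qed

lemma compact_U_sub: "compact (U_sub B :: (complex^'n^'n) set)"
proof -
  have "U_sub B = {A. A ** cadj A = mat 1} \<inter> {A. cadj A ** A = mat 1} \<inter>
      (\<Inter>i. \<Inter>j. {A. i \<notin> B \<or> j \<notin> B \<longrightarrow> A $ i $ j = (if i = j then 1 else 0)})"
    by (auto simp: U_sub_def U_group_def unitary_mat_def)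
  also have "closed \<dots>"
  proof (intro closed_Int closed_INT ballI closed_Collect_eq continuous_intros)
    fix i j
    show "closed {A :: complex^'n^'n. i \<notin> B \<or> j \<notin> B \<longrightarrow> A $ i $ j = (if i = j then 1 else 0)}"
      by (cases "i \<notin> B \<or> j \<notin> B") (auto intro!: closed_Collect_eq continuous_intros)
  qed
  finally have "closed (U_sub B :: (complex^'n^'n) set)" .
  moreover have "norm A \<le> real CARD('n) * real CARD('n)" if "A \<in> U_sub B" for A :: "complex^'n^'n"
  proof -
    have "norm A \<le> (\<Sum>i\<in>(UNIV::'n set). norm (A $ i))" 
      unfolding norm_vec_def by (rule L2_set_le_sum) auto
    also have "\<dots> \<le> (\<Sum>i\<in>(UNIV::'n set). \<Sum>j\<in>(UNIV::'n set). cmod (A $ i $ j))"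
      unfolding norm_vec_def by (intro sum_mono L2_set_le_sum) auto
    also have "\<dots> \<le> (\<Sum>i\<in>(UNIV::'n set). \<Sum>j\<in>(UNIV::'n set). 1)"
      by (intro sum_mono unitary_entry_le_1 U_sub_unitary[OF that])
    finally show ?thesis by simp
  qed
  then have "bounded (U_sub B :: (complex^'n^'n) set)" by (auto simp: bounded_iff)
  ultimately show ?thesis by (simp add: compact_eq_bounded_closed)
qed

lemma norm_unitary_mult_mat:
  fixes Z :: "complex^'m^'n"
  assumes "unitary_mat g" shows "norm (g ** Z) = norm Z"
proof -
  have sq: "(norm Z)\<^sup>2 = (\<Sum>j\<in>UNIV. (norm (column j Z))\<^sup>2)" for Z :: "complex^'m^'n"
  proof -
    have "(norm Z)\<^sup>2 = (\<Sum>i\<in>UNIV. \<Sum>j\<in>UNIV. (cmod (Z $ i $ j))\<^sup>2)"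
      by (simp add: norm_vec_def L2_set_def sum_nonneg)
    also have "\<dots> = (\<Sum>j\<in>UNIV. \<Sum>i\<in>UNIV. (cmod (Z $ i $ j))\<^sup>2)" by (rule sum.swap)
    also have "\<dots> = (\<Sum>j\<in>UNIV. (norm (column j Z))\<^sup>2)"
      by (simp add: norm_vec_def L2_set_def sum_nonneg column_def)
    finally show ?thesis .
  qed
  have "(norm (g ** Z))\<^sup>2 = (norm Z)\<^sup>2"
    by (simp add: sq column_mult norm_unitary_mult[OF assms])
  then show ?thesis by simp
qed

lemma linear_matrix_mult_left: "linear (\<lambda>Z. (X::complex^'n^'m) ** (Z :: complex^'k^'n))"
  by (rule linearI) (simp_all add: vec_eq_iff matrix_mult_nth sum.distrib algebra_simps scaleR_right.sum)

lemma orthogonal_transformation_unitary_mult: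
  fixes g :: "complex^'n^'n"
  shows "unitary_mat g \<Longrightarrow> orthogonal_transformation (\<lambda>Z :: complex^'n^'n. g ** Z)"
  by (simp add: orthogonal_transformation linear_matrix_mult_left norm_unitary_mult_mat)

lemma open_invertible_comp:
  fixes f :: "'a::topological_space \<Rightarrow> complex^'n^'n"
  assumes "continuous_on UNIV f"
  shows "open {x. invertible (f x)}"
  unfolding invertible_det_nz det_def
  by (intro open_Collect_neq continuous_intros assms)

text \<open>Lebesgue measure on a ball of matrices is invariant under left multiplication by unitaries, and
  Gram--Schmidt commutes with it, so the push-forward along Gram--Schmidt is left invariant.\<close>

lemma exists_haar: "\<exists>\<mu>. is_haar (B :: 'n::{finite,linorder} set) \<mu>"
proof -
  \<comment> \<open>\<open>M\<close> overwrites all entries outside the \<open>B\<close> block by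
    those of the identity. One Lebesgue measure on full matrices thus serves every \<open>B\<close>:
    left multiplication by \<open>U_sub B\<close> is an isometry of the whole space and commutes
    with \<open>M\<close>.\<close>
  define M :: "complex^('n::{finite,linorder})^('n::{finite,linorder}) \<Rightarrow> complex^('n::{finite,linorder})^('n::{finite,linorder})"
    where "M Z = (\<chi> i j. if i \<in> B \<and> j \<in> B then Z $ i $ j else if i = j then 1 else 0)" for Z
  define I where "I = {Z. invertible (M Z)}"
  \<comment> \<open>The radius puts \<open>mat 1\<close> into \<open>S\<close>, so this open set has
    positive measure; being bounded, it has finite measure and can be normalised.\<close>
  define S where "S = ball 0 (norm (mat 1 :: complex^('n::{finite,linorder})^('n::{finite,linorder})) + 1) \<inter> I"
  \<comment> \<open>The default \<open>mat 1\<close> keeps the values of \<open>q\<close> in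
    \<open>U_sub B\<close> also where Gram--Schmidt breaks down.\<close>
  define q where "q Z = (if Z \<in> I then gs_mat (M Z) else mat 1)" for Z
  define R where "R = restrict_space borel (U_sub B)"
  have contM: "continuous_on A M" for A
  proof -
    have "continuous_on A (\<lambda>Z. if i \<in> B \<and> j \<in> B then Z $ i $ j else if i = j then 1 else (0::complex))" for i j
      by (cases "i \<in> B \<and> j \<in> B") (auto intro!: continuous_intros)
    then show ?thesis unfolding M_def by (intro continuous_intros)
  qed
  have openI: "open I" unfolding I_def by (intro open_invertible_comp contM)
  have openS: "open S" unfolding S_def by (intro open_Int open_ball openI)
  have S_borel[measurable]: "S \<in> sets borel" using openS by simp
  have M1: "M (mat 1) = mat 1" by (auto simp: M_def vec_eq_iff mat_1_nth)
  have "mat 1 \<in> S"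
    by (auto simp: S_def I_def M1 invertible_def intro!: exI[of _ "mat 1"])
  then have S0: "emeasure lborel S \<noteq> 0"
    using open_not_negligible[OF openS] by (metis empty_iff S_borel negligible_iff_null_sets null_setsI
        null_sets_completionI sets_lborel)
  have Sfin: "emeasure lborel S \<noteq> \<infinity>"
    using emeasure_bounded_finite[of S] unfolding S_def by (metis bounded_Int bounded_ball less_irrefl)
  have Mg: "M (g ** Z) = g ** M Z" if "g \<in> U_sub B" for g Z
  proof -
    have g: "g $ i $ j = (if i = j then 1 else 0)" if "i \<notin> B \<or> j \<notin> B" for i j
      using \<open>g \<in> U_sub B\<close> that by (auto simp: U_sub_def)
    have "(M (g ** Z)) $ i $ j = (g ** M Z) $ i $ j" for i j
    proof (cases "i \<in> B \<and> j \<in> B")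
      case True
      then show ?thesis
        unfolding M_def matrix_mult_nth by (auto simp: g intro!: sum.cong)
    next
      case False
      show ?thesis
      proof (cases "i \<in> B")
        case True
        with False have j: "j \<notin> B" by simp
        have "(g ** M Z) $ i $ j = (\<Sum>k\<in>UNIV. if k = j then g $ i $ k else 0)"
          unfolding matrix_mult_nth using j by (intro sum.cong) (auto simp: M_def)
        then show ?thesis using j True by (auto simp: M_def g)
      next
        case iB: False
        have "(g ** M Z) $ i $ j = (\<Sum>k\<in>UNIV. if i = k then M Z $ k $ j else 0)"
          unfolding matrix_mult_nth using iB by (intro sum.cong) (auto simp: g)
        then show ?thesis using iB by (auto simp: M_def)
      qed
    qed
    then show ?thesis by (simp add: vec_eq_iff)
  qed
  have qU: "q Z \<in> U_sub B" for Z
  proof (cases "Z \<in> I")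
    case True
    have "M Z $ p $ r = (if p = r then 1 else 0)" if "p \<notin> B \<or> r \<notin> B" for p r
      using that by (auto simp: M_def)
    from gs_block[of B "M Z", OF this]
    have "gs_mat (M Z) $ i $ j = (if i = j then 1 else 0)" if "i \<notin> B \<or> j \<notin> B" for i j
      using that by (cases "j \<in> B") (auto simp: gs_mat_def axis_def)
    moreover have "unitary_mat (gs_mat (M Z))" using True by (intro gs_mat_unitary) (simp add: I_def)
    ultimately show ?thesis using True by (simp add: q_def U_sub_def U_group_def)
  qed (simp add: q_def)
  have q_borel: "q \<in> borel_measurable borel"
    unfolding q_def
  proof (rule borel_measurable_continuous_on_if)
    show "I \<in> sets borel" using openI by simp
    show "continuous_on I (\<lambda>Z. gs_mat (M Z))"
      by (rule continuous_on_compose2[OF continuous_on_gs_mat contM]) (auto simp: I_def)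
  qed simp
  then have q_R[measurable]: "q \<in> borel \<rightarrow>\<^sub>M R"
    unfolding R_def using qU by (intro measurable_restrict_space2) auto
  define \<mu> where "\<mu> = distr (uniform_measure lborel S) R q"
  have q_m: "q \<in> uniform_measure lborel S \<rightarrow>\<^sub>M R"
    using q_R by (simp cong: measurable_cong_sets)
  have em: "emeasure \<mu> E = emeasure lborel (S \<inter> q -` E) / emeasure lborel S" if "E \<in> sets R" for E
  proof -
    have "q -` E \<in> sets borel" using measurable_sets[OF q_R that] by simp
    then show ?thesis
      unfolding \<mu>_def by (subst emeasure_distr[OF q_m that]) (simp add: emeasure_uniform_measure)
  qed
  have setsm: "sets \<mu> = sets R" by (simp add: \<mu>_def)
  have spR: "space R = U_sub B" by (simp add: R_def space_restrict_space)
  have space: "space \<mu> = U_sub B" by (simp add: \<mu>_def spR)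
  have one: "emeasure \<mu> (space \<mu>) = 1"
  proof -
    have "U_sub B \<in> sets R" using spR sets.top[of R] by simp
    moreover have "S \<inter> q -` U_sub B = S" using qU by auto
    ultimately show ?thesis using S0 Sfin
      unfolding space by (simp add: em ennreal_divide_self less_top[symmetric] top_unique zero_less_iff_neq_zero)
  qed
  have "distr \<mu> \<mu> (\<lambda>A. g ** A) = \<mu>" if g: "g \<in> U_sub B" for g
  proof -
    have gm: "(\<lambda>A. g ** A) \<in> \<mu> \<rightarrow>\<^sub>M \<mu>"
    proof -
      have "(\<lambda>A. g ** A) \<in> R \<rightarrow>\<^sub>M R"
        unfolding R_def using mult_in_U_sub[OF g]
        by (intro measurable_restrict_space3 borel_measurable_continuous_onI continuous_intros) auto
      then show ?thesis using setsm by (simp cong: measurable_cong_sets)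
    qed
    show ?thesis
    proof (rule measure_eqI)
      fix E assume "E \<in> sets (distr \<mu> \<mu> ((**) g))"
      then have E: "E \<in> sets R" by (simp add: setsm)
      have gE: "(\<lambda>A. g ** A) -` E \<inter> space \<mu> \<in> sets R"
        using measurable_sets[OF gm] E setsm by simp
      have gu: "unitary_mat g" using g by (rule U_sub_unitary)
      have ginv: "invertible (g ** X) = invertible X" for X :: "complex^('n::{finite,linorder})^('n::{finite,linorder})"
      proof -
        have "det g \<noteq> 0"
        proof
          assume "det g = 0"
          then have "det (g ** cadj g) = 0" by (simp add: det_mul)
          then show False using gu by (simp add: unitary_mat_def)
        qed
        then show ?thesis by (simp add: invertible_det_nz det_mul)
      qed
      have "S \<inter> q -` ((\<lambda>A. g ** A) -` E \<inter> space \<mu>) = (\<lambda>Z. g ** Z) -` (S \<inter> q -` E)"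
      proof (rule set_eqI)
        fix Z
        have "g ** Z \<in> S \<longleftrightarrow> Z \<in> S"
          by (simp add: S_def I_def Mg[OF g] ginv norm_unitary_mult_mat[OF gu])
        moreover have "q (g ** Z) = g ** q Z" if "Z \<in> S"
          using that by (simp add: S_def I_def q_def Mg[OF g] ginv gs_mat_equivariant[OF gu])
        ultimately show "Z \<in> S \<inter> q -` ((\<lambda>A. g ** A) -` E \<inter> space \<mu>) \<longleftrightarrow> Z \<in> (\<lambda>Z. g ** Z) -` (S \<inter> q -` E)"
          using qU by (auto simp: space)
      qed
      moreover have "S \<inter> q -` E \<in> sets borel"
        using measurable_sets[OF q_R E] by simp
      ultimately have "emeasure lborel (S \<inter> q -` ((\<lambda>A. g ** A) -` E \<inter> space \<mu>)) = emeasure lborel (S \<inter> q -` E)"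
        using emeasure_lborel_orthogonal_vimage[OF orthogonal_transformation_unitary_mult[OF gu]] by metis
      then show "emeasure (distr \<mu> \<mu> ((**) g)) E = emeasure \<mu> E"
        using E setsm gm gE by (simp add: emeasure_distr em)
    qed simp
  qed
  then have "is_haar B \<mu>" using setsm one unfolding is_haar_def R_def by auto
  then show ?thesis ..
qed

text \<open>Integrating \<open>1\<^sub>E(x\<^sup>* y)\<close> over \<open>\<nu> \<otimes> \<mu>\<close> in both orders.\<close>

lemma is_haar_cadj:
  fixes \<mu> \<nu> :: "(complex^'n^'n) measure"
  assumes \<mu>: "is_haar B \<mu>" and \<nu>: "is_haar B \<nu>" and E: "E \<in> sets \<mu>"
  shows "emeasure \<mu> E = emeasure \<nu> (cadj -` E \<inter> space \<nu>)"
proof -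
  define R where "R = restrict_space borel (U_sub B :: (complex^'n^'n) set)"
  have s\<mu>[measurable_cong]: "sets \<mu> = sets R" and s\<nu>[measurable_cong]: "sets \<nu> = sets R"
    using \<mu> \<nu> by (auto simp: is_haar_def R_def)
  have spR: "space R = U_sub B" by (simp add: R_def space_restrict_space)
  have sp: "space \<mu> = U_sub B" "space \<nu> = U_sub B"
    using sets_eq_imp_space_eq[OF s\<mu>] sets_eq_imp_space_eq[OF s\<nu>] spR by auto
  interpret \<mu>: finite_measure \<mu> using \<mu> by (intro finite_measureI) (simp add: is_haar_def)
  interpret \<nu>: finite_measure \<nu> using \<nu> by (intro finite_measureI) (simp add: is_haar_def)
  interpret pair_sigma_finite \<nu> \<mu> ..
  have ER[measurable]: "E \<in> sets R" using E s\<mu> by simp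
  have id: "(\<lambda>x. x) \<in> R \<rightarrow>\<^sub>M borel" unfolding R_def by (rule measurable_restrict_space1) simp
  have m1: "(\<lambda>z. cadj (fst z) ** snd z) \<in> R \<Otimes>\<^sub>M R \<rightarrow>\<^sub>M R"
  proof -
    have "(\<lambda>z. cadj (fst z) ** snd z) \<in> R \<Otimes>\<^sub>M R \<rightarrow>\<^sub>M borel"
      by (rule borel_measurable_continuous_Pair[where H="\<lambda>x y. cadj x ** y"])
         (auto intro!: continuous_intros measurable_compose[OF measurable_fst id] measurable_compose[OF measurable_snd id])
    then show ?thesis
      unfolding R_def[symmetric] apply (subst (3) R_def)
      by (rule measurable_restrict_space2) (auto simp: space_pair_measure spR intro!: mult_in_U_sub cadj_in_U_sub)
  qed
  have mult[measurable]: "(\<lambda>A. g ** A) \<in> R \<rightarrow>\<^sub>M R" if "g \<in> U_sub B" for g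
    unfolding R_def using mult_in_U_sub[OF that]
    by (intro measurable_restrict_space3 borel_measurable_continuous_onI continuous_intros) auto
  have cadj[measurable]: "cadj \<in> R \<rightarrow>\<^sub>M R"
    unfolding R_def using cadj_in_U_sub
    by (intro measurable_restrict_space3 borel_measurable_continuous_onI continuous_intros) auto
  have inv: "(\<integral>\<^sup>+ y. f (g ** y) \<partial>\<kappa>) = (\<integral>\<^sup>+ y. f y \<partial>\<kappa>)"
    if "is_haar B \<kappa>" "f \<in> borel_measurable R" "g \<in> U_sub B" for f g \<kappa>
  proof -
    have s: "sets \<kappa> = sets R" using that(1) by (simp add: is_haar_def R_def)
    have "(\<integral>\<^sup>+ y. f y \<partial>\<kappa>) = (\<integral>\<^sup>+ y. f y \<partial>(distr \<kappa> \<kappa> (\<lambda>A. g ** A)))"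
      using that by (simp add: is_haar_def)
    also have "\<dots> = (\<integral>\<^sup>+ y. f (g ** y) \<partial>\<kappa>)"
      using that mult[OF that(3)] by (intro nn_integral_distr) (simp_all add: s cong: measurable_cong_sets)
    finally show ?thesis by simp
  qed
  have iE: "indicator E \<in> borel_measurable R" using ER by simp
  have "emeasure \<mu> E = (\<integral>\<^sup>+ x. emeasure \<mu> E \<partial>\<nu>)"
    using \<nu> by (simp add: is_haar_def)
  also have "\<dots> = (\<integral>\<^sup>+ x. \<integral>\<^sup>+ y. indicator E (cadj x ** y) \<partial>\<mu> \<partial>\<nu>)"
    using E by (intro nn_integral_cong) (simp add: sp inv[OF \<mu> iE] cadj_in_U_sub)
  also have "\<dots> = (\<integral>\<^sup>+ y. \<integral>\<^sup>+ x. indicator E (cadj x ** y) \<partial>\<nu> \<partial>\<mu>)"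
  proof (rule Fubini'[symmetric])
    have "(\<lambda>z. indicator E (cadj (fst z) ** snd z) :: ennreal) \<in> borel_measurable (R \<Otimes>\<^sub>M R)"
      using m1 iE by (rule measurable_compose)
    then show "(\<lambda>(x, y). indicator E (cadj x ** y) :: ennreal) \<in> borel_measurable (\<nu> \<Otimes>\<^sub>M \<mu>)"
      by (simp add: case_prod_beta' s\<mu> s\<nu> cong: measurable_cong_sets sets_pair_measure_cong)
  qed
  also have "\<dots> = (\<integral>\<^sup>+ y. \<integral>\<^sup>+ x. indicator E (cadj x) \<partial>\<nu> \<partial>\<mu>)"
  proof (rule nn_integral_cong)
    fix y assume "y \<in> space \<mu>"
    then have y: "cadj y \<in> U_sub B" by (simp add: sp cadj_in_U_sub)
    have "(\<integral>\<^sup>+ x. indicator E (cadj x ** y) \<partial>\<nu>) = (\<integral>\<^sup>+ x. indicator E (cadj (cadj y ** x)) \<partial>\<nu>)"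
      by (simp add: cadj_mult)
    also have "\<dots> = (\<integral>\<^sup>+ x. indicator E (cadj x) \<partial>\<nu>)"
      by (rule inv[OF \<nu> _ y]) (rule measurable_compose[OF cadj iE])
    finally show "(\<integral>\<^sup>+ x. indicator E (cadj x ** y) \<partial>\<nu>) = (\<integral>\<^sup>+ x. (indicator E (cadj x) :: ennreal) \<partial>\<nu>)" .
  qed
  also have "\<dots> = (\<integral>\<^sup>+ x. indicator E (cadj x) \<partial>\<nu>)"
    using \<mu> by (simp add: is_haar_def)
  also have "\<dots> = (\<integral>\<^sup>+ x. indicator (cadj -` E \<inter> space \<nu>) x \<partial>\<nu>)"
    by (intro nn_integral_cong) (auto simp: indicator_def)
  also have "\<dots> = emeasure \<nu> (cadj -` E \<inter> space \<nu>)"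
    by (rule nn_integral_indicator) (use measurable_sets[OF cadj ER] s\<nu> sp spR in simp)
  finally show ?thesis .
qed

text \<open>By \<open>is_haar_cadj\<close>, applied to the pairs \<open>\<mu>\<close>,
  \<open>\<nu>\<close> and \<open>\<nu>\<close>, \<open>\<nu>\<close>, both measures of
  \<open>E\<close> equal the \<open>\<nu>\<close>-measure of the set of adjoints. Uniqueness makes
  the \<open>THE\<close> in \<open>haar_measure\<close> denote.\<close>

lemma is_haar_unique:
  assumes \<mu>: "is_haar B \<mu>" and \<nu>: "is_haar B \<nu>"
  shows "\<mu> = \<nu>"
proof (rule measure_eqI)
  show "sets \<mu> = sets \<nu>" using assms by (simp add: is_haar_def)
  fix E assume E: "E \<in> sets \<mu>"
  then have "E \<in> sets \<nu>" using assms by (simp add: is_haar_def)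
  then show "emeasure \<mu> E = emeasure \<nu> E"
    using is_haar_cadj[OF \<mu> \<nu> E] is_haar_cadj[OF \<nu> \<nu>] by simp
qed

section \<open>Integration against the Haar measure\<close>

lemma is_haar_haar_measure: "is_haar (B :: 'n::{finite,linorder} set) (haar_measure B)"
  unfolding haar_measure_def
  using exists_haar[of B] is_haar_unique by (auto intro: theI2)

lemma sets_haar: "sets (haar_measure (B :: 'n::{finite,linorder} set)) = sets (restrict_space borel (U_sub B))"
  using is_haar_haar_measure[of B] by (simp add: is_haar_def)

lemma space_haar: "space (haar_measure (B :: 'n::{finite,linorder} set)) = U_sub B"
  using sets_eq_imp_space_eq[OF sets_haar[of B]] by (simp add: space_restrict_space)

lemma finite_measure_haar: "finite_measure (haar_measure (B :: 'n::{finite,linorder} set))"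
  using is_haar_haar_measure[of B] by (intro finite_measureI) (simp add: is_haar_def)

lemma measure_haar_space [simp]:
  "measure (haar_measure (B :: 'n::{finite,linorder} set)) (space (haar_measure B)) = 1"
  using is_haar_haar_measure[of B] by (simp add: is_haar_def measure_def)

lemma measurable_haar:
  fixes f :: "complex^('n::{finite,linorder})^('n::{finite,linorder}) \<Rightarrow> 'b::topological_space"
  assumes "continuous_on (U_sub B) f"
  shows "f \<in> borel_measurable (haar_measure B)"
  using borel_measurable_continuous_on_restrict[OF assms] by (simp add: sets_haar cong: measurable_cong_sets)

lemma integrable_haar:
  fixes f :: "complex^('n::{finite,linorder})^('n::{finite,linorder}) \<Rightarrow> 'b::{banach,second_countable_topology}"
  assumes f: "continuous_on (U_sub B) f"
  shows "integrable (haar_measure B) f"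
proof -
  interpret finite_measure "haar_measure B" by (rule finite_measure_haar)
  have "bounded (f ` U_sub B)"
    by (intro compact_imp_bounded compact_continuous_image f compact_U_sub)
  then obtain C where "\<And>A. A \<in> U_sub B \<Longrightarrow> norm (f A) \<le> C" by (auto simp: bounded_iff)
  then show ?thesis
    by (intro integrable_const_bound[where B=C] measurable_haar f) (auto simp: space_haar)
qed

lemma integral_haar_cong:
  fixes f :: "complex^('n::{finite,linorder})^('n::{finite,linorder}) \<Rightarrow> 'b::{banach,second_countable_topology}"
  assumes "\<And>A. A \<in> U_sub B \<Longrightarrow> f A = g A"
  shows "(LINT A|haar_measure B. f A) = (LINT A|haar_measure B. g A)"
  by (rule Bochner_Integration.integral_cong) (auto simp: space_haar assms)

lemma measurable_mult_haar:
  fixes B :: "'n::{finite,linorder} set"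
  assumes "g \<in> U_sub B"
  shows "(\<lambda>A. g ** A) \<in> haar_measure B \<rightarrow>\<^sub>M haar_measure B"
proof -
  have "(\<lambda>A. g ** A) \<in> restrict_space borel (U_sub B) \<rightarrow>\<^sub>M restrict_space borel (U_sub B)"
    using mult_in_U_sub[OF assms]
    by (intro measurable_restrict_space3 borel_measurable_continuous_onI continuous_intros) auto
  then show ?thesis by (simp add: sets_haar cong: measurable_cong_sets)
qed

lemma measurable_cadj_haar:
  fixes B :: "'n::{finite,linorder} set"
  shows "cadj \<in> haar_measure B \<rightarrow>\<^sub>M haar_measure B"
proof -
  have "cadj \<in> restrict_space borel (U_sub B) \<rightarrow>\<^sub>M restrict_space borel (U_sub B)"
    using cadj_in_U_sub
    by (intro measurable_restrict_space3 borel_measurable_continuous_onI continuous_intros) auto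
  then show ?thesis by (simp add: sets_haar cong: measurable_cong_sets)
qed

lemma integral_haar_left:
  fixes f :: "complex^('n::{finite,linorder})^('n::{finite,linorder}) \<Rightarrow> 'b::{banach,second_countable_topology}"
  assumes f: "continuous_on (U_sub B) f" and g: "g \<in> U_sub B"
  shows "(LINT A|haar_measure B. f (g ** A)) = (LINT A|haar_measure B. f A)"
proof -
  have "(LINT A|haar_measure B. f A) = (LINT A|distr (haar_measure B) (haar_measure B) (\<lambda>A. g ** A). f A)"
    using is_haar_haar_measure[of B] g by (simp add: is_haar_def)
  also have "\<dots> = (LINT A|haar_measure B. f (g ** A))"
    by (rule integral_distr[OF measurable_mult_haar[OF g] measurable_haar[OF f]])
  finally show ?thesis by simp
qed

lemma integral_haar_cadj:
  fixes f :: "complex^('n::{finite,linorder})^('n::{finite,linorder}) \<Rightarrow> 'b::{banach,second_countable_topology}"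
  assumes f: "continuous_on (U_sub B) f"
  shows "(LINT A|haar_measure B. f (cadj A)) = (LINT A|haar_measure B. f A)"
proof -
  have "distr (haar_measure B) (haar_measure B) cadj = haar_measure B"
  proof (rule measure_eqI)
    fix E assume "E \<in> sets (distr (haar_measure B) (haar_measure B) cadj)"
    then have E: "E \<in> sets (haar_measure B)" by simp
    show "emeasure (distr (haar_measure B) (haar_measure B) cadj) E = emeasure (haar_measure B) E"
      using is_haar_cadj[OF is_haar_haar_measure is_haar_haar_measure E]
      by (simp add: emeasure_distr[OF measurable_cadj_haar E])
  qed simp
  then have "(LINT A|haar_measure B. f A) = (LINT A|distr (haar_measure B) (haar_measure B) cadj. f A)"
    by simp
  also have "\<dots> = (LINT A|haar_measure B. f (cadj A))"
    by (rule integral_distr[OF measurable_cadj_haar measurable_haar[OF f]])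
  finally show ?thesis by simp
qed

text \<open>\<open>is_haar\<close> demands left invariance only; passing to adjoints before and
  after turns right multiplication into left multiplication.\<close>

lemma integral_haar_right:
  fixes f :: "complex^('n::{finite,linorder})^('n::{finite,linorder}) \<Rightarrow> 'b::{banach,second_countable_topology}"
  assumes f: "continuous_on (U_sub B) f" and g: "g \<in> U_sub B"
  shows "(LINT A|haar_measure B. f (A ** g)) = (LINT A|haar_measure B. f A)"
proof -
  have 1: "continuous_on (U_sub B) (\<lambda>A. f (A ** g))"
    by (rule continuous_on_compose2[OF f]) (auto intro!: continuous_intros mult_in_U_sub g)
  have 2: "continuous_on (U_sub B) (\<lambda>A. f (cadj A))"
    by (rule continuous_on_compose2[OF f]) (auto intro!: continuous_intros cadj_in_U_sub)
  have "(LINT A|haar_measure B. f (A ** g)) = (LINT A|haar_measure B. f (cadj A ** g))"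
    by (rule integral_haar_cadj[OF 1, symmetric])
  also have "\<dots> = (LINT A|haar_measure B. f (cadj (cadj g ** A)))"
    by (simp add: cadj_mult)
  also have "\<dots> = (LINT A|haar_measure B. f (cadj A))"
    by (rule integral_haar_left[OF 2 cadj_in_U_sub[OF g]])
  also have "\<dots> = (LINT A|haar_measure B. f A)"
    by (rule integral_haar_cadj[OF f])
  finally show ?thesis .
qed

lemma integral_haar_linear:
  fixes f :: "complex^('n::{finite,linorder})^('n::{finite,linorder}) \<Rightarrow> 'b::euclidean_space"
    and T :: "'b \<Rightarrow> 'c::{banach,second_countable_topology}"
  assumes "continuous_on (U_sub B) f" "linear T"
  shows "T (LINT A|haar_measure B. f A) = (LINT A|haar_measure B. T (f A))"
  using integral_bounded_linear[OF _ integrable_haar[OF assms(1)], of T] assms(2)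
  by (simp add: linear_conv_bounded_linear)

text \<open>By compactness finitely many translates of the neighbourhood cover the group. If one
  were null, all would be, contradicting total mass 1.\<close>

lemma haar_nbhd_pos:
  fixes B :: "'n::{finite,linorder} set"
  assumes O: "open W" "mat 1 \<in> W"
  shows "measure (haar_measure B) (W \<inter> U_sub B) > 0"
proof (rule ccontr)
  interpret finite_measure "haar_measure B" by (rule finite_measure_haar)
  let ?\<mu> = "haar_measure B"
  assume "\<not> ?thesis"
  then have 0: "emeasure ?\<mu> (W \<inter> U_sub B) = 0"
    by (simp add: emeasure_eq_measure zero_less_measure_iff)
  have meas: "X \<inter> U_sub B \<in> sets ?\<mu>" if "open X" for X
    using that by (auto simp: sets_haar sets_restrict_space)
  define tr where "tr g = (\<lambda>A. cadj g ** A) -` W" for g :: "complex^('n::{finite,linorder})^('n::{finite,linorder})"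
  have op: "open (tr g)" for g
    unfolding tr_def by (intro open_vimage O continuous_intros)
  have "g \<in> tr g" if "g \<in> U_sub B" for g
    using U_sub_unitary[OF that] O by (simp add: tr_def unitary_mat_def)
  then have "U_sub B \<subseteq> (\<Union>g\<in>U_sub B. tr g)" by auto
  then obtain F where F: "F \<subseteq> U_sub B" "finite F" "U_sub B \<subseteq> (\<Union>g\<in>F. tr g)"
    using compactE_image[OF compact_U_sub, of "U_sub B" tr B] op by metis
  have "emeasure ?\<mu> (tr g \<inter> U_sub B) = 0" if "g \<in> U_sub B" for g
  proof -
    have g: "cadj g \<in> U_sub B" using that by (rule cadj_in_U_sub)
    have "(\<lambda>A. cadj g ** A) -` (W \<inter> U_sub B) \<inter> space ?\<mu> = tr g \<inter> U_sub B"
      using mult_in_U_sub[OF g] by (auto simp: tr_def space_haar)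
    moreover have "emeasure (distr ?\<mu> ?\<mu> (\<lambda>A. cadj g ** A)) (W \<inter> U_sub B) = emeasure ?\<mu> (W \<inter> U_sub B)"
      using is_haar_haar_measure[of B] g by (simp add: is_haar_def)
    ultimately show ?thesis
      using 0 by (simp add: emeasure_distr[OF measurable_mult_haar[OF g] meas[OF O(1)]])
  qed
  then have "(\<Sum>g\<in>F. emeasure ?\<mu> (tr g \<inter> U_sub B)) = 0" using F by auto
  moreover have "emeasure ?\<mu> (\<Union>g\<in>F. tr g \<inter> U_sub B) \<le> (\<Sum>g\<in>F. emeasure ?\<mu> (tr g \<inter> U_sub B))"
    using F(2) meas[OF op] by (intro emeasure_subadditive_finite) auto
  moreover have "(\<Union>g\<in>F. tr g \<inter> U_sub B) = U_sub B" using F by auto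
  ultimately show False
    using is_haar_haar_measure[of B] by (simp add: is_haar_def space_haar)
qed

text \<open>Continuity keeps \<open>f\<close> above half its value at the identity on a ball, which
  has positive measure by \<open>haar_nbhd_pos\<close>.\<close>

lemma integral_haar_pos:
  fixes f :: "complex^('n::{finite,linorder})^('n::{finite,linorder}) \<Rightarrow> real"
  assumes f: "continuous_on (U_sub B) f" and nonneg: "\<And>A. A \<in> U_sub B \<Longrightarrow> 0 \<le> f A"
    and pos: "f (mat 1) > 0"
  shows "(LINT A|haar_measure B. f A) > 0"
proof -
  interpret finite_measure "haar_measure B" by (rule finite_measure_haar)
  let ?e = "f (mat 1) / 2"
  obtain d where d: "d > 0" "\<And>A. A \<in> U_sub B \<Longrightarrow> dist A (mat 1) < d \<Longrightarrow> dist (f A) (f (mat 1)) < ?e"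
    using f[unfolded continuous_on_iff] pos mat_1_in_U_sub by (metis half_gt_zero)
  let ?W = "ball (mat 1) d \<inter> U_sub B"
  have W: "?W \<in> sets (haar_measure B)" by (auto simp: sets_haar sets_restrict_space)
  have "0 < ?e * measure (haar_measure B) ?W"
    using haar_nbhd_pos[of "ball (mat 1) d" B] d(1) pos by (intro mult_pos_pos) auto
  also have "\<dots> = (LINT A|haar_measure B. ?e * indicator ?W A)"
    using W by (simp add: space_haar inf.absorb1)
  also have "\<dots> \<le> (LINT A|haar_measure B. f A)"
  proof (rule integral_mono[OF _ integrable_haar[OF f]])
    show "integrable (haar_measure B) (\<lambda>A. ?e * indicator ?W A)"
      using W by (intro integrable_mult_right) (simp add: emeasure_eq_measure)
    fix A assume "A \<in> space (haar_measure B)"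
    then have A: "A \<in> U_sub B" by (simp add: space_haar)
    show "?e * indicator ?W A \<le> f A"
    proof (cases "A \<in> ?W")
      case True
      then have "\<bar>f A - f (mat 1)\<bar> < ?e" using d(2)[OF A] by (auto simp: dist_commute dist_real_def)
      then show ?thesis using True by (simp add: field_simps abs_if split: if_splits)
    qed (use nonneg[OF A] in auto)
  qed
  finally show ?thesis .
qed

subsection \<open>Averages of unitary representations\<close>

lemma rep_unitary: "unitary_rep \<rho> \<Longrightarrow> A \<in> U_group \<Longrightarrow> unitary_mat (\<rho> A)"
  by (simp add: unitary_rep_def)

lemma rep_mult: "unitary_rep \<rho> \<Longrightarrow> A \<in> U_group \<Longrightarrow> B \<in> U_group \<Longrightarrow> \<rho> (A ** B) = \<rho> A ** \<rho> B"
  by (simp add: unitary_rep_def)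

lemma rep_mult_vec:
  "unitary_rep \<rho> \<Longrightarrow> A \<in> U_group \<Longrightarrow> B \<in> U_group \<Longrightarrow> \<rho> (A ** B) *v v = \<rho> A *v (\<rho> B *v v)"
  by (simp add: rep_mult matrix_vector_mul_assoc)

lemma mat_1_in_U_group [simp]: "mat 1 \<in> U_group"
  by (simp add: U_group_def)

lemma cadj_in_U_group: "A \<in> U_group \<Longrightarrow> cadj A \<in> U_group"
  by (simp add: U_group_def cadj_unitary)

lemma mult_in_U_group: "A \<in> U_group \<Longrightarrow> B \<in> U_group \<Longrightarrow> A ** B \<in> U_group"
  by (simp add: U_group_def mult_unitary)

lemma rep_one:
  assumes "unitary_rep \<rho>" shows "\<rho> (mat 1) = mat 1"
proof -
  have "\<rho> (mat 1) = \<rho> (mat 1) ** \<rho> (mat 1)"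
    using rep_mult[OF assms, of "mat 1" "mat 1"] by simp
  then have "cadj (\<rho> (mat 1)) ** \<rho> (mat 1) = (cadj (\<rho> (mat 1)) ** \<rho> (mat 1)) ** \<rho> (mat 1)"
    by (metis matrix_mul_assoc)
  then show ?thesis using rep_unitary[OF assms, of "mat 1"] by (simp add: unitary_mat_def)
qed

lemma rep_cadj:
  assumes "unitary_rep \<rho>" "A \<in> U_group" shows "\<rho> (cadj A) = cadj (\<rho> A)"
proof -
  have "\<rho> (cadj A) ** \<rho> A = mat 1"
    using rep_mult[OF assms(1) cadj_in_U_group[OF assms(2)] assms(2)] assms rep_one[OF assms(1)]
    by (simp add: U_group_def unitary_mat_def)
  then have "\<rho> (cadj A) ** (\<rho> A ** cadj (\<rho> A)) = cadj (\<rho> A)" by (simp add: matrix_mul_assoc)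
  then show ?thesis using rep_unitary[OF assms] by (simp add: unitary_mat_def)
qed

lemma rep_continuous: "unitary_rep \<rho> \<Longrightarrow> continuous_on (U_sub B) \<rho>"
  using U_sub_subset by (auto simp: unitary_rep_def intro: continuous_on_subset)

definition rep_avg :: "(complex^('n::{finite,linorder})^('n::{finite,linorder}) \<Rightarrow> complex^'d^'d) \<Rightarrow> 'n set \<Rightarrow> complex^'d^'d" where
  "rep_avg \<rho> B = (LINT A|haar_measure B. \<rho> A)"

lemma linear_matrix_mult_right: "linear (\<lambda>Z. (Z::complex^'n^'m) ** (X :: complex^'k^'n))"
  by (rule linearI) (simp_all add: vec_eq_iff matrix_mult_nth sum.distrib algebra_simps scaleR_right.sum)

lemma linear_matrix_vector: "linear (\<lambda>Z. (Z::complex^'n^'m) *v x)"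
  by (rule linearI) (simp_all add: matrix_vector_mult_add_rdistrib scaleR_matrix_vector_mult)

lemma linear_cadj: "linear cadj"
  by (rule linearI) (simp_all add: vec_eq_iff)

lemma rep_avg_mult_left:
  "unitary_rep \<rho> \<Longrightarrow> X ** rep_avg \<rho> B = (LINT A|haar_measure B. X ** \<rho> A)"
  unfolding rep_avg_def by (intro integral_haar_linear rep_continuous linear_matrix_mult_left)

lemma rep_avg_mult_right:
  "unitary_rep \<rho> \<Longrightarrow> rep_avg \<rho> B ** X = (LINT A|haar_measure B. \<rho> A ** X)"
  unfolding rep_avg_def by (intro integral_haar_linear rep_continuous linear_matrix_mult_right)

lemma rep_avg_vec:
  "unitary_rep \<rho> \<Longrightarrow> rep_avg \<rho> B *v x = (LINT A|haar_measure B. \<rho> A *v x)"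
  unfolding rep_avg_def
  by (intro integral_haar_linear[where T="\<lambda>Z. Z *v x"] rep_continuous linear_matrix_vector)

lemma cadj_rep_avg:
  assumes "unitary_rep \<rho>" shows "cadj (rep_avg \<rho> B) = rep_avg \<rho> B"
proof -
  have "cadj (rep_avg \<rho> B) = (LINT A|haar_measure B. cadj (\<rho> A))"
    unfolding rep_avg_def by (intro integral_haar_linear rep_continuous assms linear_cadj)
  also have "\<dots> = (LINT A|haar_measure B. \<rho> (cadj A))"
    using U_sub_subset by (intro integral_haar_cong rep_cadj[OF assms, symmetric]) auto
  also have "\<dots> = rep_avg \<rho> B"
    unfolding rep_avg_def by (intro integral_haar_cadj rep_continuous assms)
  finally show ?thesis .
qed

lemma rep_mult_rep_avg:
  assumes "unitary_rep \<rho>" "g \<in> U_sub B" shows "\<rho> g ** rep_avg \<rho> B = rep_avg \<rho> B"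
proof -
  have "\<rho> g ** rep_avg \<rho> B = (LINT A|haar_measure B. \<rho> g ** \<rho> A)"
    by (rule rep_avg_mult_left[OF assms(1)])
  also have "\<dots> = (LINT A|haar_measure B. \<rho> (g ** A))"
    using assms(2) U_sub_subset by (intro integral_haar_cong rep_mult[OF assms(1), symmetric]) auto
  also have "\<dots> = rep_avg \<rho> B"
    unfolding rep_avg_def by (intro integral_haar_left rep_continuous assms)
  finally show ?thesis .
qed

lemma rep_avg_mult_rep:
  assumes "unitary_rep \<rho>" "g \<in> U_sub B" shows "rep_avg \<rho> B ** \<rho> g = rep_avg \<rho> B"
proof -
  have g: "g \<in> U_group" using assms(2) U_sub_subset by auto
  have "cadj (\<rho> (cadj g) ** rep_avg \<rho> B) = cadj (rep_avg \<rho> B)"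
    using rep_mult_rep_avg[OF assms(1) cadj_in_U_sub[OF assms(2)]] by simp
  then show ?thesis by (simp add: cadj_mult cadj_rep_avg[OF assms(1)] rep_cadj[OF assms(1) g])
qed

lemma mult_rep_avg_eqI:
  assumes "unitary_rep \<rho>" "\<And>g. g \<in> U_sub B \<Longrightarrow> X ** \<rho> g = Y"
  shows "X ** rep_avg \<rho> B = Y"
  using rep_avg_mult_left[OF assms(1), of X B] integral_haar_cong[of B "\<lambda>A. X ** \<rho> A" "\<lambda>A. Y"] assms(2)
  by simp

lemma rep_avg_mult_eqI:
  assumes "unitary_rep \<rho>" "\<And>g. g \<in> U_sub B \<Longrightarrow> \<rho> g ** X = Y"
  shows "rep_avg \<rho> B ** X = Y"
  using rep_avg_mult_right[OF assms(1), of B X] integral_haar_cong[of B "\<lambda>A. \<rho> A ** X" "\<lambda>A. Y"] assms(2)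
  by simp

lemma rep_avg_fixed:
  assumes "unitary_rep \<rho>" "\<And>g. g \<in> U_sub B \<Longrightarrow> \<rho> g *v x = x"
  shows "rep_avg \<rho> B *v x = x"
  using rep_avg_vec[OF assms(1), of B x] integral_haar_cong[of B "\<lambda>A. \<rho> A *v x" "\<lambda>A. x"] assms(2)
  by simp

lemma rep_avg_commute:
  assumes \<rho>: "unitary_rep \<rho>" and comm: "\<And>h. h \<in> U_sub B \<Longrightarrow> X ** \<rho> h = \<rho> h ** X"
  shows "X ** rep_avg \<rho> B = rep_avg \<rho> B ** X"
  using integral_haar_cong[of B "\<lambda>A. X ** \<rho> A" "\<lambda>A. \<rho> A ** X"] comm
  by (simp add: rep_avg_mult_left[OF \<rho>] rep_avg_mult_right[OF \<rho>])

lemma rep_avg_idem: "unitary_rep \<rho> \<Longrightarrow> rep_avg \<rho> B ** rep_avg \<rho> B = rep_avg \<rho> B"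
  by (rule mult_rep_avg_eqI) (auto intro: rep_avg_mult_rep)

text \<open>The complement of an orthogonal projection is again one. This turns the form of the
  Laplacian into a weighted sum of squared distances.\<close>

lemma cinner_id_minus_rep_avg:
  assumes "unitary_rep \<rho>"
  shows "cinner u (u - rep_avg \<rho> B *v u) = of_real ((norm (u - rep_avg \<rho> B *v u))\<^sup>2)"
proof -
  have "cinner (rep_avg \<rho> B *v u) (u - rep_avg \<rho> B *v u) = 0"
    by (simp add: cinner_hermitian[OF cadj_rep_avg[OF assms]] matrix_vector_mult_diff_distrib
        matrix_vector_mul_assoc rep_avg_idem[OF assms])
  then show ?thesis by (simp only: cinner_self[symmetric] cinner_diff_left) simp
qed

subsection \<open>The Laplacian\<close>

lemma hyper_laplacian_eq: "hyper_laplacian w \<rho> = (\<Sum>B\<in>UNIV. w B *\<^sub>R (mat 1 - rep_avg \<rho> B))"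
  by (simp add: hyper_laplacian_def rep_avg_def)

lemma cadj_hyper_laplacian:
  fixes \<rho> :: "complex^('n::{finite,linorder})^('n::{finite,linorder}) \<Rightarrow> complex^'d^'d"
  shows "unitary_rep \<rho> \<Longrightarrow> cadj (hyper_laplacian w \<rho>) = hyper_laplacian w \<rho>"
  by (simp add: hyper_laplacian_eq cadj_sum cadj_scaleR cadj_diff cadj_rep_avg)

lemma hyper_laplacian_vec:
  "hyper_laplacian w \<rho> *v u = (\<Sum>B\<in>UNIV. w B *\<^sub>R (u - rep_avg \<rho> B *v u))"
  by (simp add: hyper_laplacian_eq sum_matrix_vector_mult scaleR_matrix_vector_mult
      matrix_vector_mult_diff_rdistrib)

lemma hyper_laplacian_form:
  fixes \<rho> :: "complex^('n::{finite,linorder})^('n::{finite,linorder}) \<Rightarrow> complex^'d^'d"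
  shows "unitary_rep \<rho> \<Longrightarrow>
    Re (cinner u (hyper_laplacian w \<rho> *v u)) = (\<Sum>B\<in>UNIV. w B * (norm (u - rep_avg \<rho> B *v u))\<^sup>2)"
  by (simp add: hyper_laplacian_vec cinner_sum_right cinner_scaleR_right cinner_id_minus_rep_avg
      del: of_real_power)

text \<open>The minimal Rayleigh quotient is itself an eigenvalue, hence at least
  \<open>lambda_min\<close>; any \<open>u\<close> can therefore serve as a test vector.\<close>

lemma lambda_min_le_rayleigh:
  fixes \<rho> :: "complex^('n::{finite,linorder})^('n::{finite,linorder}) \<Rightarrow> complex^'d^'d"
  assumes \<rho>: "unitary_rep \<rho>"
  shows "lambda_min w \<rho> * (norm u)\<^sup>2 \<le> Re (cinner u (hyper_laplacian w \<rho> *v u))"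
proof -
  note herm = cadj_hyper_laplacian[OF \<rho>, of w]
  obtain m v where v: "v \<noteq> 0" "hyper_laplacian w \<rho> *v v = of_real m *s v"
    and m: "\<And>u. m * (norm u)\<^sup>2 \<le> Re (cinner u (hyper_laplacian w \<rho> *v u))"
    using hermitian_min_eigenvector[OF herm] by metis
  have "complex_of_real m \<in> c_eigenvalues (hyper_laplacian w \<rho>)" using v by (auto simp: c_eigenvalues_def)
  then have "m \<in> Re ` c_eigenvalues (hyper_laplacian w \<rho>)" by force
  then have "lambda_min w \<rho> \<le> m"
    unfolding lambda_min_def by (intro Min_le finite_imageI hermitian_finite_eigenvalues herm)
  then show ?thesis using m[of u] by (meson mult_right_mono order_trans zero_le_power2)
qed

lemma lambda_min_eigenvector:
  fixes \<rho> :: "complex^('n::{finite,linorder})^('n::{finite,linorder}) \<Rightarrow> complex^'d^'d"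
  assumes \<rho>: "unitary_rep \<rho>"
  obtains v where "v \<noteq> 0" "hyper_laplacian w \<rho> *v v = lambda_min w \<rho> *\<^sub>R v"
proof -
  note herm = cadj_hyper_laplacian[OF \<rho>, of w]
  have "c_eigenvalues (hyper_laplacian w \<rho>) \<noteq> {}"
    using hermitian_min_eigenvector[OF herm] unfolding c_eigenvalues_def by blast
  then have "lambda_min w \<rho> \<in> Re ` c_eigenvalues (hyper_laplacian w \<rho>)"
    unfolding lambda_min_def by (intro Min_in finite_imageI hermitian_finite_eigenvalues herm) auto
  then obtain c v where "v \<noteq> 0" "hyper_laplacian w \<rho> *v v = c *s v" "lambda_min w \<rho> = Re c"
    by (auto simp: c_eigenvalues_def)
  then show thesis
    using that hermitian_eigenvalue_real[OF herm] by (metis scaleR_eq_vec_scale)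
qed

subsection \<open>Diagonal matrices\<close>

definition diagm :: "('n \<Rightarrow> complex) \<Rightarrow> complex^'n^'n" where
  "diagm f = (\<chi> i j. if i = j then f i else 0)"

lemma diagm_nth: "diagm f $ i $ j = (if i = j then f i else 0)"
  by (simp add: diagm_def)

lemma diagm_mult_nth: "(diagm f ** X) $ i $ j = f i * X $ i $ j"
  by (simp add: matrix_mult_nth diagm_nth if_distribR if_distrib cong: if_cong)

lemma mult_diagm_nth: "(X ** diagm f) $ i $ j = X $ i $ j * f j"
  by (simp add: matrix_mult_nth diagm_nth if_distribR if_distrib cong: if_cong)

lemma diagm_mult: "diagm f ** diagm g = diagm (\<lambda>i. f i * g i)"
  by (simp add: vec_eq_iff diagm_mult_nth diagm_nth)

lemma diagm_1: "diagm (\<lambda>i. 1) = mat 1"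
  by (simp add: vec_eq_iff diagm_nth mat_1_nth)

lemma cadj_diagm: "cadj (diagm f) = diagm (\<lambda>i. cnj (f i))"
  by (auto simp: vec_eq_iff diagm_nth)

lemma unitary_diagm: "(\<And>i. cmod (f i) = 1) \<Longrightarrow> unitary_mat (diagm f)"
  by (simp add: unitary_mat_def cadj_diagm diagm_mult diagm_1 complex_norm_square[symmetric] mult.commute[of "cnj _"])

lemma torusE:
  assumes "t \<in> torus"
  obtains f where "t = diagm f" "\<And>i. cmod (f i) = 1"
proof
  show "t = diagm (\<lambda>i. t $ i $ i)" using assms by (auto simp: torus_def vec_eq_iff diagm_nth)
  fix i
  have off: "\<And>j. j \<noteq> i \<Longrightarrow> t $ j $ i = 0" using assms by (auto simp: torus_def)
  have "(\<Sum>j\<in>UNIV. (cmod (t $ j $ i))\<^sup>2) = (\<Sum>j\<in>UNIV. if j = i then (cmod (t $ j $ i))\<^sup>2 else 0)"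
    by (intro sum.cong) (auto simp: off)
  then have "(cmod (t $ i $ i))\<^sup>2 = 1"
    using unitary_column_norm[of t i] assms by (simp add: torus_def U_group_def)
  then show "cmod (t $ i $ i) = 1" by (simp add: power2_eq_1_iff) (metis norm_ge_zero not_one_le_zero neg_0_le_iff_le)
qed

lemma diagm_in_torus: "(\<And>i. cmod (f i) = 1) \<Longrightarrow> diagm f \<in> torus"
  by (auto simp: torus_def U_group_def unitary_diagm diagm_nth)

lemma torus_subset: "torus \<subseteq> U_group"
  by (auto simp: torus_def)

lemma diagm_in_U_sub_singleton: "cmod z = 1 \<Longrightarrow> diagm (\<lambda>j. if j = i then z else 1) \<in> U_sub {i}"
  by (auto simp: U_sub_def U_group_def diagm_nth intro!: unitary_diagm)

subsection \<open>Degree bounds for eigenvalues\<close>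

text \<open>A torus element is a finite product of elements of the groups \<open>U_sub {i}\<close>,
  so the coordinate averages detect torus invariance.\<close>

lemma tor_invI:
  assumes \<rho>: "unitary_rep \<rho>" and fixed: "\<And>i. rep_avg \<rho> {i} *v v = v"
  shows "v \<in> tor_inv \<rho>"
  unfolding tor_inv_def
proof (clarify)
  fix t :: "complex^('a::{finite,linorder})^('a::{finite,linorder})" assume "t \<in> torus"
  then obtain f where f: "t = diagm f" "\<And>i. cmod (f i) = 1" using torusE by metis
  have fix1: "\<rho> g *v v = v" if "g \<in> U_sub {i}" for g i
    using rep_mult_rep_avg[OF \<rho> that] fixed[of i] by (metis matrix_vector_mul_assoc)
  define T where "T J = diagm (\<lambda>j. if j \<in> J then f j else 1)" for J
  have TU: "T J \<in> U_group" for J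
    unfolding T_def U_group_def using f(2) by (auto intro: unitary_diagm)
  have "\<rho> (T J) *v v = v" for J
  proof (induction J rule: finite_induct[OF finite])
    case 1
    then show ?case by (simp add: T_def diagm_1 rep_one[OF \<rho>])
  next
    case (2 i J)
    define d where "d = diagm (\<lambda>j. if j = i then f i else 1)"
    have d: "d \<in> U_sub {i}" unfolding d_def using f(2) by (rule diagm_in_U_sub_singleton)
    have "T (insert i J) = d ** T J"
      using 2 unfolding T_def d_def diagm_mult by (intro arg_cong[of _ _ diagm]) auto
    then show ?case
      using 2 fix1[OF d] subsetD[OF U_sub_subset d] by (simp add: rep_mult_vec[OF \<rho> _ TU])
  qed
  from this[of UNIV] show "\<rho> t *v v = v" by (simp add: T_def f(1))
qed

lemma U_sub_singleton_commute:
  assumes g: "g \<in> U_sub {i}" and h: "h \<in> U_sub B" and "i \<notin> B"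
  shows "g ** h = h ** g"
proof -
  have "g $ p $ q = 0" if "p \<noteq> q" for p q
    using g that by (cases "p = i") (auto simp: U_sub_def)
  then have "g = diagm (\<lambda>j. g $ j $ j)" by (simp add: vec_eq_iff diagm_nth)
  then obtain f where f: "g = diagm f" by metis
  have f1: "f j = 1" if "j \<noteq> i" for j
    using g that by (auto simp: f U_sub_def diagm_nth dest!: spec[of _ j])
  have "f p * h $ p $ q = h $ p $ q * f q" for p q
    using f1[of p] f1[of q] h \<open>i \<notin> B\<close> by (cases "p = i"; cases "q = i") (auto simp: U_sub_def)
  then show ?thesis by (simp add: f vec_eq_iff diagm_mult_nth mult_diagm_nth)
qed

text \<open>Either \<open>i\<close> lies in \<open>B\<close> and the larger average absorbs the
  smaller one, or the two subgroups commute elementwise. Consequently every coordinate average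
  commutes with the Laplacian.\<close>

lemma rep_avg_singleton_commute:
  assumes \<rho>: "unitary_rep \<rho>"
  shows "rep_avg \<rho> {i} ** rep_avg \<rho> B = rep_avg \<rho> B ** rep_avg \<rho> {i}"
    and "i \<in> B \<Longrightarrow> rep_avg \<rho> B ** rep_avg \<rho> {i} = rep_avg \<rho> B"
proof -
  show right: "rep_avg \<rho> B ** rep_avg \<rho> {i} = rep_avg \<rho> B" if "i \<in> B"
    using that U_sub_mono[of "{i}" B] by (intro mult_rep_avg_eqI rep_avg_mult_rep \<rho>) auto
  show "rep_avg \<rho> {i} ** rep_avg \<rho> B = rep_avg \<rho> B ** rep_avg \<rho> {i}"
  proof (cases "i \<in> B")
    case True
    then have "rep_avg \<rho> {i} ** rep_avg \<rho> B = rep_avg \<rho> B"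
      using U_sub_mono[of "{i}" B] by (intro rep_avg_mult_eqI rep_mult_rep_avg \<rho>) auto
    then show ?thesis using right True by simp
  next
    case False
    show ?thesis
    proof (intro rep_avg_commute \<rho>)
      fix h assume h: "h \<in> U_sub B"
      have "\<rho> h ** rep_avg \<rho> {i} = rep_avg \<rho> {i} ** \<rho> h"
      proof (intro rep_avg_commute \<rho>)
        fix g assume g: "g \<in> U_sub {i}"
        show "\<rho> h ** \<rho> g = \<rho> g ** \<rho> h"
          using U_sub_singleton_commute[OF g h False] g h U_sub_subset rep_mult[OF \<rho>] by (metis subsetD)
      qed
      then show "rep_avg \<rho> {i} ** \<rho> h = \<rho> h ** rep_avg \<rho> {i}" by simp
    qed
  qed
qed

text \<open>Removing the part of \<open>v\<close> fixed by the \<open>i\<close>-th circle keeps the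
  eigenvalue, since that average commutes with the Laplacian. Every \<open>B\<close> containing
  \<open>i\<close> then contributes its full weight, and the remaining terms are
  nonnegative.\<close>

lemma eigenvalue_ge_degree:
  fixes \<rho> :: "complex^('n::{finite,linorder})^('n::{finite,linorder}) \<Rightarrow> complex^'d^'d"
  assumes \<rho>: "unitary_rep \<rho>" and w: "\<And>B. w B \<ge> 0" and v: "v \<noteq> 0" "v \<in> orth_compl (tor_inv \<rho>)"
    and ev: "hyper_laplacian w \<rho> *v v = \<alpha> *\<^sub>R v"
  obtains i where "(\<Sum>B\<in>{B. i \<in> B}. w B) \<le> \<alpha>"
proof -
  \<comment> \<open>Otherwise \<open>v\<close> would be torus invariant and thus orthogonal to
    itself.\<close>
  have "\<exists>i. rep_avg \<rho> {i} *v v \<noteq> v"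
  proof (rule ccontr)
    assume "\<not> ?thesis"
    then have "v \<in> tor_inv \<rho>" by (intro tor_invI \<rho>) auto
    then have "cinner v v = 0" using v(2) by (auto simp: orth_compl_def)
    then show False using v(1) by simp
  qed
  then obtain i where i: "rep_avg \<rho> {i} *v v \<noteq> v" by auto
  define u where "u = v - rep_avg \<rho> {i} *v v"
  have "u \<noteq> 0" using i by (simp add: u_def)
  have comm: "rep_avg \<rho> B *v (rep_avg \<rho> {i} *v v) = rep_avg \<rho> {i} *v (rep_avg \<rho> B *v v)" for B
    by (simp only: matrix_vector_mul_assoc rep_avg_singleton_commute(1)[OF \<rho>, of i B])
  have "hyper_laplacian w \<rho> *v (rep_avg \<rho> {i} *v v) = rep_avg \<rho> {i} *v (hyper_laplacian w \<rho> *v v)"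
    by (simp only: hyper_laplacian_vec comm matrix_vector_mult_sum scaleR_eq_vec_scale
        matrix_vector_mult_scale matrix_vector_mult_diff_distrib)
  then have "hyper_laplacian w \<rho> *v u = \<alpha> *\<^sub>R u"
    by (simp add: u_def ev matrix_vector_mult_diff_distrib scaleR_eq_vec_scale matrix_vector_mult_scale
        vector_ssub_ldistrib)
  then have "\<alpha> * (norm u)\<^sup>2 = Re (cinner u (hyper_laplacian w \<rho> *v u))"
    by (simp add: cinner_scaleR_right cinner_self del: of_real_power)
  also have "\<dots> = (\<Sum>B\<in>UNIV. w B * (norm (u - rep_avg \<rho> B *v u))\<^sup>2)"
    by (rule hyper_laplacian_form[OF \<rho>])
  also have "\<dots> \<ge> (\<Sum>B\<in>{B. i \<in> B}. w B * (norm (u - rep_avg \<rho> B *v u))\<^sup>2)"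
    by (rule sum_mono2) (auto simp: w)
  also have "(\<Sum>B\<in>{B. i \<in> B}. w B * (norm (u - rep_avg \<rho> B *v u))\<^sup>2) = (\<Sum>B\<in>{B. i \<in> B}. w B) * (norm u)\<^sup>2"
  proof -
    have "rep_avg \<rho> B *v u = 0" if "i \<in> B" for B
      using rep_avg_singleton_commute(2)[OF \<rho> that]
      by (simp add: u_def matrix_vector_mult_diff_distrib matrix_vector_mul_assoc)
    then show ?thesis by (simp add: sum_distrib_right)
  qed
  finally have "(\<Sum>B\<in>{B. i \<in> B}. w B) \<le> \<alpha>" using \<open>u \<noteq> 0\<close> by simp
  then show thesis by (rule that)
qed

text \<open>\<open>x\<close> is the test vector: sets avoiding \<open>i\<close> contribute nothing
  because their groups lie in \<open>U_sub (- {i})\<close>, and the other terms are bounded because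
  \<open>I\<close> minus an average is a contraction.\<close>

lemma lambda_min_le_degree:
  fixes \<rho> :: "complex^('n::{finite,linorder})^('n::{finite,linorder}) \<Rightarrow> complex^'d^'d"
  assumes \<rho>: "unitary_rep \<rho>" and w: "\<And>B. w B \<ge> 0" and x: "x \<noteq> 0"
    and fixed: "\<And>g. g \<in> U_sub (- {i}) \<Longrightarrow> \<rho> g *v x = x"
  shows "lambda_min w \<rho> \<le> (\<Sum>B\<in>{B. i \<in> B}. w B)"
proof -
  have "norm (x - rep_avg \<rho> B *v x) \<le> norm x" for B
  proof -
    have "Re (cinner (rep_avg \<rho> B *v x) x) \<ge> 0"
    proof -
      have "cinner (rep_avg \<rho> B *v x) x = cinner (rep_avg \<rho> B *v x) (rep_avg \<rho> B *v x)"
        by (metis cinner_hermitian[OF cadj_rep_avg[OF \<rho>]] matrix_vector_mul_assoc rep_avg_idem[OF \<rho>])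
      then show ?thesis by (simp add: cinner_self del: of_real_power)
    qed
    moreover have "Re (cinner (rep_avg \<rho> B *v x) x) = Re (cinner x (rep_avg \<rho> B *v x))"
      using arg_cong[OF cnj_cinner[of "rep_avg \<rho> B *v x" x], of Re] by simp
    moreover have "(norm x)\<^sup>2 - Re (cinner x (rep_avg \<rho> B *v x)) = (norm (x - rep_avg \<rho> B *v x))\<^sup>2"
      using arg_cong[OF cinner_id_minus_rep_avg[OF \<rho>, of x B], of Re]
      by (simp add: cinner_diff_right cinner_self del: of_real_power)
    ultimately have "(norm (x - rep_avg \<rho> B *v x))\<^sup>2 \<le> (norm x)\<^sup>2" by linarith
    then show ?thesis by (rule power2_le_imp_le) simp
  qed
  then have le: "(norm (x - rep_avg \<rho> B *v x))\<^sup>2 \<le> (norm x)\<^sup>2" for B by (simp add: power_mono)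
  have "lambda_min w \<rho> * (norm x)\<^sup>2 \<le> Re (cinner x (hyper_laplacian w \<rho> *v x))"
    by (rule lambda_min_le_rayleigh[OF \<rho>])
  also have "\<dots> = (\<Sum>B\<in>UNIV. w B * (norm (x - rep_avg \<rho> B *v x))\<^sup>2)"
    by (rule hyper_laplacian_form[OF \<rho>])
  also have "\<dots> = (\<Sum>B\<in>{B. i \<in> B}. w B * (norm (x - rep_avg \<rho> B *v x))\<^sup>2)"
  proof (rule sum.mono_neutral_right)
    have "rep_avg \<rho> B *v x = x" if "i \<notin> B" for B
    proof (rule rep_avg_fixed[OF \<rho>])
      fix g assume "g \<in> U_sub B"
      then show "\<rho> g *v x = x" using U_sub_mono[of B "- {i}"] that fixed by auto
    qed
    then show "\<forall>B\<in>UNIV - {B. i \<in> B}. w B * (norm (x - rep_avg \<rho> B *v x))\<^sup>2 = 0" by auto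
  qed auto
  also have "\<dots> \<le> (\<Sum>B\<in>{B. i \<in> B}. w B) * (norm x)\<^sup>2"
    unfolding sum_distrib_right by (intro sum_mono mult_left_mono le w)
  finally show ?thesis using x by simp
qed

text \<open>Scalar matrices are central, so irreducibility spreads their action on the highest
  weight vector to the whole space; a torus element acting as -1 leaves no nonzero invariant
  vector.\<close>

lemma unbalanced_tor_inv:
  fixes \<rho> :: "complex^('n::{finite,linorder})^('n::{finite,linorder}) \<Rightarrow> complex^'d^'d"
  assumes irr: "irreducible_rep \<rho>" and unb: "unbalanced \<rho>"
  shows "tor_inv \<rho> = {0}"
proof -
  have \<rho>: "unitary_rep \<rho>" using irr by (simp add: irreducible_rep_def)
  obtain \<mu> v where \<mu>: "(\<Sum>i\<in>UNIV. \<mu> i) \<noteq> 0" and v: "v \<noteq> 0"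
      "\<And>t. t \<in> torus \<Longrightarrow> \<rho> t *v v = (\<Prod>i\<in>UNIV. (t $ i $ i) powi \<mu> i) *s v"
    using unb by (auto simp: unbalanced_def highest_weight_def is_weight_def)
  define s where "s = (\<Sum>i\<in>UNIV. \<mu> i)"
  \<comment> \<open>The scalar \<open>c\<close> acts on the weight vector by
    \<open>c powi s\<close>; this angle makes that factor -1.\<close>
  define c where "c = cis (pi / of_int s)"
  define D where "D = (diagm (\<lambda>i. c) :: complex^('n::{finite,linorder})^('n::{finite,linorder}))"
  have "s \<noteq> 0" using \<mu> by (simp add: s_def)
  then have "c powi s = cis pi" by (simp add: c_def cis_power_int)
  then have cs: "c powi s = - 1" by simp
  have c0: "c \<noteq> 0" by (simp add: c_def)
  have D: "D \<in> torus" unfolding D_def by (rule diagm_in_torus) (simp add: c_def)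
  have Dv: "\<rho> D *v v = (- 1) *s v"
  proof -
    have "(\<Prod>i\<in>J. c powi \<mu> i) = c powi (\<Sum>i\<in>J. \<mu> i)" for J
      by (induction J rule: infinite_finite_induct) (auto simp: power_int_add c0)
    then have "(\<Prod>i\<in>(UNIV::'n set). c powi \<mu> i) = c powi s"
      by (simp add: s_def)
    then show ?thesis using v(2)[OF D] cs by (simp add: D_def diagm_nth)
  qed
  define W where "W = {u. \<rho> D *v u = (- 1) *s u}"
  have "csubspace W"
    unfolding csubspace_def W_def
    by (auto simp: matrix_vector_right_distrib matrix_vector_mult_scale vector_smult_assoc mult.commute)
  moreover have "\<rho> A *v u \<in> W" if A: "A \<in> U_group" and u: "u \<in> W" for A u
  proof -
    have "D ** A = A ** D" by (simp add: D_def vec_eq_iff diagm_mult_nth mult_diagm_nth)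
    then have "\<rho> D *v (\<rho> A *v u) = \<rho> A *v (\<rho> D *v u)"
      using A D torus_subset by (metis rep_mult_vec[OF \<rho>] subsetD)
    then show ?thesis using u by (simp only: W_def mem_Collect_eq matrix_vector_mult_scale)
  qed
  ultimately have "W = {0} \<or> W = UNIV" using irr by (auto simp: irreducible_rep_def)
  moreover have "v \<in> W" using Dv by (simp add: W_def)
  ultimately have W: "W = UNIV" using v(1) by auto
  show ?thesis
  proof (rule antisym)
    show "tor_inv \<rho> \<subseteq> {0}"
    proof
      fix u assume "u \<in> tor_inv \<rho>"
      then have "\<rho> D *v u = u" using D by (simp add: tor_inv_def)
      moreover have "u \<in> W" using W by simp
      ultimately have "u = (- 1) *s u" unfolding W_def by simp
      then have "u $ i = - u $ i" for i by (metis vector_smult_component mult_minus1)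
      then show "u \<in> {0}" by (auto simp: vec_eq_iff)
    qed
  qed (simp add: tor_inv_def)
qed

subsection \<open>Elementary matrices\<close>

lemma matrix_inv_eqI:
  fixes X Y :: "complex^'n^'n"
  assumes "X ** Y = mat 1" shows "matrix_inv X = Y"
proof -
  have YX: "Y ** X = mat 1" using assms by (simp add: matrix_left_right_inverse)
  have "X ** matrix_inv X = mat 1 \<and> matrix_inv X ** X = mat 1"
    unfolding matrix_inv_def by (rule someI[of _ Y]) (simp add: assms YX)
  then have "Y ** (X ** matrix_inv X) = Y" by simp
  then show ?thesis by (simp add: matrix_mul_assoc YX)
qed

lemma matrix_inv_mult_self:
  fixes X :: "complex^'n^'n"
  assumes "invertible X" shows "X ** matrix_inv X = mat 1" "matrix_inv X ** X = mat 1"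
  using assms matrix_inv_eqI unfolding invertible_def by metis+

lemma invertibleI:
  fixes X :: "complex^'n^'n"
  shows "X ** Y = mat 1 \<Longrightarrow> invertible X"
  using matrix_left_right_inverse unfolding invertible_def by blast

lemma invertible_mult_iff:
  fixes X Y :: "complex^'n^'n"
  shows "invertible (X ** Y) \<longleftrightarrow> invertible X \<and> invertible Y"
  by (simp add: invertible_det_nz det_mul)

lemma matrix_inv_mult:
  fixes X Y :: "complex^'n^'n"
  assumes "invertible X" "invertible Y"
  shows "matrix_inv (X ** Y) = matrix_inv Y ** matrix_inv X"
proof (rule matrix_inv_eqI)
  have "X ** Y ** (matrix_inv Y ** matrix_inv X) = X ** (Y ** matrix_inv Y) ** matrix_inv X"
    by (simp add: matrix_mul_assoc)
  then show "X ** Y ** (matrix_inv Y ** matrix_inv X) = mat 1" by (simp add: matrix_inv_mult_self assms)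
qed

lemma matrix_inv_unitary: "unitary_mat g \<Longrightarrow> matrix_inv g = cadj g"
  by (rule matrix_inv_eqI) (simp add: unitary_mat_def)

lemma invertible_unitary: "unitary_mat g \<Longrightarrow> invertible g"
  by (rule invertibleI[of _ "cadj g"]) (simp add: unitary_mat_def)

lemma invertible_mat_1 [simp]: "invertible (mat 1 :: complex^'n^'n)"
  by (rule invertible_unitary) simp

lemma matrix_inv_mat_1 [simp]: "matrix_inv (mat 1 :: complex^'n^'n) = mat 1"
  by (rule matrix_inv_eqI) simp

lemma matrix_inv_cadj:
  fixes X :: "complex^'n^'n" shows "invertible X \<Longrightarrow> matrix_inv (cadj X) = cadj (matrix_inv X)"
  by (rule matrix_inv_eqI) (simp add: cadj_mult[symmetric] matrix_inv_mult_self)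

definition dg :: "'n \<Rightarrow> complex \<Rightarrow> complex^'n^'n" where
  "dg i z = diagm (\<lambda>j. if j = i then z else 1)"

text \<open>For \<open>i \<noteq> j\<close> this is the elementary transvection, a one-parameter
  root subgroup in \<open>s\<close>.\<close>

definition tv :: "'n \<Rightarrow> 'n \<Rightarrow> complex \<Rightarrow> complex^'n^'n" where
  "tv i j s = (\<chi> p q. (if p = q then 1 else 0) + (if p = i \<and> q = j then s else 0))"

text \<open>Gauss transformation: the product of the transvections \<open>tv p i (a p)\<close>.
  Ignoring \<open>a i\<close> allows quotients by a pivot to be inserted without an exception at
  \<open>i\<close>.\<close>

definition colm :: "'n \<Rightarrow> ('n \<Rightarrow> complex) \<Rightarrow> complex^'n^'n" where
  "colm i a = (\<chi> p q. (if p = q then 1 else 0) + (if q = i \<and> p \<noteq> i then a p else 0))"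

definition rowm :: "'n \<Rightarrow> ('n \<Rightarrow> complex) \<Rightarrow> complex^'n^'n" where
  "rowm i b = (\<chi> p q. (if p = q then 1 else 0) + (if p = i \<and> q \<noteq> i then b q else 0))"

lemma colm_nth: "colm i a $ p $ q = (if p = q then 1 else 0) + (if q = i \<and> p \<noteq> i then a p else 0)"
  by (simp add: colm_def)

lemma rowm_nth: "rowm i b $ p $ q = (if p = q then 1 else 0) + (if p = i \<and> q \<noteq> i then b q else 0)"
  by (simp add: rowm_def)

lemma dg_mult_nth: "(dg i z ** X) $ p $ q = (if p = i then z else 1) * X $ p $ q"
  by (simp add: dg_def diagm_mult_nth)

lemma mult_dg_nth: "(X ** dg i z) $ p $ q = X $ p $ q * (if q = i then z else 1)"
  by (simp add: dg_def mult_diagm_nth)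

lemma dg_nth: "dg i z $ p $ q = (if p = q then (if p = i then z else 1) else 0)"
  by (simp add: dg_def diagm_nth)

lemma cadj_dg: "cadj (dg i z) = dg i (cnj z)"
  by (auto simp: vec_eq_iff dg_nth)

lemma dg_1 [simp]: "dg i 1 = mat 1"
  by (simp add: dg_def diagm_1[symmetric])

lemma dg_mult_dg: "dg i y ** dg i z = dg i (y * z)"
  by (auto simp: vec_eq_iff dg_mult_nth dg_nth)

lemma invertible_dg: "z \<noteq> 0 \<Longrightarrow> invertible (dg i z)"
  by (rule invertibleI[of _ "dg i (1 / z)"]) (simp add: dg_mult_dg)

lemma matrix_inv_dg: "z \<noteq> 0 \<Longrightarrow> matrix_inv (dg i z) = dg i (1 / z)"
  by (rule matrix_inv_eqI) (simp add: dg_mult_dg)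

lemma unitary_dg: "cmod z = 1 \<Longrightarrow> unitary_mat (dg i z)"
  unfolding dg_def by (rule unitary_diagm) simp

lemma tv_nth: "tv i j s $ p $ q = (if p = q then 1 else 0) + (if p = i \<and> q = j then s else 0)"
  by (simp add: tv_def)

lemma tv_mult_nth: "(tv i j s ** X) $ p $ q = X $ p $ q + (if p = i then s * X $ j $ q else 0)"
proof -
  have "(tv i j s ** X) $ p $ q
      = (\<Sum>k\<in>UNIV. (if k = p then X $ p $ q else 0) + (if k = j then (if p = i then s * X $ j $ q else 0) else 0))"
    unfolding matrix_mult_nth by (intro sum.cong) (auto simp: tv_nth algebra_simps)
  then show ?thesis by (simp add: sum.distrib)
qed

lemma mult_tv_nth: "(X ** tv i j s) $ p $ q = X $ p $ q + (if q = j then X $ p $ i * s else 0)"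
proof -
  have "(X ** tv i j s) $ p $ q
      = (\<Sum>k\<in>UNIV. (if k = q then X $ p $ q else 0) + (if k = i then (if q = j then X $ p $ i * s else 0) else 0))"
    unfolding matrix_mult_nth by (intro sum.cong) (auto simp: tv_nth algebra_simps)
  then show ?thesis by (simp add: sum.distrib)
qed

lemma tv_0 [simp]: "tv i j 0 = mat 1"
  by (simp add: vec_eq_iff tv_nth mat_1_nth)

lemma tv_mult_tv: "i \<noteq> j \<Longrightarrow> tv i j s ** tv i j t = tv i j (s + t)"
  by (auto simp: vec_eq_iff tv_mult_nth tv_nth)

lemma invertible_tv: "i \<noteq> j \<Longrightarrow> invertible (tv i j s)"
  by (rule invertibleI[of _ "tv i j (- s)"]) (simp add: tv_mult_tv)

lemma matrix_inv_tv: "i \<noteq> j \<Longrightarrow> matrix_inv (tv i j s) = tv i j (- s)"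
  by (rule matrix_inv_eqI) (simp add: tv_mult_tv)

lemma diagm_tv_conj:
  assumes "\<And>p. f p \<noteq> 0"
  shows "diagm f ** tv i j s ** diagm (\<lambda>p. 1 / f p) = tv i j (f i / f j * s)"
  using assms by (auto simp: vec_eq_iff diagm_mult_nth mult_diagm_nth tv_nth)

lemma colm_mult_nth: "(colm i a ** X) $ p $ q = X $ p $ q + (if p \<noteq> i then a p * X $ i $ q else 0)"
proof -
  have "(colm i a ** X) $ p $ q
      = (\<Sum>k\<in>UNIV. (if k = p then X $ p $ q else 0) + (if k = i then (if p \<noteq> i then a p * X $ i $ q else 0) else 0))"
    unfolding matrix_mult_nth by (intro sum.cong) (auto simp: colm_nth algebra_simps)
  then show ?thesis by (simp add: sum.distrib)
qed

lemma mult_rowm_nth: "(X ** rowm i b) $ p $ q = X $ p $ q + (if q \<noteq> i then X $ p $ i * b q else 0)"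
proof -
  have "(X ** rowm i b) $ p $ q
      = (\<Sum>k\<in>UNIV. (if k = q then X $ p $ q else 0) + (if k = i then (if q \<noteq> i then X $ p $ i * b q else 0) else 0))"
    unfolding matrix_mult_nth by (intro sum.cong) (auto simp: rowm_nth algebra_simps)
  then show ?thesis by (simp add: sum.distrib)
qed

lemma colm_inverse: "colm i a ** colm i (\<lambda>p. - a p) = mat 1"
  by (auto simp: vec_eq_iff colm_mult_nth colm_nth mat_1_nth)

lemma rowm_inverse: "rowm i b ** rowm i (\<lambda>p. - b p) = mat 1"
  by (auto simp: vec_eq_iff mult_rowm_nth rowm_nth mat_1_nth)

lemma cadj_colm: "cadj (colm i a) = rowm i (\<lambda>p. cnj (a p))"
  by (auto simp: vec_eq_iff rowm_nth colm_nth)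

lemma cadj_rowm: "cadj (rowm i a) = colm i (\<lambda>p. cnj (a p))"
  by (auto simp: vec_eq_iff rowm_nth colm_nth)

text \<open>Transvections of one column multiply by adding their entries, so they can be collected
  index by index. Asking only for \<open>p\<close> with \<open>a p \<noteq> 0\<close> lets the zero
  pattern of \<open>a\<close> confine the generators to a block.\<close>

lemma colm_generated:
  fixes P :: "complex^'n^'n \<Rightarrow> bool"
  assumes mult: "\<And>X Y. P X \<Longrightarrow> P Y \<Longrightarrow> P (X ** Y)" and one: "P (mat 1)"
    and tv: "\<And>p s. p \<noteq> i \<Longrightarrow> a p \<noteq> 0 \<Longrightarrow> P (tv p i s)"
  shows "P (colm i a)"
proof -
  have "P (colm i (\<lambda>p. if p \<in> J then a p else 0))" for J
  proof (induction J rule: finite_induct[OF finite])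
    case 1
    have "colm i (\<lambda>p. 0) = mat 1" by (simp add: vec_eq_iff colm_nth mat_1_nth)
    then show ?case using one by simp
  next
    case (2 p J)
    show ?case
    proof (cases "p \<noteq> i \<and> a p \<noteq> 0")
      case True
      then have "colm i (\<lambda>q. if q \<in> insert p J then a q else 0)
          = tv p i (a p) ** colm i (\<lambda>q. if q \<in> J then a q else 0)"
        using 2 by (auto simp: vec_eq_iff tv_mult_nth colm_nth)
      then show ?thesis using mult tv True 2 by metis
    next
      case False
      then have "colm i (\<lambda>q. if q \<in> insert p J then a q else 0) = colm i (\<lambda>q. if q \<in> J then a q else 0)"
        by (auto simp: vec_eq_iff colm_nth)
      then show ?thesis using 2 by simp
    qed
  qed
  from this[of UNIV] show ?thesis by simp
qed

lemma rowm_generated: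
  fixes P :: "complex^'n^'n \<Rightarrow> bool"
  assumes mult: "\<And>X Y. P X \<Longrightarrow> P Y \<Longrightarrow> P (X ** Y)" and one: "P (mat 1)"
    and tv: "\<And>q s. q \<noteq> i \<Longrightarrow> b q \<noteq> 0 \<Longrightarrow> P (tv i q s)"
  shows "P (rowm i b)"
proof -
  have "P (rowm i (\<lambda>p. if p \<in> J then b p else 0))" for J
  proof (induction J rule: finite_induct[OF finite])
    case 1
    have "rowm i (\<lambda>p. 0) = mat 1" by (simp add: vec_eq_iff rowm_nth mat_1_nth)
    then show ?case using one by simp
  next
    case (2 p J)
    show ?case
    proof (cases "p \<noteq> i \<and> b p \<noteq> 0")
      case True
      then have "rowm i (\<lambda>q. if q \<in> insert p J then b q else 0)
          = rowm i (\<lambda>q. if q \<in> J then b q else 0) ** tv i p (b p)"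
        using 2 by (auto simp: vec_eq_iff mult_tv_nth rowm_nth)
      then show ?thesis using mult tv True 2 by metis
    next
      case False
      then have "rowm i (\<lambda>q. if q \<in> insert p J then b q else 0) = rowm i (\<lambda>q. if q \<in> J then b q else 0)"
        by (auto simp: vec_eq_iff rowm_nth)
      then show ?thesis using 2 by simp
    qed
  qed
  from this[of UNIV] show ?thesis by simp
qed

section \<open>Gauss elimination inside a block\<close>

definition block :: "'n set \<Rightarrow> complex^'n^'n \<Rightarrow> bool" where
  "block M X \<longleftrightarrow> (\<forall>p q. p \<notin> M \<or> q \<notin> M \<longrightarrow> X $ p $ q = (if p = q then 1 else 0))"

text \<open>One elimination step: \<open>X'\<close> carries the Schur complement of the pivot. The
  multipliers vanish outside \<open>M\<close> because \<open>X\<close> is the identity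
  there.\<close>

lemma pivot_decomposition:
  assumes X: "block M X" and i: "i \<in> M" and pivot: "X $ i $ i \<noteq> 0"
  obtains a b X' where "X = colm i a ** (dg i (X $ i $ i) ** X') ** rowm i b" "block (M - {i}) X'"
    "\<And>p. p \<notin> M \<Longrightarrow> a p = 0 \<and> b p = 0"
proof
  let ?a = "\<lambda>p. X $ p $ i / X $ i $ i" and ?b = "\<lambda>q. X $ i $ q / X $ i $ i"
  let ?X' = "\<chi> p q. if p = i \<or> q = i then (if p = q then 1 else 0) else X $ p $ q - X $ p $ i * X $ i $ q / X $ i $ i"
  show "X = colm i ?a ** (dg i (X $ i $ i) ** ?X') ** rowm i ?b"
    using pivot by (auto simp: vec_eq_iff mult_rowm_nth colm_mult_nth dg_mult_nth)
  show "block (M - {i}) ?X'"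
    using X by (auto simp: block_def)
  show "?a p = 0 \<and> ?b p = 0" if "p \<notin> M" for p
    using X i that by (auto simp: block_def)
qed

text \<open>Induction on the block, splitting off one pivot at a time; a vanishing pivot is first
  repaired by a row addition.\<close>

lemma block_generated:
  fixes P :: "complex^'n^'n \<Rightarrow> bool"
  assumes mult: "\<And>X Y. P X \<Longrightarrow> P Y \<Longrightarrow> P (X ** Y)" and one: "P (mat 1)"
    and tv: "\<And>i j s. i \<in> M \<Longrightarrow> j \<in> M \<Longrightarrow> i \<noteq> j \<Longrightarrow> P (tv i j s)"
    and dg: "\<And>i z. i \<in> M \<Longrightarrow> z \<noteq> 0 \<Longrightarrow> P (dg i z)"
    and X: "block M X" "invertible X"
  shows "P X"
proof -
  have "finite M" by simp
  then show ?thesis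
    using tv dg X
  proof (induction M arbitrary: X rule: finite_induct)
    case empty
    then have "X = mat 1" by (simp add: block_def vec_eq_iff mat_1_nth)
    then show ?case using one by simp
  next
    case (insert i M)
    have piv: "P X" if X: "block (insert i M) X" "invertible X" "X $ i $ i \<noteq> 0" for X
    proof -
      obtain a b X' where dec: "X = colm i a ** (dg i (X $ i $ i) ** X') ** rowm i b"
        and X': "block (insert i M - {i}) X'" and ab: "\<And>p. p \<notin> insert i M \<Longrightarrow> a p = 0 \<and> b p = 0"
        by (rule pivot_decomposition[OF X(1) insertI1 X(3)]) blast
      have "invertible (colm i a ** (dg i (X $ i $ i) ** X') ** rowm i b)" using X(2) dec by simp
      then have "invertible X'" by (simp only: invertible_mult_iff)
      have "block M X'" using X' insert.hyps by simp
      have "P X'"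
        by (rule insert.IH) (use insert.prems(1,2) \<open>block M X'\<close> \<open>invertible X'\<close> in auto)
      moreover have "P (colm i a)"
      proof (rule colm_generated[OF mult one])
        fix p s assume "p \<noteq> i" "a p \<noteq> 0"
        then show "P (tv p i s)" using ab[of p] by (intro insert.prems(1)) auto
      qed
      moreover have "P (rowm i b)"
      proof (rule rowm_generated[OF mult one])
        fix p s assume "p \<noteq> i" "b p \<noteq> 0"
        then show "P (tv i p s)" using ab[of p] by (intro insert.prems(1)) auto
      qed
      moreover have "P (dg i (X $ i $ i))" using insert.prems(2) X(3) by simp
      ultimately have "P (colm i a ** (dg i (X $ i $ i) ** X') ** rowm i b)" by (intro mult)
      then show ?thesis using dec by simp
    qed
    show ?case
    proof (cases "X $ i $ i = 0")
      case False
      then show ?thesis using piv[OF insert.prems(3,4)] by simp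
    next
      case True
      have "\<exists>j. X $ j $ i \<noteq> 0"
      proof (rule ccontr)
        assume "\<not> ?thesis"
        then have "X *v axis i 1 = 0"
          by (simp add: vec_eq_iff matrix_vector_mult_nth axis_def if_distrib cong: if_cong)
        then have "matrix_inv X *v (X *v axis i 1) = 0" by simp
        then have "axis i (1::complex) = (0 :: complex^'n)"
          using matrix_inv_mult_self(2)[OF insert.prems(4)] by (simp add: matrix_vector_mul_assoc)
        then show False by simp
      qed
      then obtain j where j: "X $ j $ i \<noteq> 0" by auto
      have ji: "j \<noteq> i" using j True by auto
      have jM: "j \<in> insert i M"
      proof (rule ccontr)
        assume "j \<notin> insert i M"
        then have "X $ j $ i = (if j = i then 1 else 0)" using insert.prems(3) unfolding block_def by blast
        then show False using j ji by simp
      qed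
      \<comment> \<open>Invertibility supplies a nonzero entry in column \<open>i\<close>, and the
        block shape puts its row \<open>j\<close> inside the block; adding that row to row
        \<open>i\<close> creates a pivot.\<close>
      let ?Y = "tv i j 1 ** X"
      have "block (insert i M) ?Y"
        using insert.prems(3) jM by (auto simp: block_def tv_mult_nth)
      moreover have "invertible ?Y" using insert.prems(4) ji by (simp add: invertible_mult_iff invertible_tv)
      moreover have "?Y $ i $ i \<noteq> 0" using True j by (simp add: tv_mult_nth)
      ultimately have "P ?Y" by (rule piv)
      moreover have "X = tv i j (- 1) ** ?Y" using ji by (simp add: matrix_mul_assoc tv_mult_tv)
      moreover have "P (tv i j (- 1))" using jM ji by (intro insert.prems(1)) auto
      ultimately show ?thesis using mult[of "tv i j (- 1)" ?Y] by simp
    qed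
  qed
qed

definition emb2 :: "'n \<Rightarrow> 'n \<Rightarrow> complex \<Rightarrow> complex \<Rightarrow> complex \<Rightarrow> complex \<Rightarrow> complex^'n^'n" where
  "emb2 i j a b c d = (\<chi> p q.
     if p = i then (if q = i then a else if q = j then b else 0)
     else if p = j then (if q = i then c else if q = j then d else 0)
     else if p = q then 1 else 0)"

lemma emb2_mult_nth:
  assumes "i \<noteq> j"
  shows "(emb2 i j a b c d ** X) $ p $ q =
    (if p = i then a * X $ i $ q + b * X $ j $ q else if p = j then c * X $ i $ q + d * X $ j $ q else X $ p $ q)"
proof -
  have "(emb2 i j a b c d ** X) $ p $ q = (\<Sum>k\<in>UNIV. 
     (if k = i then (if p = i then a * X $ i $ q else if p = j then c * X $ i $ q else 0) else 0)
     + (if k = j then (if p = i then b * X $ j $ q else if p = j then d * X $ j $ q else 0) else 0)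
     + (if k = p then (if p = i \<or> p = j then 0 else X $ p $ q) else 0))"
    unfolding matrix_mult_nth using assms by (intro sum.cong) (auto simp: emb2_def)
  then show ?thesis using assms by (auto simp: sum.distrib)
qed

lemma emb2_nth: "emb2 i j a b c d $ p $ q = (if p = i then (if q = i then a else if q = j then b else 0)
     else if p = j then (if q = i then c else if q = j then d else 0)
     else if p = q then 1 else 0)"
  by (simp add: emb2_def)

lemma unitary_emb2:
  assumes "i \<noteq> j" "a * cnj a + b * cnj b = 1" "c * cnj c + d * cnj d = 1" "a * cnj c + b * cnj d = 0"
  shows "unitary_mat (emb2 i j a b c d)"
proof -
  have "c * cnj a + d * cnj b = cnj (a * cnj c + b * cnj d)" by (simp add: mult.commute)
  then have "c * cnj a + d * cnj b = 0" using assms(4) by simp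
  then have "emb2 i j a b c d ** cadj (emb2 i j a b c d) = mat 1"
    using assms by (auto simp: vec_eq_iff emb2_mult_nth emb2_nth mat_1_nth)
  then show ?thesis by (simp add: unitary_mat_def matrix_left_right_inverse)
qed

text \<open>The right-hand side is, up to diagonal factors, the QR decomposition of a diagonal matrix times
  a rotation; the Pythagorean triples (3, 4, 5) and (8, 15, 17) keep it rational.\<close>

lemma tv_via_unitaries:
  assumes "i \<noteq> j"
  shows "tv i j (- 252 / 289) = dg i (10 / 17) ** (dg j (17 / 25) **
    (emb2 i j (15/17) (8/17) (- 8/17) (15/17) ** (dg i (5/2) ** emb2 i j (3/5) (- 4/5) (4/5) (3/5))))"
  using assms by (auto simp: vec_eq_iff tv_nth dg_mult_nth emb2_mult_nth emb2_nth)

subsection \<open>Extending a representation to the general linear group\<close>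

definition smat :: "complex \<Rightarrow> complex^'m^'n \<Rightarrow> complex^'m^'n" where
  "smat c A = (\<chi> a b. c * A $ a $ b)"

lemma smat_nth [simp]: "smat c A $ a $ b = c * A $ a $ b"
  by (simp add: smat_def)

lemma smat_smat: "smat c (smat d A) = smat (c * d) A"
  by (simp add: vec_eq_iff)

lemma smat_1 [simp]: "smat 1 A = A"
  by (simp add: vec_eq_iff)

lemma mult_smat: "X ** smat c A = smat c (X ** A)"
  by (simp add: vec_eq_iff matrix_mult_nth sum_distrib_left algebra_simps)

lemma smat_mult: "smat c A ** X = smat c (A ** X)"
  by (simp add: vec_eq_iff matrix_mult_nth sum_distrib_left algebra_simps)

lemma cadj_smat: "cadj (smat c A) = smat (cnj c) (cadj A)"
  by (simp add: vec_eq_iff)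

lemma smat_vec: "smat c A *v x = c *s (A *v x)"
  by (simp add: vec_eq_iff matrix_vector_mult_nth sum_distrib_left algebra_simps)

lemma continuous_on_smat [continuous_intros]:
  "continuous_on S f \<Longrightarrow> continuous_on S g \<Longrightarrow> continuous_on S (\<lambda>x. smat (f x) (g x))"
  unfolding smat_def by (intro continuous_intros)

lemma continuous_on_trace [continuous_intros]:
  "continuous_on S f \<Longrightarrow> continuous_on S (\<lambda>x. trace (f x :: complex^'n^'n))"
  unfolding trace_def by (intro continuous_intros)

lemma linear_entry: "linear (\<lambda>M :: complex^'m^'n. M $ a $ b)"
  by (rule linearI) simp_all

lemma trace_cadj: "trace (cadj A) = cnj (trace A)"
  by (simp add: trace_def)

text \<open>On unitary \<open>X\<close> and \<open>h\<close> the two factors are conjugate and their product peaks at \<open>h = X\<close>;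
  the separate arguments \<open>X\<close> and \<open>matrix_inv X\<close> make the kernel rational in \<open>X\<close>.\<close>

definition ext_kernel :: "nat \<Rightarrow> complex^'n^'n \<Rightarrow> complex^'n^'n \<Rightarrow> complex" where
  "ext_kernel N X h =
     ((of_nat CARD('n) + trace (matrix_inv X ** h)) * (of_nat CARD('n) + trace (cadj h ** X))) ^ N"

text \<open>Convolution of \<open>\<rho>\<close> with the kernel, which makes sense off the unitary
  group too. At unitary \<open>X\<close> it is \<open>\<rho> X\<close> times its value at the
  identity, by \<open>ext_int_left\<close>.\<close>

definition ext_int :: "(complex^('n::{finite,linorder})^('n::{finite,linorder}) \<Rightarrow> complex^'d^'d) \<Rightarrow> nat \<Rightarrow>
    complex^('n::{finite,linorder})^('n::{finite,linorder}) \<Rightarrow> complex^'d^'d" where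
  "ext_int \<rho> N X = (LINT h|haar_measure UNIV. smat (ext_kernel N X h) (\<rho> h))"

lemma continuous_on_ext_kernel [continuous_intros]: "continuous_on S f \<Longrightarrow> continuous_on S (\<lambda>h. ext_kernel N X (f h))"
  unfolding ext_kernel_def by (intro continuous_intros)

lemma ext_kernel_left:
  assumes "unitary_mat g" "invertible X"
  shows "ext_kernel N X (cadj g ** h) = ext_kernel N (g ** X) h"
proof -
  have "matrix_inv X ** (cadj g ** h) = matrix_inv (g ** X) ** h"
    using assms by (simp add: matrix_inv_mult invertible_unitary matrix_inv_unitary matrix_mul_assoc)
  moreover have "cadj (cadj g ** h) ** X = cadj h ** (g ** X)"
    by (simp add: cadj_mult matrix_mul_assoc)
  ultimately show ?thesis by (simp add: ext_kernel_def)
qed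

lemma ext_kernel_right:
  assumes "unitary_mat g" "invertible X"
  shows "ext_kernel N X (h ** cadj g) = ext_kernel N (X ** g) h"
proof -
  have "trace (matrix_inv X ** (h ** cadj g)) = trace (cadj g ** (matrix_inv X ** h))"
    by (metis matrix_mul_assoc trace_mul_sym)
  also have "cadj g ** (matrix_inv X ** h) = matrix_inv (X ** g) ** h"
    using assms by (simp add: matrix_inv_mult invertible_unitary matrix_inv_unitary matrix_mul_assoc)
  finally have 1: "trace (matrix_inv X ** (h ** cadj g)) = trace (matrix_inv (X ** g) ** h)" .
  have "trace (cadj (h ** cadj g) ** X) = trace (g ** (cadj h ** X))"
    by (simp add: cadj_mult matrix_mul_assoc)
  also have "\<dots> = trace (cadj h ** (X ** g))"
    by (metis matrix_mul_assoc trace_mul_sym)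
  finally show ?thesis using 1 by (simp add: ext_kernel_def)
qed

lemma ext_kernel_cadj:
  assumes "invertible X"
  shows "cnj (ext_kernel N X (cadj h)) = ext_kernel N (cadj X) h"
proof -
  have "cnj (trace (matrix_inv X ** cadj h)) = trace (h ** cadj (matrix_inv X))"
    by (simp add: trace_cadj[symmetric] cadj_mult)
  also have "\<dots> = trace (matrix_inv (cadj X) ** h)"
    by (subst trace_mul_sym) (simp add: matrix_inv_cadj assms)
  finally have 1: "cnj (trace (matrix_inv X ** cadj h)) = trace (matrix_inv (cadj X) ** h)" .
  have "cnj (trace (cadj (cadj h) ** X)) = trace (cadj X ** cadj h)"
    by (simp add: trace_cadj[symmetric] cadj_mult)
  also have "\<dots> = trace (cadj h ** cadj X)" by (rule trace_mul_sym)
  finally show ?thesis using 1 by (simp add: ext_kernel_def)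
qed

text \<open>Translation invariance moves \<open>g\<close> from the kernel to \<open>\<rho>\<close>.
  Having this for every invertible \<open>X\<close> is what later allows continuation in
  \<open>g\<close>.\<close>

lemma ext_int_left:
  assumes \<rho>: "unitary_rep \<rho>" and g: "unitary_mat g" and X: "invertible X"
  shows "ext_int \<rho> N (g ** X) = \<rho> g ** ext_int \<rho> N X"
proof -
  have gU: "g \<in> U_sub UNIV" using g by (simp add: U_sub_UNIV U_group_def)
  let ?F = "\<lambda>h. smat (ext_kernel N (g ** X) h) (\<rho> h)"
  have "\<rho> g ** ext_int \<rho> N X = (LINT h|haar_measure UNIV. \<rho> g ** smat (ext_kernel N X h) (\<rho> h))"
    unfolding ext_int_def
    by (rule integral_haar_linear[where T="\<lambda>Z. \<rho> g ** Z"])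
       (auto intro!: continuous_intros rep_continuous[OF \<rho>] linear_matrix_mult_left)
  also have "\<dots> = (LINT h|haar_measure UNIV. ?F (g ** h))"
  proof (rule integral_haar_cong)
    fix h :: "complex^('a::{finite,linorder})^('a::{finite,linorder})" assume "h \<in> U_sub UNIV"
    moreover have "ext_kernel N (g ** X) (g ** h) = ext_kernel N X h"
      using ext_kernel_left[OF g X, of N "g ** h"] g by (simp add: matrix_mul_assoc unitary_mat_def)
    ultimately show "\<rho> g ** smat (ext_kernel N X h) (\<rho> h) = ?F (g ** h)"
      using gU by (simp add: mult_smat rep_mult[OF \<rho>] U_sub_UNIV)
  qed
  also have "\<dots> = ext_int \<rho> N (g ** X)"
    unfolding ext_int_def
    by (rule integral_haar_left) (auto intro!: continuous_intros rep_continuous[OF \<rho>] gU)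
  finally show ?thesis by simp
qed

lemma ext_int_right:
  assumes \<rho>: "unitary_rep \<rho>" and g: "unitary_mat g" and X: "invertible X"
  shows "ext_int \<rho> N (X ** g) = ext_int \<rho> N X ** \<rho> g"
proof -
  have gU: "g \<in> U_sub UNIV" using g by (simp add: U_sub_UNIV U_group_def)
  let ?F = "\<lambda>h. smat (ext_kernel N (X ** g) h) (\<rho> h)"
  have "ext_int \<rho> N X ** \<rho> g = (LINT h|haar_measure UNIV. smat (ext_kernel N X h) (\<rho> h) ** \<rho> g)"
    unfolding ext_int_def
    by (rule integral_haar_linear[where T="\<lambda>Z. Z ** \<rho> g"])
       (auto intro!: continuous_intros rep_continuous[OF \<rho>] linear_matrix_mult_right)
  also have "\<dots> = (LINT h|haar_measure UNIV. ?F (h ** g))"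
  proof (rule integral_haar_cong)
    fix h :: "complex^('a::{finite,linorder})^('a::{finite,linorder})" assume "h \<in> U_sub UNIV"
    moreover have "ext_kernel N (X ** g) (h ** g) = ext_kernel N X h"
      using ext_kernel_right[OF g X, of N "h ** g"] g
      by (simp add: matrix_mul_assoc[symmetric] unitary_mat_def)
    ultimately show "smat (ext_kernel N X h) (\<rho> h) ** \<rho> g = ?F (h ** g)"
      using gU by (simp add: smat_mult rep_mult[OF \<rho>] U_sub_UNIV)
  qed
  also have "\<dots> = ext_int \<rho> N (X ** g)"
    unfolding ext_int_def
    by (rule integral_haar_right) (auto intro!: continuous_intros rep_continuous[OF \<rho>] gU)
  finally show ?thesis by simp
qed

text \<open>Inversion invariance of Haar measure. At \<open>mat 1\<close> it gives the Hermitian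
  matrix to which Schur's lemma is applied; later it moves factors across the inner product.\<close>

lemma ext_int_cadj:
  assumes \<rho>: "unitary_rep \<rho>" and X: "invertible X"
  shows "ext_int \<rho> N (cadj X) = cadj (ext_int \<rho> N X)"
proof -
  let ?F = "\<lambda>h. smat (ext_kernel N (cadj X) h) (\<rho> h)"
  have "cadj (ext_int \<rho> N X) = (LINT h|haar_measure UNIV. cadj (smat (ext_kernel N X h) (\<rho> h)))"
    unfolding ext_int_def
    by (rule integral_haar_linear) (auto intro!: continuous_intros rep_continuous[OF \<rho>] linear_cadj)
  also have "\<dots> = (LINT h|haar_measure UNIV. ?F (cadj h))"
  proof (rule integral_haar_cong)
    fix h :: "complex^('a::{finite,linorder})^('a::{finite,linorder})" assume "h \<in> U_sub UNIV"
    then show "cadj (smat (ext_kernel N X h) (\<rho> h)) = ?F (cadj h)"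
      using ext_kernel_cadj[OF X, of N "cadj h"] by (simp add: cadj_smat rep_cadj[OF \<rho>] U_sub_UNIV)
  qed
  also have "\<dots> = ext_int \<rho> N (cadj X)"
    unfolding ext_int_def
    by (rule integral_haar_cadj) (auto intro!: continuous_intros rep_continuous[OF \<rho>])
  finally show ?thesis by simp
qed

lemma ext_int_entry:
  assumes \<rho>: "unitary_rep \<rho>"
  shows "ext_int \<rho> N X $ a $ b = (LINT h|haar_measure UNIV. ext_kernel N X h * \<rho> h $ a $ b)"
  using integral_haar_linear[where T="\<lambda>M. M $ a $ b" and f="\<lambda>h. smat (ext_kernel N X h) (\<rho> h)" and B=UNIV]
  by (simp add: ext_int_def linear_entry continuous_intros rep_continuous[OF \<rho>])

text \<open>A continuous function peaking at the identity acts, in high powers, as an approximate unit.\<close>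

lemma peak_power_integral_pos:
  fixes \<psi> f :: "complex^('n::{finite,linorder})^('n::{finite,linorder}) \<Rightarrow> real"
  assumes \<psi>: "continuous_on (U_sub B) \<psi>" and f: "continuous_on (U_sub B) f"
    and range: "\<And>h. h \<in> U_sub B \<Longrightarrow> 0 \<le> \<psi> h \<and> \<psi> h \<le> 1"
    and peak: "\<And>h. h \<in> U_sub B \<Longrightarrow> \<psi> h = 1 \<longleftrightarrow> h = mat 1" and pos: "f (mat 1) > 0"
  obtains N where "(LINT h|haar_measure B. \<psi> h ^ N * f h) > 0"
proof -
  interpret finite_measure "haar_measure B" by (rule finite_measure_haar)
  let ?\<mu> = "haar_measure B"
  define e where "e = f (mat 1) / 2"
  have e: "e > 0" using pos by (simp add: e_def)
  obtain d where d: "d > 0" "\<And>A. A \<in> U_sub B \<Longrightarrow> dist A (mat 1) < d \<Longrightarrow> dist (f A) (f (mat 1)) < e"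
    using f[unfolded continuous_on_iff] e mat_1_in_U_sub by metis
  have fW: "f h \<ge> e" if "h \<in> U_sub B" "h \<in> ball (mat 1) d" for h
    using d(2)[OF that(1)] that(2) by (auto simp: dist_commute dist_real_def e_def abs_if field_simps split: if_splits)
  let ?K = "U_sub B - ball (mat 1) d"
  have "compact ?K" by (intro compact_diff compact_U_sub open_ball)
  moreover have "continuous_on ?K \<psi>" by (rule continuous_on_subset[OF \<psi>]) auto
  ultimately have "\<exists>q. 0 \<le> q \<and> q < 1 \<and> (\<forall>h\<in>?K. \<psi> h \<le> q)"
  proof (cases "?K = {}")
    case True
    show ?thesis unfolding True by (intro exI[of _ 0]) simp
  next
    case False
    obtain k where k: "k \<in> ?K" "\<forall>h\<in>?K. \<psi> h \<le> \<psi> k"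
      using continuous_attains_sup[OF \<open>compact ?K\<close> False \<open>continuous_on ?K \<psi>\<close>] by blast
    have "\<psi> k \<noteq> 1" using k(1) peak[of k] d(1) by auto
    then show ?thesis using k range[of k] by (intro exI[of _ "\<psi> k"]) auto
  qed
  then obtain q where q: "0 \<le> q" "q < 1" "\<And>h. h \<in> ?K \<Longrightarrow> \<psi> h \<le> q" by blast
  \<comment> \<open>Any level strictly between \<open>q\<close> and 1 separates the regimes:
    \<open>\<psi>\<close> exceeds \<open>r\<close> on a set of measure \<open>m > 0\<close> and is
    at most \<open>q\<close> off the ball. The gain \<open>e * r ^ N * m\<close> beats the error
    \<open>C * q ^ N\<close> for large \<open>N\<close>.\<close>
  define r where "r = (1 + q) / 2"
  have r: "q < r" "r < 1" "0 < r" using q by (auto simp: r_def)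
  obtain d' where d': "d' > 0" "\<And>A. A \<in> U_sub B \<Longrightarrow> dist A (mat 1) < d' \<Longrightarrow> dist (\<psi> A) (\<psi> (mat 1)) < 1 - r"
    using \<psi>[unfolded continuous_on_iff] r mat_1_in_U_sub by (metis diff_gt_0_iff_gt)
  have \<psi>W: "\<psi> h > r" if "h \<in> U_sub B" "h \<in> ball (mat 1) d'" for h
  proof -
    have "\<psi> (mat 1) = 1" using peak[OF mat_1_in_U_sub] by simp
    then show ?thesis using d'(2)[OF that(1)] that(2) by (auto simp: dist_commute dist_real_def abs_if split: if_splits)
  qed
  let ?V = "ball (mat 1) d' \<inter> U_sub B"
  have V: "?V \<in> sets ?\<mu>" by (auto simp: sets_haar sets_restrict_space)
  define m where "m = measure ?\<mu> ?V"
  have m: "m > 0" unfolding m_def by (rule haar_nbhd_pos) (use d' in auto)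
  have "bounded (f ` U_sub B)"
    by (intro compact_imp_bounded compact_continuous_image f compact_U_sub)
  then obtain C where C: "\<And>A. A \<in> U_sub B \<Longrightarrow> \<bar>f A\<bar> \<le> C" by (auto simp: bounded_iff)
  have C0: "C \<ge> 0" using C[OF mat_1_in_U_sub] by linarith
  have "(\<lambda>N. C * (q / r) ^ N) \<longlonglongrightarrow> C * 0"
    using q r by (intro tendsto_intros LIMSEQ_power_zero) simp
  then have "\<forall>\<^sub>F N in sequentially. C * (q / r) ^ N < e * m"
    using e m by (intro order_tendstoD(2)) auto
  then obtain N where N: "C * (q / r) ^ N < e * m" by (meson eventually_sequentially order_refl)
  have "0 < e * r ^ N * m - C * q ^ N"
    using N r by (simp add: power_divide field_simps)
  also have "\<dots> = (LINT h|?\<mu>. e * r ^ N * indicator ?V h - C * q ^ N)"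
    using V measure_haar_space[of B] by (subst Bochner_Integration.integral_diff)
      (auto simp: m_def space_haar inf.absorb1 emeasure_eq_measure simp del: measure_haar_space)
  also have "\<dots> \<le> (LINT h|?\<mu>. \<psi> h ^ N * f h)"
  proof (rule integral_mono)
    show "integrable ?\<mu> (\<lambda>h. e * r ^ N * indicator ?V h - C * q ^ N)"
      using V by (auto simp: emeasure_eq_measure)
    show "integrable ?\<mu> (\<lambda>h. \<psi> h ^ N * f h)"
      by (intro integrable_haar continuous_intros \<psi> f)
    fix h assume "h \<in> space ?\<mu>"
    then have h: "h \<in> U_sub B" by (simp add: space_haar)
    have CN: "C * q ^ N \<ge> 0" using C0 q by simp
    show "e * r ^ N * indicator ?V h - C * q ^ N \<le> \<psi> h ^ N * f h"
    proof (cases "h \<in> ?V")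
      case True
      have "h \<in> ball (mat 1) d"
      proof (rule ccontr)
        assume "h \<notin> ball (mat 1) d"
        then have "\<psi> h \<le> q" using q(3) h by blast
        moreover have "r < \<psi> h" using \<psi>W[OF h] True by blast
        ultimately show False using r by linarith
      qed
      then have "e * r ^ N \<le> f h * \<psi> h ^ N"
        using fW[OF h] \<psi>W[OF h] True r e by (intro mult_mono power_mono) auto
      then show ?thesis using True CN by (simp add: mult.commute)
    next
      case nV: False
      show ?thesis
      proof (cases "h \<in> ball (mat 1) d")
        case True
        then have "0 \<le> \<psi> h ^ N * f h" using fW[OF h] range[OF h] e by simp
        then show ?thesis using nV CN by simp
      next
        case False
        then have "\<psi> h ^ N \<le> q ^ N" using q(3)[of h] h range[OF h] by (intro power_mono) auto
        then have "\<psi> h ^ N * \<bar>f h\<bar> \<le> q ^ N * C" using C[OF h] q by (intro mult_mono) auto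
        moreover have "- (\<psi> h ^ N * \<bar>f h\<bar>) \<le> \<psi> h ^ N * f h"
          using range[OF h] by (auto simp: abs_if)
        ultimately show ?thesis using nV by (simp add: mult.commute)
      qed
    qed
  qed
  finally show thesis by (rule that)
qed

text \<open>The modulus of the trace alone is maximal at every unimodular scalar matrix; adding the
  dimension singles out the identity. Equality forces all diagonal entries to be 1, and unit column
  norms then kill the rest.\<close>

lemma unitary_trace_peak:
  fixes h :: "complex^'n^'n"
  assumes h: "unitary_mat h"
  shows "cmod (of_nat CARD('n) + trace h) \<le> 2 * real CARD('n)"
    and "cmod (of_nat CARD('n) + trace h) = 2 * real CARD('n) \<longleftrightarrow> h = mat 1"
proof -
  have tr: "cmod (trace h) \<le> real CARD('n)"
  proof -
    have "cmod (trace h) \<le> (\<Sum>i\<in>(UNIV::'n set). cmod (h $ i $ i))" unfolding trace_def by (rule norm_sum)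
    also have "\<dots> \<le> (\<Sum>i\<in>(UNIV::'n set). 1)" by (intro sum_mono unitary_entry_le_1 h)
    finally show ?thesis by simp
  qed
  then show "cmod (of_nat CARD('n) + trace h) \<le> 2 * real CARD('n)"
    using norm_triangle_ineq[of "of_nat CARD('n)" "trace h"] by simp
  show "cmod (of_nat CARD('n) + trace h) = 2 * real CARD('n) \<longleftrightarrow> h = mat 1"
  proof
    assume eq: "cmod (of_nat CARD('n) + trace h) = 2 * real CARD('n)"
    let ?n = "real CARD('n)"
    have "(cmod (of_nat CARD('n) + trace h))\<^sup>2 = ?n\<^sup>2 + 2 * ?n * Re (trace h) + (cmod (trace h))\<^sup>2"
      unfolding cmod_power2 by (simp add: power2_eq_square algebra_simps)
    then have "4 * ?n\<^sup>2 = ?n\<^sup>2 + 2 * ?n * Re (trace h) + (cmod (trace h))\<^sup>2"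
      using eq by (simp add: power2_eq_square)
    moreover have "(cmod (trace h))\<^sup>2 \<le> ?n\<^sup>2" using tr by (simp add: power_mono)
    ultimately have "2 * ?n * ?n \<le> 2 * ?n * Re (trace h)"
      unfolding power2_eq_square by linarith
    then have ge: "?n \<le> Re (trace h)" by (rule mult_left_le_imp_le) simp
    have le1: "Re (h $ i $ i) \<le> 1" for i
      using unitary_entry_le_1[OF h, of i i] complex_Re_le_cmod[of "h $ i $ i"] by linarith
    have diag: "Re (h $ i $ i) = 1" for i
    proof (rule ccontr)
      assume "Re (h $ i $ i) \<noteq> 1"
      then have "Re (h $ i $ i) < 1" using le1[of i] by simp
      then have "(\<Sum>i\<in>(UNIV::'n set). Re (h $ i $ i)) < (\<Sum>i\<in>(UNIV::'n set). 1)"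
        using le1 by (intro sum_strict_mono_ex1) auto
      then show False using ge by (simp add: trace_def)
    qed
    have cm: "cmod (h $ i $ i) = 1" for i
      using unitary_entry_le_1[OF h, of i i] complex_Re_le_cmod[of "h $ i $ i"] diag[of i] by linarith
    have h1: "h $ i $ i = 1" for i
      using cm[of i] diag[of i] by (simp add: cmod_def complex_eq_iff)
    have "h $ p $ q = 0" if "p \<noteq> q" for p q
    proof -
      have "(\<Sum>i\<in>{p, q}. (cmod (h $ i $ q))\<^sup>2) \<le> (\<Sum>i\<in>UNIV. (cmod (h $ i $ q))\<^sup>2)"
        by (intro sum_mono2) auto
      then show ?thesis using unitary_column_norm[OF h, of q] that by (simp add: h1)
    qed
    then show "h = mat 1" using h1 by (simp add: vec_eq_iff mat_1_nth)
  qed (simp add: trace_I)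
qed

text \<open>Schur's lemma for Hermitian \<open>M\<close>: an eigenspace exists by minimisation, is
  invariant, and therefore is everything.\<close>

lemma irreducible_commutant:
  assumes irr: "irreducible_rep \<rho>" and M: "cadj M = M"
    and comm: "\<And>g. g \<in> U_group \<Longrightarrow> \<rho> g ** M = M ** \<rho> g"
  obtains c where "M = smat c (mat 1)"
proof -
  obtain m v where v: "v \<noteq> 0" "M *v v = of_real m *s v"
    using hermitian_min_eigenvector[OF M] by metis
  define W where "W = {u. M *v u = of_real m *s u}"
  have "csubspace W"
    unfolding csubspace_def W_def
    by (auto simp: matrix_vector_right_distrib matrix_vector_mult_scale vector_smult_assoc mult.commute vector_add_ldistrib)
  moreover have "\<rho> A *v u \<in> W" if A: "A \<in> U_group" and u: "u \<in> W" for A u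
  proof -
    have "M *v (\<rho> A *v u) = \<rho> A *v (M *v u)"
      by (simp add: matrix_vector_mul_assoc comm[OF A])
    then show ?thesis using u by (simp only: W_def mem_Collect_eq matrix_vector_mult_scale)
  qed
  ultimately have "W = {0} \<or> W = UNIV" using irr by (auto simp: irreducible_rep_def)
  moreover have "v \<in> W" using v by (simp add: W_def)
  ultimately have "W = UNIV" using v(1) by auto
  then have "M *v u = smat (of_real m) (mat 1) *v u" for u
    unfolding smat_vec by (auto simp: W_def)
  then have "M = smat (of_real m) (mat 1)" by (simp add: matrix_eq)
  then show thesis by (rule that)
qed

text \<open>\<open>int_one\<close> condenses irreducibility: the convolution at the identity is a
  nonzero scalar, so dividing by it makes the convolution restrict to \<open>\<rho>\<close>.\<close>

locale rep_extension =
  fixes \<rho> :: "complex^('n::{finite,linorder})^('n::{finite,linorder}) \<Rightarrow> complex^'d^'d" and N :: nat and c :: complex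
  assumes rep: "unitary_rep \<rho>" and c0: "c \<noteq> 0" and int_one: "ext_int \<rho> N (mat 1) = smat c (mat 1)"

text \<open>At the identity the kernel is a positive multiple of \<open>\<psi> ^ N\<close>, so for a
  suitable \<open>N\<close> a diagonal entry of the convolution has positive real part. Schur's
  lemma makes the matrix scalar, and that entry makes the scalar nonzero.\<close>

lemma rep_extension_exists:
  fixes \<rho> :: "complex^('n::{finite,linorder})^('n::{finite,linorder}) \<Rightarrow> complex^'d^'d"
  assumes irr: "irreducible_rep \<rho>"
  obtains N c where "rep_extension \<rho> N c"
proof -
  have \<rho>: "unitary_rep \<rho>" using irr by (simp add: irreducible_rep_def)
  let ?n = "real CARD('n)"
  \<comment> \<open>An arbitrary coordinate; one diagonal entry suffices to detect a nonzero
    scalar.\<close>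
  define a where "a = (undefined :: 'd)"
  define \<psi> where "\<psi> h = (cmod (of_nat CARD('n) + trace h) / (2 * ?n))\<^sup>2" for h :: "complex^('n::{finite,linorder})^('n::{finite,linorder})"
  define f where "f h = Re (\<rho> h $ a $ a)" for h
  have "continuous_on (U_sub UNIV) f"
    unfolding f_def by (intro continuous_intros rep_continuous[OF \<rho>])
  moreover have "continuous_on (U_sub UNIV) \<psi>"
    unfolding \<psi>_def by (intro continuous_intros) auto
  moreover have "0 \<le> \<psi> h \<and> \<psi> h \<le> 1" if "h \<in> U_sub UNIV" for h
    using unitary_trace_peak(1)[OF U_sub_unitary[OF that]] by (simp add: \<psi>_def power_le_one)
  moreover have "\<psi> h = 1 \<longleftrightarrow> h = mat 1" if "h \<in> U_sub UNIV" for h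
  proof -
    have "\<psi> h = 1 \<longleftrightarrow> cmod (of_nat CARD('n) + trace h) / (2 * ?n) = 1"
      unfolding \<psi>_def using norm_ge_zero[of "of_nat CARD('n) + trace h"]
      by (metis abs_of_nonneg divide_nonneg_nonneg mult_nonneg_nonneg of_nat_0_le_iff one_power2 power2_eq_iff_nonneg zero_le_numeral zero_le_one)
    also have "\<dots> \<longleftrightarrow> h = mat 1"
      using unitary_trace_peak(2)[OF U_sub_unitary[OF that]] by (auto simp: field_simps)
    finally show ?thesis .
  qed
  moreover have "f (mat 1) > 0" by (simp add: f_def rep_one[OF \<rho>] mat_1_nth)
  ultimately obtain N where N: "(LINT h|haar_measure UNIV. \<psi> h ^ N * f h) > 0"
    using peak_power_integral_pos[of UNIV \<psi> f] by metis
  let ?C = "ext_int \<rho> N (mat 1)"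
  have kern: "ext_kernel N (mat 1) h = of_real ((2 * ?n) ^ (2 * N) * \<psi> h ^ N)" for h :: "complex^('n::{finite,linorder})^('n::{finite,linorder})"
  proof -
    have "ext_kernel N (mat 1) h = ((of_nat CARD('n) + trace h) * cnj (of_nat CARD('n) + trace h)) ^ N"
      by (simp add: ext_kernel_def trace_cadj)
    also have "\<dots> = of_real ((2 * ?n)\<^sup>2 * \<psi> h) ^ N"
      by (subst complex_norm_square[symmetric]) (simp add: \<psi>_def power_divide)
    finally show ?thesis by (simp add: power_mult power_mult_distrib)
  qed
  have "Re (?C $ a $ a) = (LINT h|haar_measure UNIV. Re (ext_kernel N (mat 1) h * \<rho> h $ a $ a))"
    unfolding ext_int_entry[OF \<rho>]
    by (rule integral_haar_linear) (auto intro!: continuous_intros rep_continuous[OF \<rho>] linearI)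
  also have "\<dots> = (LINT h|haar_measure UNIV. (2 * ?n) ^ (2 * N) * (\<psi> h ^ N * f h))"
    by (simp only: kern f_def Re_complex_of_real Im_complex_of_real times_complex.sel mult_zero_left diff_zero mult.assoc)
  also have "\<dots> > 0" using N by simp
  finally have pos: "Re (?C $ a $ a) > 0" .
  have "cadj ?C = ?C" using ext_int_cadj[OF \<rho>, of "mat 1" N] by simp
  moreover have "\<rho> g ** ?C = ?C ** \<rho> g" if "g \<in> U_group" for g
    using ext_int_left[OF \<rho>, of g "mat 1" N] ext_int_right[OF \<rho>, of g "mat 1" N] that
    by (simp add: U_group_def)
  ultimately obtain c where c: "?C = smat c (mat 1)"
    using irreducible_commutant[OF irr, of ?C] by metis
  have "c \<noteq> 0" using pos by (auto simp: c)
  then have "rep_extension \<rho> N c" using c \<rho> by unfold_locales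
  then show thesis by (rule that)
qed

subsection \<open>Laurent polynomials and multiplicativity\<close>

text \<open>A Laurent polynomial as a function: multiplying by a power of \<open>z\<close> gives a
  polynomial. Nothing is claimed at 0, where the inverse powers have only a conventional
  value.\<close>

definition laurent :: "(complex \<Rightarrow> complex) \<Rightarrow> bool" where
  "laurent f \<longleftrightarrow> (\<exists>M p. \<forall>z. z \<noteq> 0 \<longrightarrow> f z * z ^ M = poly p z)"

lemma laurent_add:
  assumes "laurent f" "laurent g" shows "laurent (\<lambda>z. f z + g z)"
proof -
  obtain M p where p: "\<And>z. z \<noteq> 0 \<Longrightarrow> f z * z ^ M = poly p z" using assms(1) by (auto simp: laurent_def)
  obtain L q where q: "\<And>z. z \<noteq> 0 \<Longrightarrow> g z * z ^ L = poly q z" using assms(2) by (auto simp: laurent_def)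
  have "(f z + g z) * z ^ (M + L) = poly (p * monom 1 L + q * monom 1 M) z" if "z \<noteq> 0" for z
    using p[OF that, symmetric] q[OF that, symmetric] by (simp add: poly_monom power_add algebra_simps)
  then show ?thesis unfolding laurent_def by blast
qed

lemma laurent_cmult:
  assumes "laurent f" shows "laurent (\<lambda>z. a * f z)"
proof -
  obtain M p where p: "\<And>z. z \<noteq> 0 \<Longrightarrow> f z * z ^ M = poly p z" using assms by (auto simp: laurent_def)
  have "a * f z * z ^ M = poly (smult a p) z" if "z \<noteq> 0" for z
    using p[OF that] by (simp add: mult.assoc)
  then show ?thesis unfolding laurent_def by blast
qed

lemma laurent_sum: "(\<And>x. x \<in> S \<Longrightarrow> laurent (f x)) \<Longrightarrow> laurent (\<lambda>z. \<Sum>x\<in>S. f x z)"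
proof (induction S rule: infinite_finite_induct)
  case (insert x S)
  then show ?case by (simp add: laurent_add)
qed (auto simp: laurent_def intro!: exI[of _ 0])

lemma laurent_powi: "laurent (\<lambda>z. z powi m)"
proof (cases "m \<ge> 0")
  case True
  then have "z powi m * z ^ 0 = poly (monom 1 (nat m)) z" for z :: complex
    by (simp add: power_int_def poly_monom)
  then show ?thesis unfolding laurent_def by blast
next
  case False
  then have "z powi m * z ^ nat (- m) = poly 1 z" if "z \<noteq> 0" for z :: complex
    using that by (simp add: power_int_def field_simps)
  then show ?thesis unfolding laurent_def by blast
qed

lemma infinite_unit_circle: "infinite {z :: complex. cmod z = 1}"
proof -
  have "sphere (0::complex) 1 = {z. cmod z = 1}" by (auto simp: sphere_def)
  moreover have "infinite (sphere (0::complex) 1)"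
  proof
    assume "finite (sphere (0::complex) 1)"
    moreover have "connected (sphere (0::complex) 1)" by (rule connected_sphere) simp
    ultimately have "\<exists>x. sphere (0::complex) 1 \<subseteq> {x}"
      using connected_finite_iff_sing by fastforce
    moreover have "1 \<in> sphere (0::complex) 1" "- 1 \<in> sphere (0::complex) 1" by auto
    ultimately have "(1::complex) = - 1" by blast
    then show False by simp
  qed
  ultimately show ?thesis by simp
qed

text \<open>The difference, cleared of denominators, is a polynomial with infinitely many roots.
  This is the continuation principle from unitary to invertible diagonal matrices.\<close>

lemma laurent_eq_on_circle:
  assumes f: "laurent f" and g: "laurent g" and eq: "\<And>z. cmod z = 1 \<Longrightarrow> f z = g z" and z: "z \<noteq> 0"
  shows "f z = g z"
proof -
  have "laurent (\<lambda>z. f z + (- 1) * g z)" using f g by (intro laurent_add laurent_cmult)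
  then obtain M p where p: "\<And>z. z \<noteq> 0 \<Longrightarrow> (f z + (- 1) * g z) * z ^ M = poly p z"
    by (auto simp: laurent_def)
  have "{z. cmod z = 1} \<subseteq> {z. poly p z = 0}"
  proof clarify
    fix z :: complex assume "cmod z = 1"
    moreover from this have "z \<noteq> 0" by auto
    ultimately show "poly p z = 0" using p[of z] eq[of z] by simp
  qed
  then have "p = 0" using infinite_unit_circle poly_roots_finite finite_subset by blast
  then show ?thesis using p[OF z] z by simp
qed

text \<open>Continuity is asked coefficient by coefficient because each coefficient is going to be
  integrated over the group.\<close>

definition coeffs_continuous :: "'a::topological_space set \<Rightarrow> ('a \<Rightarrow> complex poly) \<Rightarrow> bool" where
  "coeffs_continuous S Q \<longleftrightarrow> (\<forall>j. continuous_on S (\<lambda>h. coeff (Q h) j))"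

lemma coeffs_continuous_linear:
  "continuous_on S f \<Longrightarrow> continuous_on S g \<Longrightarrow> coeffs_continuous S (\<lambda>h. [:f h, g h:])"
  unfolding coeffs_continuous_def
proof
  fix j assume "continuous_on S f" "continuous_on S g"
  then show "continuous_on S (\<lambda>h. coeff [:f h, g h:] j)"
    by (cases j; cases "j - 1") (auto simp: coeff_pCons split: nat.splits)
qed

lemma coeffs_continuous_mult:
  "coeffs_continuous S P \<Longrightarrow> coeffs_continuous S Q \<Longrightarrow> coeffs_continuous S (\<lambda>h. P h * Q h)"
  unfolding coeffs_continuous_def coeff_mult by (intro allI continuous_intros) auto

lemma coeffs_continuous_power: "coeffs_continuous S P \<Longrightarrow> coeffs_continuous S (\<lambda>h. P h ^ N)"
proof (induction N)
  case 0
  then show ?case by (simp add: coeffs_continuous_def)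
qed (simp add: coeffs_continuous_mult)

lemma poly_eq_sum_le:
  assumes "degree p \<le> D" shows "poly p (z::complex) = (\<Sum>j\<le>D. coeff p j * z ^ j)"
proof -
  have "(\<Sum>j\<le>degree p. coeff p j * z ^ j) = (\<Sum>j\<le>D. coeff p j * z ^ j)"
    using assms by (intro sum.mono_neutral_left) (auto simp: coeff_eq_0)
  then show ?thesis by (simp add: poly_altdef)
qed

text \<open>The degree bound \<open>D\<close> is uniform in \<open>h\<close>, so the integral passes
  through a finite sum and integrates the coefficients; \<open>z ^ M\<close> clears the
  denominators.\<close>

lemma ext_int_poly:
  fixes \<rho> :: "complex^('n::{finite,linorder})^('n::{finite,linorder}) \<Rightarrow> complex^'d^'d"
  assumes \<rho>: "unitary_rep \<rho>" and Q: "coeffs_continuous U_group Q" "\<And>h. degree (Q h) \<le> D"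
    and eq: "\<And>z h. z \<in> Z \<Longrightarrow> ext_kernel N (X z) h * z ^ M = poly (Q h) z"
  shows "\<exists>p. \<forall>z\<in>Z. ext_int \<rho> N (X z) $ a $ b * z ^ M = poly p z"
proof (intro exI ballI)
  let ?c = "\<lambda>j. LINT h|haar_measure UNIV. coeff (Q h) j * \<rho> h $ a $ b"
  fix z assume z: "z \<in> Z"
  have cont: "continuous_on (U_sub UNIV) (\<lambda>h. coeff (Q h) j * \<rho> h $ a $ b)" for j
    using Q(1) rep_continuous[OF \<rho>, of UNIV] unfolding coeffs_continuous_def U_sub_UNIV
    by (intro continuous_intros) auto
  have "ext_int \<rho> N (X z) $ a $ b * z ^ M = (LINT h|haar_measure UNIV. ext_kernel N (X z) h * \<rho> h $ a $ b * z ^ M)"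
    by (simp add: ext_int_entry[OF \<rho>])
  also have "\<dots> = (LINT h|haar_measure UNIV. (\<Sum>j\<le>D. coeff (Q h) j * \<rho> h $ a $ b * z ^ j))"
  proof (rule Bochner_Integration.integral_cong[OF refl])
    fix h :: "complex^('n::{finite,linorder})^('n::{finite,linorder})"
    have "ext_kernel N (X z) h * \<rho> h $ a $ b * z ^ M = poly (Q h) z * \<rho> h $ a $ b"
      by (simp add: eq[OF z, symmetric] mult.commute mult.left_commute)
    also have "\<dots> = (\<Sum>j\<le>D. coeff (Q h) j * z ^ j) * \<rho> h $ a $ b"
      by (simp only: poly_eq_sum_le[OF Q(2)])
    also have "\<dots> = (\<Sum>j\<le>D. coeff (Q h) j * \<rho> h $ a $ b * z ^ j)"
      unfolding sum_distrib_right by (intro sum.cong) (simp_all add: mult_ac)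
    finally show "ext_kernel N (X z) h * \<rho> h $ a $ b * z ^ M = (\<Sum>j\<le>D. coeff (Q h) j * \<rho> h $ a $ b * z ^ j)" .
  qed
  also have "\<dots> = (\<Sum>j\<le>D. ?c j * z ^ j)"
    by (subst Bochner_Integration.integral_sum)
       (auto intro!: integrable_haar continuous_intros cont)
  also have "\<dots> = poly (\<Sum>j\<le>D. monom (?c j) j) z"
    by (simp add: poly_sum poly_monom)
  finally show "ext_int \<rho> N (X z) $ a $ b * z ^ M = poly (\<Sum>j\<le>D. monom (?c j) j) z" .
qed

lemma trace_dg_mult: "trace (dg i z ** W) = trace W - W $ i $ i + z * W $ i $ i"
proof -
  have "trace (dg i z ** W) = (\<Sum>p\<in>UNIV. W $ p $ p + (if p = i then (z - 1) * W $ i $ i else 0))"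
    unfolding trace_def by (intro sum.cong) (auto simp: dg_mult_nth algebra_simps)
  then show ?thesis by (simp add: sum.distrib trace_def algebra_simps)
qed

lemma trace_tv_mult: "trace (tv i j s ** W) = trace W + s * W $ j $ i"
  by (simp add: trace_def tv_mult_nth sum.distrib)

text \<open>Only the factor with the inverse contains \<open>1 / z\<close>, once per power, hence
  the exponent \<open>N\<close> suffices to clear it.\<close>

lemma ext_kernel_dg:
  fixes Y :: "complex^'n^'n"
  assumes Y: "invertible Y" and z: "z \<noteq> 0"
  defines "W \<equiv> \<lambda>h. h ** matrix_inv Y" and "W' \<equiv> \<lambda>h. Y ** cadj h"
  shows "ext_kernel N (dg i z ** Y) h * z ^ N =
    poly (([:W h $ i $ i, of_nat CARD('n) + trace (W h) - W h $ i $ i:]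
      * [:of_nat CARD('n) + trace (W' h) - W' h $ i $ i, W' h $ i $ i:]) ^ N) z"
proof -
  have "trace (matrix_inv (dg i z ** Y) ** h) = trace (matrix_inv Y ** (dg i (1 / z) ** h))"
    using Y z by (simp add: matrix_inv_mult invertible_dg matrix_inv_dg matrix_mul_assoc)
  also have "\<dots> = trace (dg i (1 / z) ** W h)"
    unfolding W_def by (metis matrix_mul_assoc trace_mul_sym)
  finally have 1: "trace (matrix_inv (dg i z ** Y) ** h) = trace (W h) - W h $ i $ i + (1 / z) * W h $ i $ i"
    by (simp add: trace_dg_mult)
  have "trace (cadj h ** (dg i z ** Y)) = trace (dg i z ** W' h)"
    unfolding W'_def by (metis matrix_mul_assoc trace_mul_sym)
  then have 2: "trace (cadj h ** (dg i z ** Y)) = trace (W' h) - W' h $ i $ i + z * W' h $ i $ i"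
    by (simp add: trace_dg_mult)
  show ?thesis
    unfolding ext_kernel_def 1 2 poly_power poly_mult power_mult_distrib[symmetric]
    by (rule arg_cong[of _ _ "\<lambda>x. x ^ N"]) (use z in \<open>simp add: field_simps\<close>)
qed

text \<open>The inverse of a transvection is again polynomial in \<open>s\<close>, so no
  denominators arise; this makes the extension polynomial along root subgroups.\<close>

lemma ext_kernel_tv:
  fixes h :: "complex^'n^'n"
  assumes ij: "i \<noteq> j"
  shows "ext_kernel N (tv i j s) h =
    poly (([:of_nat CARD('n) + trace h, - h $ j $ i:]
      * [:of_nat CARD('n) + trace (cadj h), cadj h $ j $ i:]) ^ N) s"
proof -
  have "trace (cadj h ** tv i j s) = trace (tv i j s ** cadj h)" by (rule trace_mul_sym)
  then show ?thesis
    using ij by (simp add: ext_kernel_def matrix_inv_tv trace_tv_mult algebra_simps)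
qed

lemma degree_linear_mult_power_le: "degree (([:a, b:] * [:c, d:]) ^ N :: complex poly) \<le> 2 * N"
proof -
  have "degree ([:a, b:] * [:c, d:]) \<le> 1 + 1"
    by (rule order_trans[OF degree_mult_le add_mono]) auto
  then have "degree ([:a, b:] * [:c, d:]) * N \<le> 2 * N" by (intro mult_right_mono) auto
  then show ?thesis using degree_power_le[of "[:a, b:] * [:c, d:]" N] by linarith
qed

section \<open>Multiplicativity of the extension and its action on weight vectors\<close>

context rep_extension begin

definition ext :: "complex^('n::{finite,linorder})^('n::{finite,linorder}) \<Rightarrow> complex^'d^'d" where
  "ext X = smat (1 / c) (ext_int \<rho> N X)"

lemma ext_mult_left: "unitary_mat g \<Longrightarrow> invertible X \<Longrightarrow> ext (g ** X) = \<rho> g ** ext X"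
  by (simp add: ext_def ext_int_left[OF rep] mult_smat)

lemma ext_mult_right: "unitary_mat g \<Longrightarrow> invertible X \<Longrightarrow> ext (X ** g) = ext X ** \<rho> g"
  by (simp add: ext_def ext_int_right[OF rep] smat_mult)

lemma ext_one: "ext (mat 1) = mat 1"
  by (simp add: ext_def int_one smat_smat c0)

lemma ext_unitary: "unitary_mat g \<Longrightarrow> ext g = \<rho> g"
  using ext_mult_left[of g "mat 1"] by (simp add: ext_one)

lemma cadj_int_one: "cnj c = c"
proof -
  have "smat (cnj c) (mat 1 :: complex^'d^'d) = smat c (mat 1)"
    using ext_int_cadj[OF rep, of "mat 1" N] by (simp add: int_one cadj_smat)
  then have "smat (cnj c) (mat 1 :: complex^'d^'d) $ a $ a = smat c (mat 1) $ a $ a" for a by simp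
  then show ?thesis by (simp add: mat_1_nth)
qed

lemma ext_cadj: "invertible X \<Longrightarrow> ext (cadj X) = cadj (ext X)"
  by (simp add: ext_def ext_int_cadj[OF rep] cadj_smat cadj_int_one)

lemma laurent_ext_dg:
  assumes Y: "invertible Y" shows "laurent (\<lambda>z. ext (dg i z ** Y) $ a $ b)"
proof -
  define Q where "Q h = ([:(h ** matrix_inv Y) $ i $ i,
        of_nat CARD('n) + trace (h ** matrix_inv Y) - (h ** matrix_inv Y) $ i $ i:]
      * [:of_nat CARD('n) + trace (Y ** cadj h) - (Y ** cadj h) $ i $ i, (Y ** cadj h) $ i $ i:]) ^ N" for h
  have "coeffs_continuous U_group Q" unfolding Q_def
    by (intro coeffs_continuous_power coeffs_continuous_mult coeffs_continuous_linear continuous_intros)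
  moreover have "degree (Q h) \<le> 2 * N" for h unfolding Q_def by (rule degree_linear_mult_power_le)
  moreover have "ext_kernel N (dg i z ** Y) h * z ^ N = poly (Q h) z" if "z \<in> - {0}" for z h
    unfolding Q_def using ext_kernel_dg[OF Y] that by simp
  ultimately have "\<exists>p. \<forall>z\<in>-{0}. ext_int \<rho> N (dg i z ** Y) $ a $ b * z ^ N = poly p z"
    by (intro ext_int_poly[OF rep])
  then have "laurent (\<lambda>z. ext_int \<rho> N (dg i z ** Y) $ a $ b)" by (auto simp: laurent_def)
  then show ?thesis unfolding ext_def smat_nth by (rule laurent_cmult)
qed

lemma ext_tv_poly:
  assumes "i \<noteq> j" shows "\<exists>p. \<forall>s. ext (tv i j s) $ a $ b = poly p s"
proof -
  define Q where "Q h = ([:of_nat CARD('n) + trace h, - h $ j $ i:]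
      * [:of_nat CARD('n) + trace (cadj h), cadj h $ j $ i:]) ^ N" for h :: "complex^('n::{finite,linorder})^('n::{finite,linorder})"
  have "coeffs_continuous U_group Q" unfolding Q_def
    by (intro coeffs_continuous_power coeffs_continuous_mult coeffs_continuous_linear continuous_intros)
  moreover have "degree (Q h) \<le> 2 * N" for h unfolding Q_def by (rule degree_linear_mult_power_le)
  moreover have "ext_kernel N (tv i j z) h * z ^ 0 = poly (Q h) z" if "z \<in> UNIV" for z h
    unfolding Q_def using ext_kernel_tv[OF assms] by simp
  ultimately have "\<exists>p. \<forall>z\<in>UNIV. ext_int \<rho> N (tv i j z) $ a $ b * z ^ 0 = poly p z"
    by (rule ext_int_poly[OF rep])
  then obtain p where "\<And>z. ext_int \<rho> N (tv i j z) $ a $ b = poly p z" by auto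
  then show ?thesis by (intro exI[of _ "smult (1 / c) p"]) (simp add: ext_def)
qed

text \<open>Quantifying over all invertible right factors makes the set of admissible left factors
  closed under products.\<close>

definition mult_ok :: "complex^('n::{finite,linorder})^('n::{finite,linorder}) \<Rightarrow> bool" where
  "mult_ok X \<longleftrightarrow> invertible X \<and> (\<forall>Y. invertible Y \<longrightarrow> ext (X ** Y) = ext X ** ext Y)"

lemma mult_ok_unitary: "unitary_mat g \<Longrightarrow> mult_ok g"
  by (simp add: mult_ok_def invertible_unitary ext_mult_left ext_unitary)

lemma mult_ok_mult: "mult_ok X \<Longrightarrow> mult_ok Y \<Longrightarrow> mult_ok (X ** Y)"
  by (simp add: mult_ok_def invertible_mult_iff matrix_mul_assoc[symmetric])

text \<open>Both sides are Laurent polynomials in \<open>z\<close> and agree on the unit circle,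
  where \<open>dg i z\<close> is unitary.\<close>

lemma mult_ok_dg:
  assumes z: "z \<noteq> 0" shows "mult_ok (dg i z)"
  unfolding mult_ok_def
proof (intro conjI allI impI)
  show "invertible (dg i z)" using z by (rule invertible_dg)
  fix Y :: "complex^('n::{finite,linorder})^('n::{finite,linorder})" assume Y: "invertible Y"
  have "ext (dg i z ** Y) $ a $ b = (ext (dg i z) ** ext Y) $ a $ b" for a b
  proof (rule laurent_eq_on_circle[OF laurent_ext_dg[OF Y] _ _ z])
    have "laurent (\<lambda>z. ext Y $ k $ b * ext (dg i z ** mat 1) $ a $ k)" for k
      by (intro laurent_cmult laurent_ext_dg invertible_mat_1)
    then have "laurent (\<lambda>z. \<Sum>k\<in>UNIV. ext Y $ k $ b * ext (dg i z ** mat 1) $ a $ k)"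
      by (intro laurent_sum)
    then show "laurent (\<lambda>z. (ext (dg i z) ** ext Y) $ a $ b)"
      by (simp add: matrix_mult_nth mult.commute)
    fix z :: complex assume "cmod z = 1"
    then have "unitary_mat (dg i z)" by (rule unitary_dg)
    then show "ext (dg i z ** Y) $ a $ b = (ext (dg i z) ** ext Y) $ a $ b"
      using ext_mult_left Y ext_unitary by simp
  qed
  then show "ext (dg i z ** Y) = ext (dg i z) ** ext Y" by (simp add: vec_eq_iff)
qed

text \<open>By \<open>tv_via_unitaries\<close> one particular transvection is a product of unitary
  matrices and dilations. Conjugation by \<open>dg i z\<close> rescales its parameter to any nonzero
  \<open>s\<close>.\<close>

lemma mult_ok_tv:
  assumes ij: "i \<noteq> j" shows "mult_ok (tv i j s)"
proof (cases "s = 0")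
  case True
  then show ?thesis by (simp add: mult_ok_unitary)
next
  case False
  have "mult_ok (tv i j (- 252 / 289))"
    unfolding tv_via_unitaries[OF ij]
    by (intro mult_ok_mult mult_ok_dg mult_ok_unitary unitary_emb2 ij) (simp_all add: field_simps)
  moreover define z where "z = s / (- 252 / 289)"
  have "z \<noteq> 0" using False by (simp add: z_def)
  moreover have "tv i j s = dg i z ** tv i j (- 252 / 289) ** dg i (1 / z)"
    using ij \<open>z \<noteq> 0\<close> by (auto simp: vec_eq_iff dg_mult_nth mult_dg_nth tv_nth z_def)
  ultimately show ?thesis by (auto intro!: mult_ok_mult mult_ok_dg)
qed

lemma mult_ok_colm: "mult_ok (colm i a)"
  by (rule colm_generated[where P=mult_ok, OF mult_ok_mult mult_ok_unitary[OF unitary_mat_1] mult_ok_tv])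

lemma mult_ok_rowm: "mult_ok (rowm i a)"
  by (rule rowm_generated[where P=mult_ok, OF mult_ok_mult mult_ok_unitary[OF unitary_mat_1] mult_ok_tv]) auto

lemma ext_mult_vec: "mult_ok X \<Longrightarrow> invertible Y \<Longrightarrow> ext (X ** Y) *v u = ext X *v (ext Y *v u)"
  by (simp add: mult_ok_def matrix_vector_mul_assoc)

lemma ext_dg_weight:
  assumes v: "\<And>z. cmod z = 1 \<Longrightarrow> \<rho> (dg i z) *v v = (z powi m) *s v" and z: "z \<noteq> 0"
  shows "ext (dg i z) *v v = (z powi m) *s v"
proof -
  have "(ext (dg i z) *v v) $ a = v $ a * z powi m" for a
  proof (rule laurent_eq_on_circle[OF _ laurent_cmult[OF laurent_powi] _ z])
    have "laurent (\<lambda>z. v $ b * ext (dg i z ** mat 1) $ a $ b)" for b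
      by (intro laurent_cmult laurent_ext_dg invertible_mat_1)
    then have "laurent (\<lambda>z. \<Sum>b\<in>UNIV. v $ b * ext (dg i z ** mat 1) $ a $ b)"
      by (intro laurent_sum)
    then show "laurent (\<lambda>z. (ext (dg i z) *v v) $ a)"
      by (simp add: matrix_vector_mult_nth mult.commute)
    fix z :: complex assume "cmod z = 1"
    then show "(ext (dg i z) *v v) $ a = v $ a * z powi m"
      using v ext_unitary[OF unitary_dg] by simp
  qed
  then show ?thesis by (simp add: vec_eq_iff mult.commute)
qed

text \<open>Conjugation by a torus element rescales \<open>s\<close> by the quotient of its entries
  at \<open>i\<close> and \<open>j\<close>. Each nonzero coefficient of \<open>s^r\<close> is
  therefore a weight vector, with a weight that \<open>nw\<close> excludes for
  \<open>r \<ge> 1\<close>. The polynomial is constant, and at \<open>s = 0\<close> it equals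
  \<open>v\<close>.\<close>

lemma ext_tv_fixes:
  assumes ij: "i \<noteq> j"
    and v: "\<And>t. t \<in> torus \<Longrightarrow> \<rho> t *v v = (\<Prod>l\<in>UNIV. (t $ l $ l) powi \<mu> l) *s v"
    and nw: "\<And>r::nat. r \<ge> 1 \<Longrightarrow> \<not> is_weight \<rho> (\<lambda>l. \<mu> l + (if l = i then int r else 0) - (if l = j then int r else 0))"
  shows "ext (tv i j s) *v v = v"
proof -
  obtain p where p: "\<And>a b s. ext (tv i j s) $ a $ b = poly (p a b) s"
    using ext_tv_poly[OF ij] by metis
  define q where "q a = (\<Sum>b\<in>UNIV. smult (v $ b) (p a b))" for a
  have q: "(ext (tv i j s) *v v) $ a = poly (q a) s" for a s
    by (simp add: q_def poly_sum matrix_vector_mult_nth p mult.commute)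
  define u where "u r = (\<chi> a. coeff (q a) r)" for r
  have "u r = 0" if r: "r \<ge> 1" for r
  proof (rule ccontr)
    assume "u r \<noteq> 0"
    let ?\<nu> = "\<lambda>l. \<mu> l + (if l = i then int r else 0) - (if l = j then int r else 0)"
    have "\<rho> t *v u r = (\<Prod>l\<in>UNIV. (t $ l $ l) powi ?\<nu> l) *s u r" if t: "t \<in> torus" for t
    proof -
      obtain f where f: "t = diagm f" "\<And>l. cmod (f l) = 1" using torusE[OF t] by metis
      have f0: "f l \<noteq> 0" for l using f(2)[of l] by auto
      have tu: "unitary_mat t" using t by (simp add: torus_def U_group_def)
      define e where "e = (\<Prod>l\<in>UNIV. (t $ l $ l) powi \<mu> l)"
      define x where "x = f i / f j"
      have "\<rho> t *v (ext (tv i j s) *v v) = e *s (ext (tv i j (x * s)) *v v)" for s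
      proof -
        have "diagm (\<lambda>p. 1 / f p) ** t = mat 1"
          unfolding f(1) diagm_mult using f0 by (simp add: diagm_1)
        then have "t ** tv i j s = tv i j (x * s) ** t"
          using diagm_tv_conj[of f i j s] f0 by (metis f(1) matrix_mul_assoc matrix_mul_rid x_def)
        then have "\<rho> t ** ext (tv i j s) = ext (tv i j (x * s)) ** \<rho> t"
          using ext_mult_left[OF tu invertible_tv[OF ij]] ext_mult_right[OF tu invertible_tv[OF ij]] by metis
        then have "\<rho> t *v (ext (tv i j s) *v v) = ext (tv i j (x * s)) *v (\<rho> t *v v)"
          by (simp add: matrix_vector_mul_assoc)
        then show ?thesis by (simp add: v[OF t] e_def matrix_vector_mult_scale)
      qed
      \<comment> \<open>Equality for all \<open>s\<close> is equality of polynomials; substituting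
        \<open>x * s\<close> multiplies the coefficient of \<open>s^r\<close> by
        \<open>x ^ r\<close>, which is exactly the weight shift.\<close>
      then have "poly (\<Sum>b\<in>UNIV. smult (\<rho> t $ a $ b) (q b)) s = poly (smult e (pcompose (q a) [:0, x:])) s" for a s
        by (simp add: vec_eq_iff matrix_vector_mult_nth[of "\<rho> t"] q poly_sum poly_pcompose mult.commute)
      then have "(\<Sum>b\<in>UNIV. smult (\<rho> t $ a $ b) (q b)) = smult e (pcompose (q a) [:0, x:])" for a
        by (intro poly_eq_poly_eq_iff[THEN iffD1]) auto
      then have "coeff (\<Sum>b\<in>UNIV. smult (\<rho> t $ a $ b) (q b)) r = e * (x ^ r * coeff (q a) r)" for a
        by (simp add: coeff_pcompose_linear)
      then have 1: "\<rho> t *v u r = (e * x ^ r) *s u r"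
        by (simp add: vec_eq_iff matrix_vector_mult_nth u_def coeff_sum mult.assoc)
      have "(\<Prod>l\<in>UNIV. (t $ l $ l) powi ?\<nu> l)
          = (\<Prod>l\<in>UNIV. (t $ l $ l) powi \<mu> l * ((if l = i then f l ^ r else 1) * (if l = j then 1 / f l ^ r else 1)))"
        using f0 by (intro prod.cong) (auto simp: f(1) diagm_nth power_int_add power_int_diff ij)
      also have "\<dots> = e * x ^ r"
        by (simp add: prod.distrib e_def x_def power_divide)
      finally show ?thesis using 1 by simp
    qed
    then have "is_weight \<rho> ?\<nu>" using \<open>u r \<noteq> 0\<close> unfolding is_weight_def by blast
    then show False using nw[OF r] by simp
  qed
  then have "coeff (q a) r = 0" if "r \<ge> 1" for a r
    using that unfolding u_def vec_eq_iff by (simp add: zero_vec_def)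
  then have "degree (q a) = 0" for a
    by (metis degree_0 leading_coeff_0_iff less_one linorder_not_le)
  then have const: "poly (q a) s = poly (q a) 0" for a
    using degree_eq_zeroE[of "q a"] by (metis poly_pCons mult_zero_right poly_0)
  have "(ext (tv i j s) *v v) $ a = (ext (tv i j 0) *v v) $ a" for a
    unfolding q by (rule const)
  then have "ext (tv i j s) *v v = ext (tv i j 0) *v v" by (simp add: vec_eq_iff)
  then show ?thesis by (simp add: ext_one)
qed

end

subsection \<open>The highest weight matrix coefficient\<close>

definition swapm :: "'n \<Rightarrow> 'n \<Rightarrow> complex^'n^'n" where
  "swapm i j = (\<chi> p q. if p = Transposition.transpose i j q then 1 else 0)"

lemma swapm_nth: "swapm i j $ p $ q = (if p = Transposition.transpose i j q then 1 else 0)"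
  by (simp add: swapm_def)

lemma swapm_mult_nth: "(swapm i j ** X) $ p $ q = X $ (Transposition.transpose i j p) $ q"
proof -
  have "(swapm i j ** X) $ p $ q = (\<Sum>k\<in>UNIV. if k = Transposition.transpose i j p then X $ k $ q else 0)"
    unfolding matrix_mult_nth by (intro sum.cong) (auto simp: swapm_nth)
  then show ?thesis by simp
qed

lemma mult_swapm_nth: "(X ** swapm i j) $ p $ q = X $ p $ (Transposition.transpose i j q)"
proof -
  have "(X ** swapm i j) $ p $ q = (\<Sum>k\<in>UNIV. if k = Transposition.transpose i j q then X $ p $ k else 0)"
    unfolding matrix_mult_nth by (intro sum.cong) (auto simp: swapm_nth)
  then show ?thesis by simp
qed

lemma swapm_swapm: "swapm i j ** swapm i j = mat 1"
  by (auto simp: vec_eq_iff swapm_mult_nth mat_1_nth swapm_nth transpose_eq_iff)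

lemma unitary_swapm: "unitary_mat (swapm i j)"
proof -
  have "cadj (swapm i j) = swapm i j"
    by (auto simp: vec_eq_iff swapm_nth)
  then show ?thesis by (simp add: unitary_mat_def swapm_swapm)
qed

text \<open>Permutation matrices normalise the torus, so they carry weight vectors to weight
  vectors: Weyl group symmetry of the weights.\<close>

lemma is_weight_swap:
  fixes \<rho> :: "complex^'n^'n \<Rightarrow> complex^'d^'d"
  assumes \<rho>: "unitary_rep \<rho>" and w: "is_weight \<rho> \<nu>"
  shows "is_weight \<rho> (\<nu> \<circ> Transposition.transpose i j)"
proof -
  let ?\<tau> = "Transposition.transpose i j" and ?S = "swapm i j :: complex^'n^'n"
  obtain v where v: "v \<noteq> 0" "\<And>t. t \<in> torus \<Longrightarrow> \<rho> t *v v = (\<Prod>i\<in>UNIV. (t $ i $ i) powi \<nu> i) *s v"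
    using w by (auto simp: is_weight_def)
  have S: "?S \<in> U_group" by (simp add: U_group_def unitary_swapm)
  have "\<rho> ?S *v v \<noteq> 0"
    using norm_unitary_mult[OF rep_unitary[OF \<rho> S], of v] v(1) by auto
  moreover have "\<rho> t *v (\<rho> ?S *v v) = (\<Prod>l\<in>UNIV. (t $ l $ l) powi (\<nu> \<circ> ?\<tau>) l) *s (\<rho> ?S *v v)"
    if t: "t \<in> torus" for t
  proof -
    obtain f where f: "t = diagm f" "\<And>l. cmod (f l) = 1" using torusE[OF t] by metis
    let ?t = "diagm (f \<circ> ?\<tau>)"
    have t': "?t \<in> torus" using f(2) by (intro diagm_in_torus) simp
    have "t ** ?S = ?S ** ?t"
      by (auto simp: f(1) vec_eq_iff diagm_mult_nth mult_diagm_nth swapm_nth)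
    then have "\<rho> t *v (\<rho> ?S *v v) = \<rho> ?S *v (\<rho> ?t *v v)"
      using rep_mult_vec[OF \<rho>] S t t' torus_subset by (metis subsetD)
    also have "\<dots> = (\<Prod>l\<in>UNIV. f (?\<tau> l) powi \<nu> l) *s (\<rho> ?S *v v)"
      by (simp add: v(2)[OF t'] matrix_vector_mult_scale diagm_nth)
    also have "(\<Prod>l\<in>UNIV. f (?\<tau> l) powi \<nu> l) = (\<Prod>l\<in>UNIV. f l powi \<nu> (?\<tau> l))"
      by (rule prod.reindex_bij_witness[of _ ?\<tau> ?\<tau>]) auto
    finally show ?thesis by (simp add: f(1) diagm_nth)
  qed
  ultimately show ?thesis unfolding is_weight_def by blast
qed

lemma block_matrix_inv:
  assumes X: "block M X" "invertible X" shows "block M (matrix_inv X)"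
proof -
  let ?Y = "matrix_inv X"
  have "?Y $ p $ q = (if p = q then 1 else 0)" if "p \<notin> M" for p q
  proof -
    have "(X ** ?Y) $ p $ q = (\<Sum>k\<in>UNIV. if p = k then ?Y $ k $ q else 0)"
      unfolding matrix_mult_nth using X(1) that by (intro sum.cong) (auto simp: block_def)
    then show ?thesis by (simp add: matrix_inv_mult_self(1)[OF X(2)] mat_1_nth split: if_splits)
  qed
  moreover have "?Y $ p $ q = (if p = q then 1 else 0)" if "q \<notin> M" for p q
  proof -
    have "(?Y ** X) $ p $ q = (\<Sum>k\<in>UNIV. if k = q then ?Y $ p $ k else 0)"
      unfolding matrix_mult_nth using X(1) that by (intro sum.cong) (auto simp: block_def)
    then show ?thesis by (simp add: matrix_inv_mult_self(2)[OF X(2)] mat_1_nth split: if_splits)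
  qed
  ultimately show ?thesis by (auto simp: block_def)
qed

lemma rowm_mult_nth_other: "p \<noteq> i \<Longrightarrow> (rowm i b ** X) $ p $ q = X $ p $ q"
proof -
  assume "p \<noteq> i"
  then have "(rowm i b ** X) $ p $ q = (\<Sum>k\<in>UNIV. if p = k then X $ k $ q else 0)"
    unfolding matrix_mult_nth by (intro sum.cong) (auto simp: rowm_nth)
  then show ?thesis by simp
qed

lemma mult_colm_nth_other: "q \<noteq> i \<Longrightarrow> (X ** colm i a) $ p $ q = X $ p $ q"
proof -
  assume "q \<noteq> i"
  then have "(X ** colm i a) $ p $ q = (\<Sum>k\<in>UNIV. if k = q then X $ p $ k else 0)"
    unfolding matrix_mult_nth by (intro sum.cong) (auto simp: colm_nth)
  then show ?thesis by simp
qed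

lemma invertible_colm: "invertible (colm i a)"
  by (rule invertibleI[OF colm_inverse])

lemma invertible_rowm: "invertible (rowm i a)"
  by (rule invertibleI[OF rowm_inverse])

lemma matrix_inv_colm: "matrix_inv (colm i a) = colm i (\<lambda>p. - a p)"
  by (rule matrix_inv_eqI[OF colm_inverse])

lemma matrix_inv_rowm: "matrix_inv (rowm i a) = rowm i (\<lambda>p. - a p)"
  by (rule matrix_inv_eqI[OF rowm_inverse])

text \<open>The pivot at \<open>i\<close> is taken in \<open>g\<close>, the one at \<open>j\<close> in the inverse: this puts the
  factors supported in row \<open>j\<close> to the left of those supported in column \<open>j\<close>.\<close>

lemma corner_decomposition:
  fixes g :: "complex^'n^'n"
  assumes g: "invertible g" and ij: "i \<noteq> j"
    and x: "g $ i $ i \<noteq> 0" and y: "matrix_inv g $ j $ j \<noteq> 0"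
  obtains a b a' b' Z where
    "g = colm i a ** (dg i (g $ i $ i) ** (rowm j b' ** (Z ** (dg j (1 / matrix_inv g $ j $ j) ** (colm j a' ** rowm i b)))))"
    "block (- {i, j}) Z" "invertible Z"
proof -
  let ?x = "g $ i $ i" and ?y = "matrix_inv g $ j $ j"
  have "block UNIV g" by (simp add: block_def)
  obtain a b X where dec: "g = colm i a ** (dg i ?x ** X) ** rowm i b" and X: "block (UNIV - {i}) X"
    by (rule pivot_decomposition[OF \<open>block UNIV g\<close> UNIV_I x]) blast
  have "invertible (colm i a ** (dg i ?x ** X) ** rowm i b)" using g dec by simp
  then have Xinv: "invertible X" by (simp only: invertible_mult_iff)
  have "matrix_inv g = rowm i (\<lambda>p. - b p) ** ((matrix_inv X ** dg i (1 / ?x)) ** colm i (\<lambda>p. - a p))"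
    by (subst dec) (simp add: matrix_inv_mult invertible_mult_iff invertible_colm invertible_rowm
        invertible_dg x Xinv matrix_inv_rowm matrix_inv_colm matrix_inv_dg matrix_mul_assoc)
  then have y_eq: "?y = matrix_inv X $ j $ j"
    using ij by (simp add: rowm_mult_nth_other mult_colm_nth_other mult_dg_nth)
  have bl: "block (UNIV - {i}) (matrix_inv X)" by (rule block_matrix_inv[OF X Xinv])
  have jM: "j \<in> UNIV - {i}" using ij by simp
  obtain a' b' Y where dec': "matrix_inv X = colm j a' ** (dg j ?y ** Y) ** rowm j b'"
    and Y: "block (UNIV - {i} - {j}) Y"
    unfolding y_eq by (rule pivot_decomposition[OF bl jM y[unfolded y_eq]]) blast
  have "invertible (matrix_inv X)" using matrix_inv_mult_self(2)[OF Xinv] by (rule invertibleI)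
  then have "invertible (colm j a' ** (dg j ?y ** Y) ** rowm j b')" using dec' by simp
  then have Yinv: "invertible Y" by (simp only: invertible_mult_iff)
  have "X = matrix_inv (matrix_inv X)"
    using matrix_inv_eqI[OF matrix_inv_mult_self(2)[OF Xinv]] by simp
  also have "\<dots> = rowm j (\<lambda>p. - b' p) ** (matrix_inv Y ** (dg j (1 / ?y) ** colm j (\<lambda>p. - a' p)))"
    by (subst dec') (simp add: matrix_inv_mult invertible_mult_iff invertible_colm invertible_rowm
        invertible_dg y Yinv matrix_inv_rowm matrix_inv_colm matrix_inv_dg matrix_mul_assoc)
  finally have X_eq: "X = rowm j (\<lambda>p. - b' p) ** (matrix_inv Y ** (dg j (1 / ?y) ** colm j (\<lambda>p. - a' p)))" .
  have "g = colm i a ** (dg i ?x ** (rowm j (\<lambda>p. - b' p) ** (matrix_inv Y ** (dg j (1 / ?y) ** (colm j (\<lambda>p. - a' p) ** rowm i b)))))"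
    by (subst dec, subst X_eq) (simp add: matrix_mul_assoc)
  moreover have "block (- {i, j}) (matrix_inv Y)"
    using block_matrix_inv[OF Y Yinv] by (simp add: Compl_eq_Diff_UNIV Diff_insert2[symmetric])
  moreover have "invertible (matrix_inv Y)" using matrix_inv_mult_self(2)[OF Yinv] by (rule invertibleI)
  ultimately show thesis by (rule that)
qed

lemma mult_emb2_nth:
  assumes "i \<noteq> j"
  shows "(X ** emb2 i j a b c d) $ p $ q =
    (if q = i then X $ p $ i * a + X $ p $ j * c else if q = j then X $ p $ i * b + X $ p $ j * d else X $ p $ q)"
proof -
  have "(X ** emb2 i j a b c d) $ p $ q = (\<Sum>k\<in>UNIV.
     (if k = i then (if q = i then X $ p $ i * a else if q = j then X $ p $ i * b else 0) else 0)
     + (if k = j then (if q = i then X $ p $ j * c else if q = j then X $ p $ j * d else 0) else 0)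
     + (if k = q then (if q = i \<or> q = j then 0 else X $ p $ q) else 0))"
    unfolding matrix_mult_nth using assms by (intro sum.cong) (auto simp: emb2_def)
  then show ?thesis using assms by (auto simp: sum.distrib)
qed

lemma half_sqrt_sq: "complex_of_real (1 / sqrt 2) * complex_of_real (1 / sqrt 2) = 1 / 2"
  by (simp add: of_real_mult[symmetric] del: of_real_mult)

lemma Min_neq_Max_UNIV:
  assumes "CARD('n::{finite,linorder}) \<ge> 2" shows "Min (UNIV :: 'n set) \<noteq> Max UNIV"
proof
  assume eq: "Min (UNIV :: 'n set) = Max UNIV"
  have "x = Min UNIV" for x :: 'n
    using Min_le[of UNIV x] Max_ge[of UNIV x] eq by (simp add: antisym)
  then have "(UNIV :: 'n set) = {Min UNIV}" by auto
  then have "CARD('n) = 1" by (metis card_1_singleton_iff One_nat_def)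
  then show False using assms by simp
qed

locale highest_weight_extension = rep_extension \<rho> N c
  for \<rho> :: "complex^('n::{finite,linorder})^('n::{finite,linorder}) \<Rightarrow> complex^'d^'d" and N c +
  fixes k :: int and v :: "complex^'d"
  assumes card: "CARD('n) \<ge> 2"
    and highest: "\<And>\<nu>. is_weight \<rho> \<nu> \<Longrightarrow> lex_le \<nu> (hw_k k)"
    and v0: "v \<noteq> 0"
    and v: "\<And>t. t \<in> torus \<Longrightarrow> \<rho> t *v v = (\<Prod>i\<in>UNIV. (t $ i $ i) powi hw_k k i) *s v"
begin

abbreviation lo :: 'n where "lo \<equiv> Min UNIV"
abbreviation hi :: 'n where "hi \<equiv> Max UNIV"

lemma lo_hi: "lo \<noteq> hi"
  using card by (rule Min_neq_Max_UNIV)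

text \<open>For \<open>i < j\<close> the shifted weight would exceed the highest one
  lexicographically. For \<open>j < i\<close> both indices lie strictly between \<open>lo\<close>
  and \<open>hi\<close>, where \<open>hw_k\<close> vanishes, and a swap reduces to the first
  case.\<close>

lemma tv_fixes_v:
  assumes ij: "i \<noteq> j" and "j \<noteq> lo" "i \<noteq> hi"
  shows "ext (tv i j s) *v v = v"
proof (rule ext_tv_fixes[OF ij v])
  fix r :: nat assume r: "r \<ge> 1"
  have up: "\<not> is_weight \<rho> (\<lambda>l. hw_k k l + (if l = i then int r else 0) - (if l = j then int r else 0))"
    if "i < j" for i j
  proof
    let ?\<nu> = "\<lambda>l. hw_k k l + (if l = i then int r else 0) - (if l = j then int r else 0)"
    assume "is_weight \<rho> ?\<nu>"
    then have "lex_le ?\<nu> (hw_k k)" by (rule highest)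
    moreover have "?\<nu> \<noteq> hw_k k"
    proof
      assume "?\<nu> = hw_k k"
      from fun_cong[OF this, of i] show False using r that by (auto split: if_splits)
    qed
    ultimately obtain l where l: "?\<nu> l < hw_k k l" "\<forall>m<l. ?\<nu> m = hw_k k m"
      unfolding lex_le_def by blast
    \<comment> \<open>Only the entry at \<open>j\<close> decreases, but the larger entry at the
      earlier index \<open>i\<close> already decides the order.\<close>
    have "l = j" using l(1) by (auto split: if_splits)
    then have "?\<nu> i = hw_k k i" using l(2) that by blast
    then show False using r that by (auto split: if_splits)
  qed
  show "\<not> is_weight \<rho> (\<lambda>l. hw_k k l + (if l = i then int r else 0) - (if l = j then int r else 0))"
  proof (cases "i < j")
    case True then show ?thesis by (rule up)
  next
    case False
    then have ji: "j < i" using ij by simp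
    have "lo \<le> j" "i \<le> hi" by simp_all
    then have "i \<noteq> lo" "j \<noteq> hi" using ji by auto
    then have zero: "hw_k k i = 0" "hw_k k j = 0" using assms by (auto simp: hw_k_def)
    let ?\<nu> = "\<lambda>l. hw_k k l + (if l = i then int r else 0) - (if l = j then int r else 0)"
    have "?\<nu> \<circ> Transposition.transpose i j
        = (\<lambda>l. hw_k k l + (if l = j then int r else 0) - (if l = i then int r else 0))"
      using ij zero by (auto simp: fun_eq_iff Transposition.transpose_def)
    then show ?thesis using up[OF ji] is_weight_swap[OF rep, of ?\<nu> i j] by auto
  qed
qed

lemma dg_v:
  assumes "z \<noteq> 0" shows "ext (dg i z) *v v = (z powi hw_k k i) *s v"
proof (rule ext_dg_weight[OF _ assms])
  fix z :: complex assume "cmod z = 1"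
  then have "dg i z \<in> torus" unfolding dg_def by (intro diagm_in_torus) auto
  moreover have "(\<Prod>l\<in>UNIV. (dg i z $ l $ l) powi hw_k k l) = (\<Prod>l\<in>UNIV. if l = i then z powi hw_k k l else 1)"
    by (intro prod.cong) (auto simp: dg_nth)
  ultimately show "\<rho> (dg i z) *v v = (z powi hw_k k i) *s v" using v by simp
qed

text \<open>Multiplicativity is bundled with fixing \<open>v\<close> so that the predicate is closed
  under products, as the generation lemmas require.\<close>

definition fixes_v :: "complex^('n::{finite,linorder})^('n::{finite,linorder}) \<Rightarrow> bool" where
  "fixes_v X \<longleftrightarrow> mult_ok X \<and> ext X *v v = v"

lemma fixes_v_mult: "fixes_v X \<Longrightarrow> fixes_v Y \<Longrightarrow> fixes_v (X ** Y)"
  by (simp add: fixes_v_def mult_ok_mult) (simp add: mult_ok_def matrix_vector_mul_assoc[symmetric])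

lemma fixes_v_one: "fixes_v (mat 1)"
  by (simp add: fixes_v_def mult_ok_unitary ext_one)

lemma fixes_v_tv: "i \<noteq> j \<Longrightarrow> j \<noteq> lo \<Longrightarrow> i \<noteq> hi \<Longrightarrow> fixes_v (tv i j s)"
  by (simp add: fixes_v_def mult_ok_tv tv_fixes_v)

lemma fixes_v_rowm: "fixes_v (rowm lo b)"
  by (rule rowm_generated[where P=fixes_v, OF fixes_v_mult fixes_v_one fixes_v_tv]) (use lo_hi in auto)

lemma fixes_v_colm: "fixes_v (colm hi a)"
  by (rule colm_generated[where P=fixes_v, OF fixes_v_mult fixes_v_one fixes_v_tv]) (use lo_hi in auto)

lemma fixes_v_block:
  assumes "block (- {lo, hi}) Z" "invertible Z" shows "fixes_v Z"
proof (rule block_generated[OF fixes_v_mult fixes_v_one _ _ assms])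
  fix i j s assume "i \<in> - {lo, hi}" "j \<in> - {lo, hi}" "i \<noteq> j"
  then show "fixes_v (tv i j s)" by (intro fixes_v_tv) auto
next
  fix i and z :: complex assume "i \<in> - {lo, hi}" "z \<noteq> 0"
  then show "fixes_v (dg i z)" by (simp add: fixes_v_def mult_ok_dg dg_v hw_k_def)
qed

lemma cinner_v_ext_mult:
  assumes "mult_ok X" "invertible Y"
  shows "cinner v (ext (X ** Y) *v v) = cinner (ext (cadj X) *v v) (ext Y *v v)"
proof -
  have "ext (X ** Y) *v v = ext X *v (ext Y *v v)"
    using assms by (simp add: mult_ok_def matrix_vector_mul_assoc)
  then show ?thesis
    using assms by (simp add: cinner_cadj_left[of "ext X", symmetric] ext_cadj mult_ok_def)
qed

text \<open>The right-hand factors \<open>colm hi\<close> and \<open>rowm lo\<close> and the middle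
  block fix \<open>v\<close>. The left-hand factors \<open>colm lo\<close> and
  \<open>rowm hi\<close> have adjoints that fix \<open>v\<close>, so they are moved across the inner
  product. Only the two dilations leave a trace.\<close>

lemma highest_coefficient:
  assumes g: "invertible g" and x: "g $ lo $ lo \<noteq> 0" and y: "matrix_inv g $ hi $ hi \<noteq> 0"
  shows "cinner v (ext g *v v) = (g $ lo $ lo * matrix_inv g $ hi $ hi) powi k * cinner v v"
proof -
  let ?x = "g $ lo $ lo" and ?y = "matrix_inv g $ hi $ hi"
  obtain a b a' b' Z where dec: "g = colm lo a ** (dg lo ?x ** (rowm hi b' ** (Z ** (dg hi (1 / ?y) ** (colm hi a' ** rowm lo b)))))"
    and Z: "block (- {lo, hi}) Z" "invertible Z"
    by (rule corner_decomposition[OF g lo_hi x y]) blast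
  define R1 where "R1 = colm hi a' ** rowm lo b"
  define R2 where "R2 = dg hi (1 / ?y) ** R1"
  define R3 where "R3 = Z ** R2"
  define R4 where "R4 = rowm hi b' ** R3"
  define R5 where "R5 = dg lo ?x ** R4"
  have inv: "invertible R1" "invertible R2" "invertible R3" "invertible R4" "invertible R5"
    unfolding R5_def R4_def R3_def R2_def R1_def invertible_mult_iff
    using x y Z(2) by (simp_all add: invertible_colm invertible_rowm invertible_dg)
  have R1: "ext R1 *v v = v"
    using fixes_v_mult[OF fixes_v_colm fixes_v_rowm] by (simp add: R1_def fixes_v_def)
  have hw: "hw_k k lo = k" "hw_k k hi = - k" using lo_hi by (auto simp: hw_k_def)
  \<comment> \<open>At \<open>hi\<close> the weight is \<open>- k\<close> and the dilation is by
    \<open>1 / ?y\<close>; the two inversions cancel.\<close>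
  have R2: "ext R2 *v v = (?y powi k) *s v"
    unfolding R2_def using y inv by (simp add: ext_mult_vec mult_ok_dg R1 dg_v hw power_int_minus power_int_divide_distrib)
  have R3: "ext R3 *v v = (?y powi k) *s v"
    unfolding R3_def using fixes_v_block[OF Z] inv
    by (simp add: ext_mult_vec R2 fixes_v_def matrix_vector_mult_scale)
  have "cinner v (ext g *v v) = cinner v (ext (colm lo a ** R5) *v v)"
    unfolding R5_def R4_def R3_def R2_def R1_def by (subst dec) simp
  also have "\<dots> = cinner v (ext R5 *v v)"
    using fixes_v_rowm by (simp add: cinner_v_ext_mult mult_ok_colm inv cadj_colm fixes_v_def)
  also have "\<dots> = ?x powi k * cinner v (ext R4 *v v)"
    unfolding R5_def using x inv
    by (simp add: cinner_v_ext_mult mult_ok_dg cadj_dg dg_v hw cinner_scale_left)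
  also have "cinner v (ext R4 *v v) = cinner v (ext R3 *v v)"
    unfolding R4_def using fixes_v_colm by (simp add: cinner_v_ext_mult mult_ok_rowm inv cadj_rowm fixes_v_def)
  also have "\<dots> = ?y powi k * cinner v v" by (simp add: R3 cinner_scale_right)
  finally show ?thesis by (simp add: power_int_mult_distrib)
qed

section \<open>Positivity along the Hadamard conjugate, and the fixed vectors\<close>

definition hadamard :: "complex^('n::{finite,linorder})^('n::{finite,linorder})" where
  "hadamard = (let s = complex_of_real (1 / sqrt 2) in emb2 lo hi s s s (- s))"

lemma cadj_hadamard: "cadj hadamard = hadamard"
  using lo_hi by (auto simp: hadamard_def Let_def vec_eq_iff emb2_nth)

lemma unitary_hadamard: "unitary_mat hadamard"
  unfolding hadamard_def Let_def using lo_hi half_sqrt_sq by (intro unitary_emb2) (simp_all add: field_simps)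

text \<open>The reflection makes the two corner entries coincide. As the inverse of a unitary matrix
  is its adjoint, the product in \<open>highest_coefficient\<close> becomes a squared
  modulus.\<close>

lemma hadamard_conj_nth:
  assumes A: "A \<in> U_sub (- {lo})"
  shows "(hadamard ** A ** hadamard) $ lo $ lo = (1 + A $ hi $ hi) / 2"
    and "(hadamard ** A ** hadamard) $ hi $ hi = (1 + A $ hi $ hi) / 2"
proof -
  have A: "A $ lo $ lo = 1" "A $ lo $ hi = 0" "A $ hi $ lo = 0"
    using A lo_hi by (auto simp: U_sub_def)
  define s where "s = complex_of_real (1 / sqrt 2)"
  have s: "s * s = 1 / 2" unfolding s_def by (rule half_sqrt_sq)
  have r: "hadamard = emb2 lo hi s s s (- s)" by (simp add: hadamard_def s_def Let_def)
  have "(hadamard ** A ** hadamard) $ lo $ lo = s * s * (1 + A $ hi $ hi)"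
    unfolding r using lo_hi A by (simp add: mult_emb2_nth emb2_mult_nth algebra_simps)
  then show "(hadamard ** A ** hadamard) $ lo $ lo = (1 + A $ hi $ hi) / 2" by (simp add: s)
  have "(hadamard ** A ** hadamard) $ hi $ hi = s * s * (1 + A $ hi $ hi)"
    unfolding r using lo_hi A by (simp add: mult_emb2_nth emb2_mult_nth algebra_simps)
  then show "(hadamard ** A ** hadamard) $ hi $ hi = (1 + A $ hi $ hi) / 2" by (simp add: s)
qed

definition coef :: "complex^('n::{finite,linorder})^('n::{finite,linorder}) \<Rightarrow> real" where
  "coef A = Re (cinner (\<rho> hadamard *v v) (\<rho> A *v (\<rho> hadamard *v v)))"

lemma coef_eq:
  assumes "A \<in> U_group" shows "coef A = Re (cinner v (\<rho> (hadamard ** A ** hadamard) *v v))"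
proof -
  have R: "hadamard \<in> U_group" by (simp add: U_group_def unitary_hadamard)
  have "cadj (\<rho> hadamard) = \<rho> hadamard" using rep_cadj[OF rep R] by (simp add: cadj_hadamard)
  then have "cinner (\<rho> hadamard *v v) (\<rho> A *v (\<rho> hadamard *v v)) = cinner v (\<rho> hadamard *v (\<rho> A *v (\<rho> hadamard *v v)))"
    by (rule cinner_hermitian)
  then show ?thesis
    by (simp add: coef_def rep_mult_vec[OF rep] R assms mult_in_U_group)
qed

text \<open>The excluded value is where both pivots of \<open>highest_coefficient\<close> vanish.
  Elsewhere the coefficient is an integer power of a squared modulus times the squared norm of
  \<open>v\<close>.\<close>

lemma coef_nonneg_generic:
  assumes A: "A \<in> U_sub (- {lo})" and ne: "A $ hi $ hi \<noteq> - 1"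
  shows "coef A \<ge> 0"
proof -
  let ?g = "hadamard ** A ** hadamard"
  have g: "unitary_mat ?g" using U_sub_unitary[OF A] unitary_hadamard by (intro mult_unitary)
  have "cadj ?g = hadamard ** cadj A ** hadamard"
    by (simp add: cadj_mult cadj_hadamard matrix_mul_assoc)
  then have inv: "matrix_inv ?g $ hi $ hi = (1 + cnj (A $ hi $ hi)) / 2"
    using hadamard_conj_nth(2)[OF cadj_in_U_sub[OF A]] by (simp add: matrix_inv_unitary[OF g])
  have ne': "1 + A $ hi $ hi \<noteq> 0" using ne by (simp add: add_eq_0_iff)
  moreover have "1 + cnj (A $ hi $ hi) = cnj (1 + A $ hi $ hi)" by simp
  ultimately have ne'': "1 + cnj (A $ hi $ hi) \<noteq> 0" by (metis complex_cnj_zero_iff)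
  have prod: "?g $ lo $ lo * matrix_inv ?g $ hi $ hi = of_real ((cmod ((1 + A $ hi $ hi) / 2))\<^sup>2)"
    unfolding complex_norm_square hadamard_conj_nth(1)[OF A] inv by simp
  have "cinner v (ext ?g *v v) = (?g $ lo $ lo * matrix_inv ?g $ hi $ hi) powi k * cinner v v"
    by (rule highest_coefficient) (use g ne' ne'' in \<open>auto simp: invertible_unitary hadamard_conj_nth(1)[OF A] inv\<close>)
  also have "\<dots> = of_real (((cmod ((1 + A $ hi $ hi) / 2))\<^sup>2) powi k * (norm v)\<^sup>2)"
    unfolding prod cinner_self by simp
  finally have "coef A = ((cmod ((1 + A $ hi $ hi) / 2))\<^sup>2) powi k * (norm v)\<^sup>2"
    using A U_sub_subset by (subst coef_eq) (auto simp: ext_unitary[OF g] simp del: of_real_mult of_real_power)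
  then show ?thesis by simp
qed

lemma continuous_on_coef: "continuous_on (U_sub B) coef"
  unfolding coef_def by (intro continuous_intros rep_continuous rep)

text \<open>Exceptional \<open>A\<close> are limits of generic ones in the same subgroup, obtained
  by rotating the last coordinate slightly; continuity of \<open>coef\<close> carries the inequality
  over.\<close>

lemma coef_nonneg:
  assumes A: "A \<in> U_sub (- {lo})" shows "coef A \<ge> 0"
proof (cases "A $ hi $ hi = - 1")
  case False
  then show ?thesis using A by (intro coef_nonneg_generic)
next
  case True
  \<comment> \<open>These angles tend to 0 and lie in \<open>(0, pi)\<close>, so the sine is
    positive and \<open>t n\<close> is never 1.\<close>
  define t where "t n = cis (1 / real (Suc n))" for n
  define S where "S n = A ** dg hi (t n)" for n
  have S: "S n \<in> U_sub (- {lo})" for n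
  proof -
    have "dg hi (t n) \<in> U_sub {hi}"
      unfolding dg_def by (rule diagm_in_U_sub_singleton) (simp add: t_def)
    then have "dg hi (t n) \<in> U_sub (- {lo})" using U_sub_mono[of "{hi}" "- {lo}"] lo_hi by auto
    then show ?thesis unfolding S_def by (rule mult_in_U_sub[OF A])
  qed
  have "S n $ hi $ hi \<noteq> - 1" for n
  proof
    assume "S n $ hi $ hi = - 1"
    then have "t n = 1" using True by (simp add: S_def mult_dg_nth)
    then have "sin (1 / real (Suc n)) = 0" by (simp add: t_def complex_eq_iff)
    moreover have "sin (1 / real (Suc n)) > 0"
    proof (rule sin_gt_zero)
      have "1 / real (Suc n) \<le> 1" by simp
      then show "1 / real (Suc n) < pi" using pi_gt3 by linarith
    qed simp
    ultimately show False by simp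
  qed
  then have nonneg: "0 \<le> coef (S n)" for n using S by (intro coef_nonneg_generic)
  have "(\<lambda>n. 1 / real (Suc n)) \<longlonglongrightarrow> 0" by (rule LIMSEQ_Suc[OF lim_1_over_n])
  then have "(\<lambda>n. exp (\<i> * of_real (1 / real (Suc n)))) \<longlonglongrightarrow> exp (\<i> * of_real 0)"
    by (intro tendsto_intros)
  then have t: "t \<longlonglongrightarrow> 1" by (simp add: t_def[abs_def] cis_conv_exp)
  have "S \<longlonglongrightarrow> A"
  proof (rule vec_tendstoI, rule vec_tendstoI)
    fix p q
    have "(\<lambda>n. A $ p $ q * (if q = hi then t n else 1)) \<longlonglongrightarrow> A $ p $ q * (if q = hi then 1 else 1)"
      using tendsto_mult[OF tendsto_const[of "A $ p $ q"] t] by (cases "q = hi") auto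
    then show "(\<lambda>n. S n $ p $ q) \<longlonglongrightarrow> A $ p $ q" by (simp add: S_def mult_dg_nth)
  qed
  then have "(\<lambda>n. coef (S n)) \<longlonglongrightarrow> coef A"
    using S by (intro continuous_on_tendsto_compose[OF continuous_on_coef _ A]) auto
  then show ?thesis using nonneg by (intro LIMSEQ_le_const) auto
qed

text \<open>Pairing the average with the rotated vector reduces its nonvanishing to positivity of
  the integral of \<open>coef\<close>.\<close>

lemma fixed_vector_lo: "\<exists>x. x \<noteq> 0 \<and> (\<forall>g\<in>U_sub (- {lo}). \<rho> g *v x = x)"
proof -
  let ?u = "\<rho> hadamard *v v"
  let ?x = "rep_avg \<rho> (- {lo}) *v ?u"
  have R: "hadamard \<in> U_group" by (simp add: U_group_def unitary_hadamard)
  have "coef (mat 1) > 0"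
  proof -
    have "?u \<noteq> 0" using norm_unitary_mult[OF rep_unitary[OF rep R], of v] v0 by auto
    then show ?thesis by (simp add: coef_def rep_one[OF rep] cinner_self del: of_real_power)
  qed
  then have "0 < (LINT A|haar_measure (- {lo}). coef A)"
    by (intro integral_haar_pos continuous_on_coef coef_nonneg)
  also have "\<dots> = Re (cinner ?u ?x)"
    unfolding rep_avg_def coef_def
    by (rule integral_haar_linear[symmetric, where T="\<lambda>Z. Re (cinner ?u (Z *v ?u))"])
       (auto intro!: rep_continuous rep linearI simp: matrix_vector_mult_add_rdistrib cinner_add_right
          scaleR_matrix_vector_mult cinner_scaleR_right)
  finally have "?x \<noteq> 0" by auto
  moreover have "\<rho> g *v ?x = ?x" if "g \<in> U_sub (- {lo})" for g
    by (subst matrix_vector_mul_assoc) (simp only: rep_mult_rep_avg[OF rep that])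
  ultimately show ?thesis by blast
qed

text \<open>Conjugation by a transposition matrix carries \<open>U_sub (- {i})\<close> into
  \<open>U_sub (- {lo})\<close>, so the swapped vector does the job.\<close>

lemma fixed_vector: "\<exists>x. x \<noteq> 0 \<and> (\<forall>g\<in>U_sub (- {i}). \<rho> g *v x = x)"
proof -
  obtain x where x: "x \<noteq> 0" "\<And>g. g \<in> U_sub (- {lo}) \<Longrightarrow> \<rho> g *v x = x" using fixed_vector_lo by blast
  let ?S = "swapm lo i :: complex^('n::{finite,linorder})^('n::{finite,linorder})"
  have S: "?S \<in> U_group" by (simp add: U_group_def unitary_swapm)
  have "\<rho> g *v (\<rho> ?S *v x) = \<rho> ?S *v x" if g: "g \<in> U_sub (- {i})" for g
  proof -
    let ?g = "?S ** g ** ?S"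
    have gU: "g \<in> U_group" using g U_sub_subset by auto
    have \<tau>: "Transposition.transpose lo i x = i \<longleftrightarrow> x = lo" for x
      by (auto simp: Transposition.transpose_def)
    have "g $ p $ q = (if p = q then 1 else 0)" if "p = i \<or> q = i" for p q
      using g that by (auto simp: U_sub_def)
    then have "?g $ p $ q = (if p = q then 1 else 0)" if "p = lo \<or> q = lo" for p q
      using that \<tau>[of p] \<tau>[of q] by (auto simp: mult_swapm_nth swapm_mult_nth)
    then have g': "?g \<in> U_sub (- {lo})"
      using S gU by (auto simp: U_sub_def intro!: mult_in_U_group)
    have "?S ** ?g = g ** ?S" by (simp add: matrix_mul_assoc swapm_swapm)
    then have "\<rho> g *v (\<rho> ?S *v x) = \<rho> ?S *v (\<rho> ?g *v x)"
      using rep_mult_vec[OF rep] S gU g' U_sub_subset by (metis subsetD)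
    then show ?thesis by (simp add: x(2)[OF g'])
  qed
  moreover have "\<rho> ?S *v x \<noteq> 0"
    using norm_unitary_mult[OF rep_unitary[OF rep S], of x] x(1) by auto
  ultimately show ?thesis by blast
qed

end

text \<open>Eigenvalues of the restriction to the complement are represented by eigenvectors lying
  in it. Real \<open>\<alpha>\<close> cover all of them, since the Laplacian of a unitary
  representation is Hermitian.\<close>

theorem theorem1p10:
  fixes w :: "'n::{finite,linorder} set \<Rightarrow> real"
    and k :: int
    and \<rho> :: "complex^('n::{finite,linorder})^('n::{finite,linorder}) \<Rightarrow> complex^'d^'d"
    and \<rho>k :: "complex^('n::{finite,linorder})^('n::{finite,linorder}) \<Rightarrow> complex^'e^'e"
  assumes "CARD('n) \<ge> 2"
    and "\<forall>B. w B \<ge> 0"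
    and "k \<ge> 1"
    and "irreducible_rep \<rho>k" and "highest_weight \<rho>k (hw_k k)"
    and "irreducible_rep \<rho>"
  shows "(\<forall>(\<alpha>::real) v. v \<noteq> 0 \<and> v \<in> orth_compl (tor_inv \<rho>)
            \<and> hyper_laplacian w \<rho> *v v = \<alpha> *\<^sub>R v \<longrightarrow> lambda_min w \<rho>k \<le> \<alpha>)
       \<and> (unbalanced \<rho> \<longrightarrow> lambda_min w \<rho>k \<le> lambda_min w \<rho>)"
proof -
  have \<rho>k: "unitary_rep \<rho>k" and \<rho>: "unitary_rep \<rho>"
    using assms by (auto simp: irreducible_rep_def)
  have w: "w B \<ge> 0" for B using assms(2) by simp
  obtain N c where "rep_extension \<rho>k N c" using rep_extension_exists[OF assms(4)] by metis
  moreover obtain u where "u \<noteq> 0"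
      "\<And>t. t \<in> torus \<Longrightarrow> \<rho>k t *v u = (\<Prod>i\<in>UNIV. (t $ i $ i) powi hw_k k i) *s u"
    using assms(5) by (auto simp: highest_weight_def is_weight_def)
  ultimately interpret highest_weight_extension \<rho>k N c k u
    using assms(1,5) by (auto simp: highest_weight_extension_def highest_weight_extension_axioms_def highest_weight_def)
  have main: "lambda_min w \<rho>k \<le> \<alpha>"
    if v: "v \<noteq> 0" "v \<in> orth_compl (tor_inv \<rho>)" "hyper_laplacian w \<rho> *v v = \<alpha> *\<^sub>R v" for \<alpha> v
  proof -
    \<comment> \<open>The coordinate comes from \<open>\<rho>\<close> and \<open>v\<close>; the test
      vector for \<open>\<rho>k\<close> is then taken for this same \<open>i\<close>.\<close>
    obtain i where i: "(\<Sum>B\<in>{B. i \<in> B}. w B) \<le> \<alpha>" using eigenvalue_ge_degree[OF \<rho> w v] .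
    obtain x where "x \<noteq> 0" "\<And>g. g \<in> U_sub (- {i}) \<Longrightarrow> \<rho>k g *v x = x" using fixed_vector[of i] by blast
    then have "lambda_min w \<rho>k \<le> (\<Sum>B\<in>{B. i \<in> B}. w B)" by (intro lambda_min_le_degree[OF \<rho>k w]) auto
    then show ?thesis using i by simp
  qed
  moreover have "lambda_min w \<rho>k \<le> lambda_min w \<rho>" if "unbalanced \<rho>"
  proof -
    obtain v where v: "v \<noteq> 0" "hyper_laplacian w \<rho> *v v = lambda_min w \<rho> *\<^sub>R v"
      using lambda_min_eigenvector[OF \<rho>] .
    \<comment> \<open>With no nonzero torus invariants, an eigenvector for the smallest eigenvalue
      lies in the complement automatically.\<close>
    have "orth_compl (tor_inv \<rho>) = UNIV"
      using unbalanced_tor_inv[OF assms(6) that] by (simp add: orth_compl_def)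
    then show ?thesis using main v by blast
  qed
  ultimately show ?thesis by blast
qed

end
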